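(* Let $(\mathcal X,\mathcal E)$ be a $\mathbb Z^d$-periodic connected graph, $F$ an admissible cost function (as in the context), and $\mathcal I\subset\mathbb R$ a bounded open interval. Let $\boldsymbol m^\varepsilon:\mathcal I\to\mathbb R_+^{\mathcal X_\varepsilon}$ be curves such that $$\sup_{\varepsilon>0}\mathcal A^{\mathcal I}_\varepsilon(\boldsymbol m^\varepsilon)<\infty\quad\text{and}\quad\sup_{\varepsilon>0}\boldsymbol m^\varepsilon(\mathcal I\times\mathcal X_\varepsilon)<\infty.$$ Then there exists a curve $(\mu_t)_{t\in\mathcal I}\in\mathrm{BV}_{\rm KR}(\mathcal I;\mathcal M_+(\mathbb T^d))$ such that, writing $\boldsymbol\mu(dx,dt)=\mu_t(dx)\,dt$ and up to extracting a subsequence ($\varepsilon\to0$), (i) $\iota_\varepsilon\boldsymbol m^\varepsilon\to\boldsymbol\mu$ weakly in $\mathcal M_+(\mathcal I\times\mathbb T^d)$; (ii) $\iota_\varepsilon m^\varepsilon_t\to\mu_t$ weakly in $\mathcal M_+(\mathbb T^d)$ for almost every $t\in\mathcal I$; (iii) $t\mapsto\mu_t(\mathbb T^d)$ is constant.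
   Context: **Graph.** $\mathcal X=\mathbb Z^d\times V$ with $V$ a finite nonempty set; for $x=(z,v)$ write $x_{\mathsf z}=z$. The edge set $\mathcal E\subseteq\mathcal X\times\mathcal X$ is symmetric and $\mathbb Z^d$-periodic (invariant under the shifts $(z,v)\mapsto(\bar z+z,v)$ applied to both endpoints); $(\mathcal X,\mathcal E)$ is connected, locally finite, of bounded degree; $x\sim y$ means $(x,y)\in\mathcal E$. $R_0=\max_{(x,y)\in\mathcal E}|x_{\mathsf z}-y_{\mathsf z}|_{\infty}$. $\mathcal E^Q=\{(x,y)\in\mathcal E:x_{\mathsf z}=0\}$. $\mathbb R_+=[0,\infty)$; $\mathbb R_a^{\mathcal E}$: antisymmetric functions $J:\mathcal E\to\mathbb R$; $\operatorname{div}J(x)=\sum_{y\sim x}J(x,y)$. **Admissible cost.** $F:\mathbb R_+^{\mathcal X}\times\mathbb R_a^{\mathcal E}\to\mathbb R\cup\{+\infty\}$ satisfies: (a) convex and lower semicontinuous; (b) local: there is $R_1<\infty$ such that $F(m,J)=F(m',J')$ whenever $m=m'$ on $\{|x_{\mathsf z}|_\infty\le R_1\}$ and $J=J'$ on $\{(x,y)\in\mathcal E:|x_{\mathsf z}|_\infty,|y_{\mathsf z}|_\infty\le R_1\}$; (c) there are $c>0$, $C<\infty$ with $F(m,J)\ge c\sum_{(x,y)\in\mathcal E^Q}|J(x,y)|-C\big(1+\sum_{|x_{\mathsf z}|_\infty\le R}m(x)\big)$, $R=\max\{R_0,R_1\}$; (d) there are a $\mathbb Z^d$-periodic $m^\circ\in\mathbb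 R_+^{\mathcal X}$ and a $\mathbb Z^d$-periodic divergence-free $J^\circ\in\mathbb R_a^{\mathcal E}$ with $(m^\circ,J^\circ)\in\mathsf D(F)^\circ$, where $\mathsf D(F)=\{F<\infty\}$ and the interior is taken in the finite-dimensional Euclidean space of the finitely many parameters on which $F$ depends. **Rescaled graph and energies.** Throughout $\varepsilon>0$ with $1/\varepsilon\in\mathbb N$, $\varepsilon R_0<\frac12$. $\mathbb Z^d_\varepsilon=(\mathbb Z/\frac1\varepsilon\mathbb Z)^d$, $\mathbb T^d_\varepsilon=\varepsilon\mathbb Z^d_\varepsilon\subset\mathbb T^d=\mathbb R^d/\mathbb Z^d$, $\mathcal X_\varepsilon=\mathbb T^d_\varepsilon\times V$; $T^{\bar z}_\varepsilon(z,v)=([\varepsilon(\bar z+z)],v)$ for $(z,v)\in\mathcal X$, $\bar z\in\mathbb Z^d_\varepsilon$; $\mathcal E_\varepsilon=\{(T^0_\varepsilon x,T^0_\varepsilon y):(x,y)\in\mathcal E\}$; $x_{\mathsf z}=z$ for $x=([\varepsilon z],v)\in\mathcal X_\varepsilon$. $\tau^{\bar z}_\varepsilon m(x)=m(T^{\bar z}_\varepsilon x)$, $\tau^{\bar z}_\varepsilon J(x,y)=J(T^{\bar z}_\varepsilon x,T^{\bar z}_\varepsilon y)$, and $$\mathcal F_\varepsilon(m,J)=\sum_{z\in\mathbb Z^d_\varepsilon}\varepsilon^dF\Big(\frac{\tau^z_\varepsilon m}{\varepsilon^d},\frac{\tau^z_\varepsilon J}{\varepsilon^{d-1}}\Big),\quad(m,J)\in\mathbb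 R_+^{\mathcal X_\varepsilon}\times\mathbb R_a^{\mathcal E_\varepsilon}.$$ $(\boldsymbol m,\boldsymbol J)\in\mathcal{CE}^{\mathcal I}_\varepsilon$: $\boldsymbol m:\mathcal I\to\mathbb R_+^{\mathcal X_\varepsilon}$ continuous, $\boldsymbol J:\mathcal I\to\mathbb R_a^{\mathcal E_\varepsilon}$ Borel, $\partial_tm_t+\operatorname{div}J_t=0$ in the sense of distributions. For continuous $\boldsymbol m$ with $\boldsymbol m(\mathcal I\times\mathcal X_\varepsilon):=\int_{\mathcal I}\sum_{x}m_t(x)\,dt<\infty$ (all curves in the claim are of this type), $\mathcal A^{\mathcal I}_\varepsilon(\boldsymbol m)=\inf\{\int_{\mathcal I}\mathcal F_\varepsilon(m_t,J_t)\,dt:(\boldsymbol m,\boldsymbol J)\in\mathcal{CE}^{\mathcal I}_\varepsilon\}$, $\inf\emptyset=+\infty$. **Embedding.** $Q^z_\varepsilon=\varepsilon z+[0,\varepsilon)^d\subseteq\mathbb T^d$; $\iota_\varepsilon m=\varepsilon^{-d}\sum_{x\in\mathcal X_\varepsilon}m(x)\,\mathscr L^d|_{Q^{x_{\mathsf z}}_\varepsilon}$; $\iota_\varepsilon\boldsymbol m$ is the measure $(\iota_\varepsilon m_t)(dx)\,dt$. **Spaces.** $\mathcal M_+(A)$: finite nonnegative Radon measures on $A$; weak convergence is tested against $C_b(A)$. $\mathrm{BV}_{\rm KR}(\mathcal I;\mathcal M_+(\mathbb T^d))$ is the set of curves $\boldsymbol\mu:\mathcal I\to\mathcal M_+(\mathbb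 T^d)$ for which $$\sup\Big\{\int_{\mathcal I}\int_{\mathbb T^d}\partial_t\varphi_t\,d\mu_t\,dt:\varphi\in C^1_c(\mathcal I;C^1(\mathbb T^d)),\ \max_{t\in\mathcal I}\|\varphi_t\|_{C^1(\mathbb T^d)}\le1\Big\}<\infty .$$ *)

theory Defs
  imports "HOL-Analysis.Analysis"
begin

section \<open>The torus\<close>

text \<open>The torus \<open>\<real>\<^sup>d / \<int>\<^sup>d\<close> with the quotient topology; \<open>d = CARD('d)\<close>, and \<open>\<int>\<^sup>d\<close> is \<open>int ^ 'd\<close>.\<close>

definition torus_rel :: "real ^ 'd \<Rightarrow> real ^ 'd \<Rightarrow> bool" where
  "torus_rel x y \<longleftrightarrow> (\<forall>i. x $ i - y $ i \<in> \<int>)"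

lemma equivp_torus_rel: "equivp torus_rel"
proof (rule equivpI)
  show "reflp torus_rel" by (simp add: reflp_def torus_rel_def)
  show "symp torus_rel"
    unfolding symp_def torus_rel_def by (metis Ints_minus minus_diff_eq)
  show "transp torus_rel"
  proof (rule transpI)
    fix x y z :: "real ^ 'd"
    assume "torus_rel x y" "torus_rel y z"
    then have "(x $ i - y $ i) + (y $ i - z $ i) \<in> \<int>" for i
      by (intro Ints_add) (auto simp: torus_rel_def)
    then show "torus_rel x z" by (simp add: torus_rel_def)
  qed
qed

quotient_type (overloaded) 'd torus = "real ^ ('d::finite)" / torus_rel
  morphisms rep_torus to_torus
  by (rule equivp_torus_rel)

instantiation torus :: (finite) topological_space
begin

definition open_torus :: "'a torus set \<Rightarrow> bool" where
  "open_torus U \<longleftrightarrow> open (to_torus -` U)"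

instance
proof
  show "open (UNIV :: 'a torus set)" by (simp add: open_torus_def)
  show "open (S \<inter> T)" if "open S" "open T" for S T :: "'a torus set"
    using that by (simp add: open_torus_def open_Int)
  show "open (\<Union> K)" if "\<forall>S\<in>K. open S" for K :: "'a torus set set"
    using that by (auto simp: open_torus_def vimage_Union)
qed

end

definition torus_lebesgue :: "('d::finite) torus measure" where
  "torus_lebesgue = distr (restrict_space lborel {x. \<forall>i. 0 \<le> x $ i \<and> x $ i < 1}) borel to_torus"


section \<open>Periodic graphs\<close>

type_synonym ('d, 'v) site = "(int ^ 'd) \<times> 'v"

definition linf :: "int ^ ('d::finite) \<Rightarrow> int" where
  "linf z = Max (range (\<lambda>i. \<bar>z $ i\<bar>))"

definition shift :: "int ^ 'd \<Rightarrow> ('d::finite, 'v) site \<Rightarrow> ('d, 'v) site" where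
  "shift z x = (z + fst x, snd x)"

definition periodic_graph :: "(('d::finite, 'v::finite) site \<times> ('d, 'v) site) set \<Rightarrow> bool" where
  "periodic_graph E \<longleftrightarrow>
     sym E \<and>
     (\<forall>z x y. (x, y) \<in> E \<longrightarrow> (shift z x, shift z y) \<in> E) \<and>
     (\<forall>x y. (x, y) \<in> E\<^sup>*) \<and>
     (\<forall>x. finite {y. (x, y) \<in> E}) \<and>
     (\<exists>D. \<forall>x. card {y. (x, y) \<in> E} \<le> D)"

definition R0 :: "(('d::finite, 'v::finite) site \<times> ('d, 'v) site) set \<Rightarrow> real" where
  "R0 E = real_of_int (Max ((\<lambda>(x, y). linf (fst x - fst y)) ` E))"

definition edges_Q :: "(('d::finite, 'v) site \<times> ('d, 'v) site) set \<Rightarrow> (('d, 'v) site \<times> ('d, 'v) site) set" where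
  "edges_Q E = {(x, y) \<in> E. fst x = 0}"

text \<open>A function on an edge set is encoded by its extension by zero to all pairs of vertices.\<close>

definition antisym_fluxes :: "('x \<times> 'x) set \<Rightarrow> ('x \<times> 'x \<Rightarrow> real) set" where
  "antisym_fluxes E =
     {J. (\<forall>x y. (x, y) \<in> E \<longrightarrow> J (y, x) = - J (x, y)) \<and> (\<forall>e. e \<notin> E \<longrightarrow> J e = 0)}"

definition divergence :: "('x \<times> 'x) set \<Rightarrow> ('x \<times> 'x \<Rightarrow> real) \<Rightarrow> 'x \<Rightarrow> real" where
  "divergence E J x = (\<Sum>y\<in>{y. (x, y) \<in> E}. J (x, y))"


section \<open>Admissible costs\<close>

type_synonym ('d, 'v) cost =
  "(('d, 'v) site \<Rightarrow> real) \<Rightarrow> (('d, 'v) site \<times> ('d, 'v) site \<Rightarrow> real) \<Rightarrow> ereal"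

definition nonneg_densities :: "('x \<Rightarrow> real) set" where
  "nonneg_densities = {m. \<forall>x. 0 \<le> m x}"

definition ball_sites :: "real \<Rightarrow> ('d::finite, 'v) site set" where
  "ball_sites R = {x. real_of_int (linf (fst x)) \<le> R}"

definition ball_edges ::
  "(('d::finite, 'v) site \<times> ('d, 'v) site) set \<Rightarrow> real \<Rightarrow> (('d, 'v) site \<times> ('d, 'v) site) set" where
  "ball_edges E R = E \<inter> (ball_sites R \<times> ball_sites R)"

definition convex_cost ::
  "(('d::finite, 'v) site \<times> ('d, 'v) site) set \<Rightarrow> ('d, 'v) cost \<Rightarrow> bool" where
  "convex_cost E F \<longleftrightarrow>
     (\<forall>m\<in>nonneg_densities. \<forall>m'\<in>nonneg_densities.
      \<forall>J\<in>antisym_fluxes E. \<forall>J'\<in>antisym_fluxes E. \<forall>s\<in>{0..1}.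
        F (\<lambda>x. (1 - s) * m x + s * m' x) (\<lambda>e. (1 - s) * J e + s * J' e)
          \<le> ereal (1 - s) * F m J + ereal s * F m' J')"

text \<open>Closedness of the sublevel sets, for the product topology on functions (the instance
  from \<open>Function_Topology\<close>).\<close>

definition lsc_cost ::
  "(('d::finite, 'v) site \<times> ('d, 'v) site) set \<Rightarrow> ('d, 'v) cost \<Rightarrow> bool" where
  "lsc_cost E F \<longleftrightarrow>
     (\<forall>a::real. closedin (top_of_set (nonneg_densities \<times> antisym_fluxes E))
        {(m, J) \<in> nonneg_densities \<times> antisym_fluxes E. F m J \<le> ereal a})"

definition local_cost ::
  "(('d::finite, 'v) site \<times> ('d, 'v) site) set \<Rightarrow> ('d, 'v) cost \<Rightarrow> real \<Rightarrow> bool" where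
  "local_cost E F R1 \<longleftrightarrow>
     (\<forall>m\<in>nonneg_densities. \<forall>m'\<in>nonneg_densities.
      \<forall>J\<in>antisym_fluxes E. \<forall>J'\<in>antisym_fluxes E.
        (\<forall>x\<in>ball_sites R1. m x = m' x) \<longrightarrow> (\<forall>e\<in>ball_edges E R1. J e = J' e) \<longrightarrow>
        F m J = F m' J')"

definition coercive_cost ::
  "(('d::finite, 'v::finite) site \<times> ('d, 'v) site) set \<Rightarrow> ('d, 'v) cost \<Rightarrow> real \<Rightarrow> bool" where
  "coercive_cost E F R1 \<longleftrightarrow>
     (\<exists>c C :: real. 0 < c \<and>
       (\<forall>m\<in>nonneg_densities. \<forall>J\<in>antisym_fluxes E.
          ereal (c * (\<Sum>e\<in>edges_Q E. \<bar>J e\<bar>) - C * (1 + (\<Sum>x\<in>ball_sites (max (R0 E) R1). m x)))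
            \<le> F m J))"

text \<open>The Euclidean space of the parameters on which a cost with locality radius \<open>R1\<close> depends:
  arbitrary real (not only nonnegative) values at the sites, and antisymmetric values at the
  edges, of the ball of radius \<open>R1\<close>.\<close>

definition param_space ::
  "(('d::finite, 'v) site \<times> ('d, 'v) site) set \<Rightarrow> real \<Rightarrow>
   ((('d, 'v) site \<Rightarrow> real) \<times> (('d, 'v) site \<times> ('d, 'v) site \<Rightarrow> real)) topology" where
  "param_space E R1 =
     subtopology (prod_topology (powertop_real (ball_sites R1)) (powertop_real (ball_edges E R1)))
       {(m, J). \<forall>x y. (x, y) \<in> ball_edges E R1 \<longrightarrow> J (y, x) = - J (x, y)}"

definition param_restrict ::
  "(('d::finite, 'v) site \<times> ('d, 'v) site) set \<Rightarrow> real \<Rightarrow>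
   (('d, 'v) site \<Rightarrow> real) \<times> (('d, 'v) site \<times> ('d, 'v) site \<Rightarrow> real) \<Rightarrow>
   (('d, 'v) site \<Rightarrow> real) \<times> (('d, 'v) site \<times> ('d, 'v) site \<Rightarrow> real)" where
  "param_restrict E R1 = (\<lambda>(m, J). (restrict m (ball_sites R1), restrict J (ball_edges E R1)))"

definition cost_domain ::
  "(('d::finite, 'v) site \<times> ('d, 'v) site) set \<Rightarrow> ('d, 'v) cost \<Rightarrow>
   ((('d, 'v) site \<Rightarrow> real) \<times> (('d, 'v) site \<times> ('d, 'v) site \<Rightarrow> real)) set" where
  "cost_domain E F = {(m, J) \<in> nonneg_densities \<times> antisym_fluxes E. F m J < \<infinity>}"

definition interior_point_cost ::
  "(('d::finite, 'v::finite) site \<times> ('d, 'v) site) set \<Rightarrow> ('d, 'v) cost \<Rightarrow> real \<Rightarrow> bool" where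
  "interior_point_cost E F R1 \<longleftrightarrow>
     (\<exists>m\<in>nonneg_densities. \<exists>J\<in>antisym_fluxes E.
        (\<forall>z x. m (shift z x) = m x) \<and>
        (\<forall>z x y. J (shift z x, shift z y) = J (x, y)) \<and>
        (\<forall>x. divergence E J x = 0) \<and>
        param_restrict E R1 (m, J) \<in>
          param_space E R1 interior_of (param_restrict E R1 ` cost_domain E F))"

definition admissible_cost ::
  "(('d::finite, 'v::finite) site \<times> ('d, 'v) site) set \<Rightarrow> ('d, 'v) cost \<Rightarrow> bool" where
  "admissible_cost E F \<longleftrightarrow>
     (\<forall>m\<in>nonneg_densities. \<forall>J\<in>antisym_fluxes E. F m J \<noteq> -\<infinity>) \<and>
     convex_cost E F \<and> lsc_cost E F \<and>
     (\<exists>R1. local_cost E F R1 \<and> coercive_cost E F R1 \<and> interior_point_cost E F R1)"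


section \<open>Rescaled graphs and energies\<close>

definition scales :: "(('d::finite, 'v::finite) site \<times> ('d, 'v) site) set \<Rightarrow> real set" where
  "scales E = {\<epsilon>. 0 < \<epsilon> \<and> 1 / \<epsilon> \<in> \<nat> \<and> \<epsilon> * R0 E < 1 / 2}"

text \<open>\<open>(\<int> / (1/\<epsilon>)\<int>)\<^sup>d\<close>, through its representatives in \<open>{0, \<dots>, 1/\<epsilon> - 1}\<^sup>d\<close>.\<close>

definition Zd :: "real \<Rightarrow> (int ^ ('d::finite)) set" where
  "Zd \<epsilon> = {z. \<forall>i. 0 \<le> z $ i \<and> real_of_int (z $ i) < 1 / \<epsilon>}"

definition T_eps :: "real \<Rightarrow> int ^ 'd \<Rightarrow> ('d::finite, 'v) site \<Rightarrow> 'd torus \<times> 'v" where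
  "T_eps \<epsilon> z x = (to_torus (\<chi> i. \<epsilon> * real_of_int (z $ i + fst x $ i)), snd x)"

definition X_eps :: "real \<Rightarrow> (('d::finite) torus \<times> 'v) set" where
  "X_eps \<epsilon> = range (T_eps \<epsilon> 0)"

definition E_eps ::
  "(('d::finite, 'v) site \<times> ('d, 'v) site) set \<Rightarrow> real \<Rightarrow> (('d torus \<times> 'v) \<times> ('d torus \<times> 'v)) set" where
  "E_eps E \<epsilon> = (\<lambda>(x, y). (T_eps \<epsilon> 0 x, T_eps \<epsilon> 0 y)) ` E"

definition tau_density ::
  "real \<Rightarrow> int ^ 'd \<Rightarrow> (('d::finite) torus \<times> 'v \<Rightarrow> real) \<Rightarrow> ('d, 'v) site \<Rightarrow> real" where
  "tau_density \<epsilon> z m = (\<lambda>x. m (T_eps \<epsilon> z x))"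

definition tau_flux ::
  "(('d, 'v) site \<times> ('d, 'v) site) set \<Rightarrow> real \<Rightarrow> int ^ 'd \<Rightarrow>
   (((('d::finite) torus \<times> 'v) \<times> ('d torus \<times> 'v)) \<Rightarrow> real) \<Rightarrow>
   ('d, 'v) site \<times> ('d, 'v) site \<Rightarrow> real" where
  "tau_flux E \<epsilon> z J = (\<lambda>(x, y). if (x, y) \<in> E then J (T_eps \<epsilon> z x, T_eps \<epsilon> z y) else 0)"

definition energy ::
  "(('d::finite, 'v) site \<times> ('d, 'v) site) set \<Rightarrow> ('d, 'v) cost \<Rightarrow> real \<Rightarrow>
   ('d torus \<times> 'v \<Rightarrow> real) \<Rightarrow> ((('d torus \<times> 'v) \<times> ('d torus \<times> 'v)) \<Rightarrow> real) \<Rightarrow> ereal" where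
  "energy E F \<epsilon> m J =
     (\<Sum>z\<in>Zd \<epsilon>. ereal (\<epsilon> ^ CARD('d)) *
        F (\<lambda>x. tau_density \<epsilon> z m x / \<epsilon> ^ CARD('d))
          (\<lambda>e. tau_flux E \<epsilon> z J e / \<epsilon> ^ (CARD('d) - 1)))"

definition test_function :: "real set \<Rightarrow> (real \<Rightarrow> real) \<Rightarrow> bool" where
  "test_function I \<phi> \<longleftrightarrow>
     (\<forall>k t. ((deriv ^^ k) \<phi>) field_differentiable (at t)) \<and>
     (\<exists>K. compact K \<and> K \<subseteq> I \<and> (\<forall>t. t \<notin> K \<longrightarrow> \<phi> t = 0))"

definition density_curve :: "real \<Rightarrow> real set \<Rightarrow> (real \<Rightarrow> ('d::finite) torus \<times> 'v \<Rightarrow> real) \<Rightarrow> bool" where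
  "density_curve \<epsilon> I m \<longleftrightarrow>
     (\<forall>t\<in>I. \<forall>x\<in>X_eps \<epsilon>. 0 \<le> m t x) \<and> (\<forall>x\<in>X_eps \<epsilon>. continuous_on I (\<lambda>t. m t x))"

text \<open>Local integrability of the divergence is what makes it a distribution on \<open>I\<close>.\<close>

definition CE ::
  "(('d::finite, 'v) site \<times> ('d, 'v) site) set \<Rightarrow> real \<Rightarrow> real set \<Rightarrow>
   (real \<Rightarrow> 'd torus \<times> 'v \<Rightarrow> real) \<Rightarrow> (real \<Rightarrow> ('d torus \<times> 'v) \<times> ('d torus \<times> 'v) \<Rightarrow> real) \<Rightarrow> bool" where
  "CE E \<epsilon> I m J \<longleftrightarrow>
     density_curve \<epsilon> I m \<and>
     (\<forall>t\<in>I. J t \<in> antisym_fluxes (E_eps E \<epsilon>)) \<and>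
     (\<forall>e\<in>E_eps E \<epsilon>. (\<lambda>t. J t e) \<in> borel_measurable (restrict_space borel I)) \<and>
     (\<forall>x\<in>X_eps \<epsilon>.
        (\<forall>K. compact K \<longrightarrow> K \<subseteq> I \<longrightarrow>
           set_integrable lborel K (\<lambda>t. divergence (E_eps E \<epsilon>) (J t) x)) \<and>
        (\<forall>\<phi>. test_function I \<phi> \<longrightarrow>
           - (LBINT t:I. deriv \<phi> t * m t x)
             + (LBINT t:I. \<phi> t * divergence (E_eps E \<epsilon>) (J t) x) = 0))"

text \<open>Integral of an extended real function: positive part minus negative part. Below, the
  negative part has a finite integral by coercivity and finiteness of the total mass.\<close>

definition ereal_integral :: "real set \<Rightarrow> (real \<Rightarrow> ereal) \<Rightarrow> ereal" where
  "ereal_integral I f =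
     enn2ereal (\<integral>\<^sup>+t\<in>I. e2ennreal (f t) \<partial>lborel) - enn2ereal (\<integral>\<^sup>+t\<in>I. e2ennreal (- f t) \<partial>lborel)"

definition action ::
  "(('d::finite, 'v) site \<times> ('d, 'v) site) set \<Rightarrow> ('d, 'v) cost \<Rightarrow> real \<Rightarrow> real set \<Rightarrow>
   (real \<Rightarrow> 'd torus \<times> 'v \<Rightarrow> real) \<Rightarrow> ereal" where
  "action E F \<epsilon> I m =
     (INF J\<in>{J. CE E \<epsilon> I m J}. ereal_integral I (\<lambda>t. energy E F \<epsilon> (m t) (J t)))"

definition total_mass :: "real \<Rightarrow> real set \<Rightarrow> (real \<Rightarrow> ('d::finite) torus \<times> 'v \<Rightarrow> real) \<Rightarrow> ennreal" where
  "total_mass \<epsilon> I m = (\<integral>\<^sup>+t\<in>I. ennreal (\<Sum>x\<in>X_eps \<epsilon>. m t x) \<partial>lborel)"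


section \<open>Embedding and weak convergence\<close>

definition cell :: "real \<Rightarrow> int ^ 'd \<Rightarrow> ('d::finite) torus set" where
  "cell \<epsilon> z = to_torus `
     {y. \<forall>i. \<epsilon> * real_of_int (z $ i) \<le> y $ i \<and> y $ i < \<epsilon> * real_of_int (z $ i) + \<epsilon>}"

definition z_of :: "real \<Rightarrow> ('d::finite) torus \<times> 'v \<Rightarrow> int ^ 'd" where
  "z_of \<epsilon> x = (THE z. z \<in> Zd \<epsilon> \<and> fst x = to_torus (\<chi> i. \<epsilon> * real_of_int (z $ i)))"

definition embed :: "real \<Rightarrow> (('d::finite) torus \<times> 'v \<Rightarrow> real) \<Rightarrow> 'd torus measure" where
  "embed \<epsilon> m = density torus_lebesgue
     (\<lambda>p. ennreal (1 / \<epsilon> ^ CARD('d) * (\<Sum>x\<in>X_eps \<epsilon>. m x * indicator (cell \<epsilon> (z_of \<epsilon> x)) p)))"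

text \<open>The spaces \<open>A\<close> of interest are Polish, so that finite Radon measures are the same as
  finite Borel measures.\<close>

definition Mplus :: "'a::topological_space set \<Rightarrow> 'a measure set" where
  "Mplus A = {\<mu>. sets \<mu> = sets (restrict_space borel A) \<and> finite_measure \<mu>}"

definition weakly_converges ::
  "'a::topological_space set \<Rightarrow> (nat \<Rightarrow> 'a measure) \<Rightarrow> 'a measure \<Rightarrow> bool" where
  "weakly_converges A \<mu>s \<mu> \<longleftrightarrow>
     (\<forall>n. \<mu>s n \<in> Mplus A) \<and> \<mu> \<in> Mplus A \<and>
     (\<forall>f :: 'a \<Rightarrow> real. continuous_on A f \<longrightarrow> bounded (f ` A) \<longrightarrow>
        (\<lambda>n. \<integral>x. f x \<partial>\<mu>s n) \<longlonglongrightarrow> (\<integral>x. f x \<partial>\<mu>))"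

text \<open>The measure \<open>\<mu>\<^sub>t(dx) dt\<close> on \<open>I \<times> \<bbbT>\<^sup>d\<close>.\<close>

definition spacetime :: "real set \<Rightarrow> (real \<Rightarrow> 'a::topological_space measure) \<Rightarrow> (real \<times> 'a) measure" where
  "spacetime I \<mu> = measure_of (I \<times> UNIV) (sets (restrict_space borel (I \<times> UNIV)))
     (\<lambda>A. \<integral>\<^sup>+t\<in>I. emeasure (\<mu> t) (Pair t -` A) \<partial>lborel)"


section \<open>Curves of bounded variation\<close>

definition grad :: "(('d::finite) torus \<Rightarrow> real) \<Rightarrow> real ^ 'd \<Rightarrow> real ^ 'd" where
  "grad f x = (\<chi> i. frechet_derivative (\<lambda>y. f (to_torus y)) (at x) (axis i 1))"

definition C1_torus :: "(('d::finite) torus \<Rightarrow> real) set" where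
  "C1_torus = {f. (\<forall>x. (\<lambda>y. f (to_torus y)) differentiable (at x)) \<and> continuous_on UNIV (grad f)}"

definition C1_norm :: "(('d::finite) torus \<Rightarrow> real) \<Rightarrow> real" where
  "C1_norm f = (SUP p. \<bar>f p\<bar>) + (SUP x. norm (grad f x))"

text \<open>\<open>\<phi> \<in> C\<^sub>c\<^sup>1(I; C\<^sup>1(\<bbbT>\<^sup>d))\<close>, extended by zero outside \<open>I\<close>, with derivative
  \<open>\<partial>\<^sub>t \<phi> = \<psi>\<close>; limits are taken in the Banach space \<open>C\<^sup>1(\<bbbT>\<^sup>d)\<close>.\<close>

definition C1c_curve ::
  "real set \<Rightarrow> (real \<Rightarrow> ('d::finite) torus \<Rightarrow> real) \<Rightarrow> (real \<Rightarrow> 'd torus \<Rightarrow> real) \<Rightarrow> bool" where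
  "C1c_curve I \<phi> \<psi> \<longleftrightarrow>
     (\<forall>t. \<phi> t \<in> C1_torus \<and> \<psi> t \<in> C1_torus) \<and>
     (\<forall>t. ((\<lambda>s. C1_norm (\<lambda>p. (\<phi> s p - \<phi> t p) / (s - t) - \<psi> t p)) \<longlongrightarrow> 0) (at t)) \<and>
     (\<forall>t. ((\<lambda>s. C1_norm (\<lambda>p. \<psi> s p - \<psi> t p)) \<longlongrightarrow> 0) (at t)) \<and>
     (\<exists>K. compact K \<and> K \<subseteq> I \<and> (\<forall>t. t \<notin> K \<longrightarrow> \<phi> t = (\<lambda>p. 0)))"

text \<open>Measurability of the curve and integrability are implicit in the defining supremum.\<close>

definition BV_KR :: "real set \<Rightarrow> (real \<Rightarrow> ('d::finite) torus measure) set" where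
  "BV_KR I = {\<mu>.
     (\<forall>t\<in>I. \<mu> t \<in> Mplus UNIV) \<and>
     (\<forall>A\<in>sets borel. (\<lambda>t. emeasure (\<mu> t) A) \<in> borel_measurable (restrict_space borel I)) \<and>
     (\<forall>\<phi> \<psi>. C1c_curve I \<phi> \<psi> \<longrightarrow> set_integrable lborel I (\<lambda>t. \<integral>p. \<psi> t p \<partial>\<mu> t)) \<and>
     bdd_above {LBINT t:I. (\<integral>p. \<psi> t p \<partial>\<mu> t) | \<phi> \<psi>.
       C1c_curve I \<phi> \<psi> \<and> (\<forall>t\<in>I. C1_norm (\<phi> t) \<le> 1)}}"

end

theory Submission
  imports Defs "HOL-Probability.Helly_Selection" "HOL-Probability.Giry_Monad"
    "HOL-Computational_Algebra.Polynomial"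
begin

text \<open>
  A bound on the action is, by coercivity, a bound on the time integral of the flux intensity
  \<open>\<epsilon> \<Sum>\<bar>J\<^sub>t\<bar>\<close>, uniformly in the scale \<open>\<epsilon>\<close> (\<open>energy_lower_bound\<close>, \<open>flux_intensity_bound\<close>).
  Everything else is extracted from this \<open>L\<^sup>1\<close> bound and the continuity equation.

  First, the divergences of an antisymmetric flux sum to zero, so that the mass of each discrete curve
  is constant in time; as its time integral is bounded, so is the mass itself. Secondly, if \<open>f\<close> is a
  Lipschitz function on the torus, then the discrete integration by parts turns the increment of
  \<open>t \<mapsto> \<integral>f d(\<iota>\<^sub>\<epsilon> m\<^sub>t)\<close> into a sum over edges of flux times the difference of two cell averages of \<open>f\<close>;
  an edge has length of order \<open>\<epsilon>\<close>, so the increment over \<open>[s, t]\<close> is at most a constant times the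
  integral of the flux intensity over \<open>[s, t]\<close> (\<open>integral_embed_increment_le\<close>). These real functions of time
  are thus bounded in BV uniformly in \<open>\<epsilon>\<close>, and Helly's selection theorem makes them converge along a
  subsequence at all times outside a countable set (\<open>Helly_bounded_variation\<close>).

  Applied to the countably many trigonometric monomials, with a diagonal sequence, this gives one
  subsequence and one countable set \<open>N\<close> of exceptional times. Trigonometric polynomials are dense in the
  continuous functions, so for \<open>t \<notin> N\<close> the integrals of every continuous function converge. The limit
  functional is integration against a measure \<open>\<mu>\<^sub>t\<close>, because measures of bounded mass on the torus are
  weakly sequentially compact (\<open>torus_finite_measures_weakly_compact\<close>). The latter is reduced to the real
  line: a Borel code \<open>g\<close> maps the torus to the line in such a way that every continuous function on the
  torus is a uniformly continuous function of the code (\<open>borel_code_exists\<close>), and on the line weak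
  compactness is Helly's theorem for distribution functions. At the exceptional times \<open>\<mu>\<^sub>t\<close> is one fixed
  limit measure, so that the total mass is constant at every time.

  Convergence of the space-time measures follows from the convergence at almost every time by dominated
  convergence. Finally, for a test curve \<open>\<phi>\<close> with values in the unit ball of \<open>C\<^sup>1\<close>, an integration by parts
  in time at each site bounds the integral of \<open>\<partial>\<^sub>t \<phi>\<close> against the discrete curve by a constant times the
  integrated flux intensity (\<open>integral_embed_test_curve_le\<close>); the bound survives in the limit, and this is
  the bounded variation of \<open>\<mu>\<close>.
\<close>

section \<open>Smooth cut-off functions on the line\<close>

text \<open>Smoothness is established by exhibiting a family of functions that is closed under
  differentiation.\<close>

lemma iterated_deriv_differentiable:
  fixes f :: "real \<Rightarrow> real"
  assumes "f \<in> A" and A: "\<And>f. f \<in> A \<Longrightarrow> \<exists>f'\<in>A. \<forall>t. (f has_real_derivative f' t) (at t)"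
  shows "((deriv ^^ k) f) field_differentiable (at t)"
proof -
  have "deriv g \<in> A" if g: "g \<in> A" for g
  proof -
    obtain g' where g': "g' \<in> A" "\<forall>t. (g has_real_derivative g' t) (at t)"
      using A[OF g] by blast
    then have "deriv g = g'" by (auto intro!: ext DERIV_imp_deriv)
    then show ?thesis using g' by simp
  qed
  then have "(deriv ^^ k) f \<in> A" for k by (induction k) (use assms(1) in auto)
  then show ?thesis using A unfolding field_differentiable_def by blast
qed

text \<open>The smallest convenient family that contains the standard bump \<open>exp (- 1 / (x (1 - x)))\<close> on \<open>(0, 1)\<close>,
  which is \<open>flat_bump 1 0\<close>, and is closed under differentiation.\<close>

definition flat_bump :: "real poly \<Rightarrow> nat \<Rightarrow> real \<Rightarrow> real" where
  "flat_bump p k x =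
     (if 0 < x \<and> x < 1 then poly p x / (x * (1 - x)) ^ k * exp (- (1 / (x * (1 - x)))) else 0)"

text \<open>A single term of the exponential series of \<open>1 / q\<close> is a lower bound for \<open>exp (1 / q)\<close>.\<close>

lemma exp_neg_inverse_le: "exp (- (1 / q)) \<le> fact n * q ^ n" if "0 < q" for q :: real
proof -
  have "(\<lambda>n. inverse (fact n) * (1 / q) ^ n) sums exp (1 / q)"
    using exp_converges[of "1 / q"] by (simp add: scaleR_conv_of_real)
  then have "inverse (fact n) * (1 / q) ^ n \<le> exp (1 / q)"
    using sum_le_suminf[of "\<lambda>n. inverse (fact n) * (1 / q) ^ n" "{n}"] that
    by (auto simp: sums_iff)
  then have "inverse (exp (1 / q)) \<le> inverse (inverse (fact n) * (1 / q) ^ n)"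
    using that by (intro le_imp_inverse_le) auto
  also have "\<dots> = fact n * q ^ n" by (simp add: power_divide field_simps)
  finally show ?thesis by (simp add: exp_minus)
qed

lemma has_real_derivative_0_if_quadratic_bound:
  fixes f :: "real \<Rightarrow> real"
  assumes "\<And>x. \<bar>f x - f a\<bar> \<le> C * (x - a)\<^sup>2"
  shows "(f has_real_derivative 0) (at a)"
proof -
  have "((\<lambda>x. C * \<bar>x - a\<bar>) \<longlongrightarrow> C * \<bar>a - a\<bar>) (at a)"
    by (intro tendsto_intros)
  then have lim: "((\<lambda>x. C * \<bar>x - a\<bar>) \<longlongrightarrow> 0) (at a)" by simp
  have bound: "norm ((f x - f a) / (x - a)) \<le> C * \<bar>x - a\<bar>" for x
  proof (cases "x = a")
    case False
    have "norm ((f x - f a) / (x - a)) = \<bar>f x - f a\<bar> / \<bar>x - a\<bar>" by simp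
    also have "\<dots> \<le> C * (x - a)\<^sup>2 / \<bar>x - a\<bar>"
      by (intro divide_right_mono assms) simp
    also have "\<dots> = C * \<bar>x - a\<bar>"
    proof -
      have "C * y\<^sup>2 / \<bar>y\<bar> = C * \<bar>y\<bar>" if "y \<noteq> 0" for y :: real
        using that by (cases "0 < y") (auto simp: power2_eq_square)
      then show ?thesis using False by simp
    qed
    finally show ?thesis .
  qed simp
  show ?thesis unfolding has_field_derivative_iff
    by (rule Lim_null_comparison[OF always_eventually lim]) (use bound in blast)
qed

text \<open>With \<open>n = k + 2\<close> in the previous estimate the exponential absorbs the negative power of \<open>x (1 - x)\<close>
  and leaves a square. A quadratic bound is what makes the extension by zero differentiable at the two
  end points.\<close>

lemma flat_bump_quadratic_bound:
  "\<exists>C. \<forall>x. \<bar>flat_bump p k x\<bar> \<le> C * x\<^sup>2 \<and> \<bar>flat_bump p k x\<bar> \<le> C * (x - 1)\<^sup>2"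
proof -
  have "bounded (poly p ` {0..1})"
    by (intro compact_imp_bounded compact_continuous_image) (auto intro!: continuous_intros)
  then obtain B where B: "\<And>x. x \<in> {0..1} \<Longrightarrow> \<bar>poly p x\<bar> \<le> B"
    unfolding bounded_iff by fastforce
  have "\<bar>poly p 0\<bar> \<le> B" by (rule B) simp
  then have B0: "0 \<le> B" by linarith
  define C where "C = B * fact (k + 2)"
  have C: "\<bar>flat_bump p k x\<bar> \<le> C * (x * (1 - x))\<^sup>2" if "0 < x" "x < 1" for x
  proof -
    let ?q = "x * (1 - x)"
    have q: "0 < ?q" using that by simp
    have "\<bar>flat_bump p k x\<bar> = \<bar>poly p x\<bar> / ?q ^ k * exp (- (1 / ?q))"
      using that by (simp add: flat_bump_def abs_mult)
    also have "\<dots> \<le> B / ?q ^ k * (fact (k + 2) * ?q ^ (k + 2))"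
      using q that B0 by (intro mult_mono divide_right_mono B exp_neg_inverse_le) auto
    also have "\<dots> = C * ?q\<^sup>2"
    proof -
      have "B / Q ^ k * (fact (k + 2) * Q ^ (k + 2)) = C * Q\<^sup>2" if "0 < Q" for Q :: real
        using that by (simp add: C_def power_add power2_eq_square del: fact_Suc)
      then show ?thesis using q by blast
    qed
    finally show ?thesis .
  qed
  have "\<bar>flat_bump p k x\<bar> \<le> C * x\<^sup>2 \<and> \<bar>flat_bump p k x\<bar> \<le> C * (x - 1)\<^sup>2" for x
  proof (cases "0 < x \<and> x < 1")
    case True
    then have "(x * (1 - x))\<^sup>2 \<le> x\<^sup>2" "(x * (1 - x))\<^sup>2 \<le> (1 - x)\<^sup>2"
      by (auto intro!: power_mono simp: mult_left_le mult_left_le_one_le)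
    then have "C * (x * (1 - x))\<^sup>2 \<le> C * x\<^sup>2" "C * (x * (1 - x))\<^sup>2 \<le> C * (x - 1)\<^sup>2"
      using B0 by (auto intro!: mult_left_mono simp: C_def power2_commute)
    with C[of x] True show ?thesis by linarith
  next
    case False
    then show ?thesis using B0 by (auto simp: flat_bump_def C_def)
  qed
  then show ?thesis by blast
qed

definition flat_bump_deriv_poly :: "real poly \<Rightarrow> nat \<Rightarrow> real poly" where
  "flat_bump_deriv_poly p k =
     pderiv p * [:0, 1, -1:] ^ 2 - smult (real k) (p * [:1, -2:] * [:0, 1, -1:]) + p * [:1, -2:]"

lemma has_real_derivative_flat_bump:
  "(flat_bump p k has_real_derivative flat_bump (flat_bump_deriv_poly p k) (k + 2) x) (at x)"
proof -
  let ?Q = "flat_bump_deriv_poly p k"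
  consider "x < 0 \<or> 1 < x" | "x = 0 \<or> x = 1" | "0 < x" "x < 1" by linarith
  then show ?thesis
  proof cases
    case 1
    have "((\<lambda>_. 0) has_real_derivative 0) (at x)" by simp
    moreover have "\<forall>\<^sub>F y in nhds x. 0 = flat_bump p k y"
    proof -
      have "open ({..<0} \<union> {1::real<..})" "x \<in> {..<0} \<union> {1<..}" using 1 by auto
      then show ?thesis unfolding eventually_nhds
        by (intro exI[of _ "{..<0} \<union> {1<..}"]) (auto simp: flat_bump_def)
    qed
    ultimately have "(flat_bump p k has_real_derivative 0) (at x)"
      by (rule DERIV_cong_ev[THEN iffD1, OF refl, rotated 2]) simp
    moreover have "flat_bump ?Q (k + 2) x = 0" using 1 by (auto simp: flat_bump_def)
    ultimately show ?thesis by simp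
  next
    case 2
    obtain C where C: "\<And>x. \<bar>flat_bump p k x\<bar> \<le> C * x\<^sup>2" "\<And>x. \<bar>flat_bump p k x\<bar> \<le> C * (x - 1)\<^sup>2"
      using flat_bump_quadratic_bound by metis
    have 0: "flat_bump p k x = 0" "flat_bump ?Q (k + 2) x = 0" using 2 by (auto simp: flat_bump_def)
    have "(flat_bump p k has_real_derivative 0) (at x)"
      using 2 0 C by (intro has_real_derivative_0_if_quadratic_bound[where C = C]) auto
    then show ?thesis using 0 by simp
  next
    case 3
    let ?q = "\<lambda>x::real. x * (1 - x)"
    have q: "0 < ?q x" "x \<noteq> 0" "x \<noteq> 1" using 3 by auto
    have eq: "\<forall>\<^sub>F y in nhds x. poly p y / ?q y ^ k * exp (- (1 / ?q y)) = flat_bump p k y"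
      unfolding eventually_nhds
      by (intro exI[of _ "{0<..<1}"]) (use 3 in \<open>auto simp: flat_bump_def\<close>)
    have dq: "(?q has_real_derivative 1 - 2 * x) (at x)"
      by (auto intro!: derivative_eq_intros)
    have dqk: "((\<lambda>y. ?q y ^ k) has_real_derivative real k * (1 - 2 * x) * ?q x ^ k / ?q x) (at x)"
    proof -
      have "((\<lambda>y. ?q y ^ k) has_real_derivative real k * ((1 - 2 * x) * ?q x ^ (k - Suc 0))) (at x)"
        by (rule DERIV_power[OF dq])
      also have "real k * ((1 - 2 * x) * ?q x ^ (k - Suc 0)) = real k * (1 - 2 * x) * ?q x ^ k / ?q x"
        by (cases k) (use q in auto)
      finally show ?thesis .
    qed
    have de: "((\<lambda>y. exp (- (1 / ?q y))) has_real_derivative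
        exp (- (1 / ?q x)) * ((1 - 2 * x) / (?q x)\<^sup>2)) (at x)"
    proof -
      have "((\<lambda>y. - inverse (?q y)) has_real_derivative - (- (inverse (?q x) * (1 - 2 * x) * inverse (?q x)))) (at x)"
        by (intro DERIV_minus DERIV_inverse' dq) (use 3 in simp)
      from DERIV_fun_exp[OF this] show ?thesis
        by (simp add: inverse_eq_divide power2_eq_square)
    qed
    have "((\<lambda>y. poly p y / ?q y ^ k * exp (- (1 / ?q y))) has_real_derivative
        (poly (pderiv p) x * ?q x ^ k - poly p x * (real k * (1 - 2 * x) * ?q x ^ k / ?q x)) /
          (?q x ^ k * ?q x ^ k) * exp (- (1 / ?q x)) +
        exp (- (1 / ?q x)) * ((1 - 2 * x) / (?q x)\<^sup>2) * (poly p x / ?q x ^ k)) (at x)"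
      using 3 by (intro DERIV_mult DERIV_divide poly_DERIV dqk de) auto
    also have "(poly (pderiv p) x * ?q x ^ k - poly p x * (real k * (1 - 2 * x) * ?q x ^ k / ?q x)) /
          (?q x ^ k * ?q x ^ k) * exp (- (1 / ?q x)) +
        exp (- (1 / ?q x)) * ((1 - 2 * x) / (?q x)\<^sup>2) * (poly p x / ?q x ^ k)
        = flat_bump ?Q (k + 2) x"
    proof -
      define Q where "Q = ?q x"
      have Qx: "poly [:0, 1, -1:] x = Q" by (simp add: Q_def algebra_simps)
      have Q1: "poly [:1, -2:] x = 1 - 2 * x" by simp
      have Q0: "Q \<noteq> 0" using q by (simp add: Q_def)
      have "flat_bump ?Q (k + 2) x = (poly (pderiv p) x * Q ^ 2 - real k * (poly p x * (1 - 2 * x) * Q)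
          + poly p x * (1 - 2 * x)) / Q ^ (k + 2) * exp (- (1 / Q))"
        using 3 unfolding flat_bump_def flat_bump_deriv_poly_def
        by (simp only: poly_add poly_diff poly_mult poly_power poly_smult Qx Q1 Q_def[symmetric] if_True simp_thms)
      also have "\<dots> = (poly (pderiv p) x * Q ^ k - poly p x * (real k * (1 - 2 * x) * Q ^ k / Q)) /
          (Q ^ k * Q ^ k) * exp (- (1 / Q)) + exp (- (1 / Q)) * ((1 - 2 * x) / Q\<^sup>2) * (poly p x / Q ^ k)"
      proof -
        have "(A * Q ^ 2 - K * (P * D * Q) + P * D) / (W * Q ^ 2) * e
            = (A * W - P * (K * D * W / Q)) / (W * W) * e + e * (D / Q\<^sup>2) * (P / W)"
          if "W \<noteq> 0" for W A K P D e
          using that Q0 by (simp add: field_simps power2_eq_square)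
        note alg = this
        show ?thesis unfolding power_add by (rule alg) (use Q0 in simp)
      qed
      finally show ?thesis unfolding Q_def[symmetric] ..
    qed
    finally show ?thesis
      by (rule DERIV_cong_ev[THEN iffD1, OF refl eq refl])
  qed
qed

text \<open>The step is the normalised antiderivative of the bump.\<close>

lemma smooth_step_exists:
  obtains \<rho> :: "real \<Rightarrow> real" and c where
    "\<And>x. (\<rho> has_real_derivative c * flat_bump 1 0 x) (at x)"
    "\<And>x. 0 \<le> \<rho> x" "\<And>x. \<rho> x \<le> 1" "\<And>x. x \<le> 0 \<Longrightarrow> \<rho> x = 0" "\<And>x. 1 \<le> x \<Longrightarrow> \<rho> x = 1" "0 < c"
proof -
  let ?b = "flat_bump 1 0"
  have cont: "isCont ?b x" for x
    using has_real_derivative_flat_bump DERIV_isCont by blast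
  obtain G where G: "\<And>x. (G has_vector_derivative ?b x) (at x)"
    using einterval_antiderivative[of "-\<infinity>" \<infinity> ?b] cont by auto
  then have dG: "(G has_real_derivative ?b x) (at x)" for x
    by (simp add: has_real_derivative_iff_has_vector_derivative)
  have b0: "0 \<le> ?b x" for x by (auto simp: flat_bump_def)
  have mono: "G x \<le> G y" if "x \<le> y" for x y
    by (rule DERIV_nonneg_imp_nondecreasing[OF that]) (use dG b0 in blast)
  have bpos: "0 < ?b x" if "0 < x" "x < 1" for x using that by (simp add: flat_bump_def)
  have contG: "continuous_on S G" for S
    using dG DERIV_isCont by (blast intro: continuous_at_imp_continuous_on)
  have lt: "G 0 < G 1"
    by (rule DERIV_pos_imp_increasing_open[of 0 1 G])
      (use dG bpos contG in \<open>auto\<close>)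
  have left: "G x = G 0" if "x \<le> 0" for x
  proof (cases "x = 0")
    case False
    have "(G has_real_derivative 0) (at y)" if "y < 0" for y
      using dG[of y] that by (simp add: flat_bump_def)
    then have "G 0 = G x"
      using False that by (intro DERIV_isconst_end contG) auto
    then show ?thesis by simp
  qed simp
  have right: "G x = G 1" if "1 \<le> x" for x
  proof (cases "x = 1")
    case False
    have "(G has_real_derivative 0) (at y)" if "1 < y" for y
      using dG[of y] that by (simp add: flat_bump_def)
    then show ?thesis
      using False that by (intro DERIV_isconst_end contG) auto
  qed simp
  define c where "c = 1 / (G 1 - G 0)"
  have c: "0 < c" using lt by (simp add: c_def)
  show thesis
  proof
    show "((\<lambda>x. c * (G x - G 0)) has_real_derivative c * ?b x) (at x)" for x
      by (auto intro!: derivative_eq_intros dG)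
    show "0 \<le> c * (G x - G 0)" for x
      using c mono[of 0 x] left[of x] by (cases "0 \<le> x") auto
    show "c * (G x - G 0) \<le> 1" for x
    proof -
      have "G x \<le> G 1" using mono[of x 1] right[of x] by (cases "x \<le> 1") auto
      then have "c * (G x - G 0) \<le> c * (G 1 - G 0)" using c by simp
      also have "\<dots> = 1" using lt by (simp add: c_def)
      finally show ?thesis .
    qed
    show "c * (G x - G 0) = 0" if "x \<le> 0" for x using left[OF that] by simp
    show "c * (G x - G 0) = 1" if "1 \<le> x" for x using right[OF that] lt by (simp add: c_def)
  qed (rule c)
qed

text \<open>For large \<open>n\<close> this is a smooth approximation of the indicator of \<open>(s, t]\<close>. All its derivatives are
  again differences of one function at \<open>n (r - s)\<close> and at \<open>n (r - t)\<close>, with the function taken from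
  the step and the multiples of the bumps.\<close>

lemma smooth_step_difference:
  fixes \<rho> :: "real \<Rightarrow> real"
  assumes "\<And>x. (\<rho> has_real_derivative c * flat_bump 1 0 x) (at x)"
  shows "((deriv ^^ k) (\<lambda>r. \<rho> (n * (r - s)) - \<rho> (n * (r - t)))) field_differentiable (at x)"
proof -
  define H where "H = insert \<rho> {\<lambda>x. c * flat_bump p k x | c p k. True}"
  define A where "A = {\<lambda>r. u * (h (n * (r - s)) - h (n * (r - t))) | u h. h \<in> H}"
  have H: "\<exists>h'\<in>H. \<forall>x. (h has_real_derivative h' x) (at x)" if hH: "h \<in> H" for h
  proof (cases "h = \<rho>")
    case True
    then show ?thesis using assms
      by (intro bexI[of _ "\<lambda>x. c * flat_bump 1 0 x"]) (auto simp: H_def)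
  next
    case False
    then obtain c p k where h: "h = (\<lambda>x. c * flat_bump p k x)" using hH by (auto simp: H_def)
    have "(h has_real_derivative c * flat_bump (flat_bump_deriv_poly p k) (k + 2) x) (at x)" for x
      unfolding h by (intro DERIV_cmult has_real_derivative_flat_bump)
    then show ?thesis unfolding H_def
      by (intro bexI[of _ "\<lambda>x. c * flat_bump (flat_bump_deriv_poly p k) (k + 2) x"]) auto
  qed
  show ?thesis
  proof (rule iterated_deriv_differentiable[where A = A])
    show "(\<lambda>r. \<rho> (n * (r - s)) - \<rho> (n * (r - t))) \<in> A"
      unfolding A_def H_def by (intro CollectI exI[of _ 1] exI[of _ \<rho>]) auto
  next
    fix f assume "f \<in> A"
    then obtain u h where f: "f = (\<lambda>r. u * (h (n * (r - s)) - h (n * (r - t))))" and h: "h \<in> H"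
      by (auto simp: A_def)
    obtain h' where h': "h' \<in> H" "\<And>x. (h has_real_derivative h' x) (at x)" using H[OF h] by blast
    have "(f has_real_derivative (u * n) * (h' (n * (r - s)) - h' (n * (r - t)))) (at r)" for r
      unfolding f
      by (auto intro!: derivative_eq_intros DERIV_chain2[OF h'(2)] simp: algebra_simps)
    then show "\<exists>f'\<in>A. \<forall>t. (f has_real_derivative f' t) (at t)"
      unfolding A_def using h'(1)
      by (intro bexI[of _ "\<lambda>r. (u * n) * (h' (n * (r - s)) - h' (n * (r - t)))"]) auto
  qed
qed

lemma isCont_flat_bump: "isCont (flat_bump p k) x"
  using has_real_derivative_flat_bump DERIV_isCont by blast

section \<open>The weak time derivative\<close>

text \<open>The substitution \<open>r = s + y / n\<close> turns the kernel into the fixed density \<open>b\<close> on \<open>[0, 1]\<close>, while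
  \<open>u (s + y / n)\<close> converges boundedly to \<open>u s\<close>.\<close>

lemma concentrating_kernel_tendsto:
  fixes \<rho> b u :: "real \<Rightarrow> real"
  assumes \<rho>: "\<And>x. (\<rho> has_real_derivative b x) (at x)" and b: "\<And>x. isCont b x" "\<And>x. 0 \<le> b x"
    and b0: "\<And>x. x \<notin> {0<..<1} \<Longrightarrow> b x = 0" and \<rho>01: "\<rho> 0 = 0" "\<rho> 1 = 1"
    and s: "\<alpha> < s" "s < \<beta>" and u: "continuous_on {\<alpha><..<\<beta>} u"
  shows "(\<lambda>n. LBINT r:{\<alpha><..<\<beta>}. (real n * b (real n * (r - s))) * u r) \<longlonglongrightarrow> u s"
proof -
  define \<delta> where "\<delta> = (\<beta> - s) / 2"
  have \<delta>: "0 < \<delta>" "s + \<delta> < \<beta>" using s by (auto simp: \<delta>_def field_simps)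
  have sub: "{s..s + \<delta>} \<subseteq> {\<alpha><..<\<beta>}" using s \<delta> by auto
  have "bounded (u ` {s..s + \<delta>})"
    by (intro compact_imp_bounded compact_continuous_image continuous_on_subset[OF u sub]) auto
  then obtain M where M: "\<forall>r\<in>{s..s + \<delta>}. \<bar>u r\<bar> \<le> M" unfolding bounded_iff by fastforce
  obtain n0 where n0: "1 / \<delta> \<le> real n0" using real_arch_simple by blast
  \<comment> \<open>For indices above \<open>n0\<close> the support \<open>[s, s + 1 / n]\<close> of the kernel lies in \<open>[s, s + \<delta>]\<close>.\<close>
  define w where "w n y = indicator {0..1} y *\<^sub>R (b y * u (s + (1 / real (n + (n0 + 1))) * y))" for n y
  have in_I: "s + (1 / real (n + (n0 + 1))) * y \<in> {s..s + \<delta>}" if "y \<in> {0..1}" for n y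
  proof -
    have "1 \<le> real n0 * \<delta>" using n0 \<delta> by (simp add: field_simps)
    also have "\<dots> \<le> real (n + (n0 + 1)) * \<delta>" using \<delta> by (intro mult_right_mono) auto
    finally have "1 / real (n + (n0 + 1)) \<le> \<delta>" by (simp add: field_simps)
    then have "(1 / real (n + (n0 + 1))) * y \<le> \<delta> * 1"
      using that \<delta> by (intro mult_mono) auto
    then show ?thesis using that by auto
  qed
  have eq: "(LBINT r:{\<alpha><..<\<beta>}. (real n' * b (real n' * (r - s))) * u r) = (\<integral>y. w n y \<partial>lborel)"
    if "n' = n + (n0 + 1)" for n n'
  proof -
    let ?f = "\<lambda>r. indicator {\<alpha><..<\<beta>} r *\<^sub>R (real n' * b (real n' * (r - s)) * u r)"
    have "(\<integral>r. ?f r \<partial>lborel) = \<bar>1 / real n'\<bar> *\<^sub>R (\<integral>y. ?f (s + (1 / real n') * y) \<partial>lborel)"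
      by (rule lborel_integral_real_affine) (use that in auto)
    also have "\<dots> = (\<integral>y. \<bar>1 / real n'\<bar> *\<^sub>R ?f (s + (1 / real n') * y) \<partial>lborel)"
      by (rule integral_scaleR_right[symmetric])
    also have "\<dots> = (\<integral>y. w n y \<partial>lborel)"
    proof (rule Bochner_Integration.integral_cong[OF refl])
      fix y
      show "\<bar>1 / real n'\<bar> *\<^sub>R ?f (s + (1 / real n') * y) = w n y"
      proof (cases "y \<in> {0<..<1}")
        case True
        have "s + (1 / real n') * y \<in> {\<alpha><..<\<beta>}"
            unfolding that by (rule subsetD[OF sub in_I]) (use True in auto)
        then show ?thesis using True that by (simp add: w_def)
      next
        case False
        then show ?thesis using b0[of y] that by (simp add: w_def)
      qed
    qed
    finally show ?thesis by (simp add: set_lebesgue_integral_def)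
  qed
  have intb: "has_bochner_integral lborel (\<lambda>x. b x * indicator {0..1} x) (\<rho> 1 - \<rho> 0)"
    by (rule has_bochner_integral_FTC_Icc_real) (use \<rho> b in auto)
  have "(\<lambda>n. \<integral>y. w n y \<partial>lborel) \<longlonglongrightarrow> (\<integral>y. indicator {0..1} y *\<^sub>R (b y * u s) \<partial>lborel)"
  proof (rule integral_dominated_convergence[where w = "\<lambda>y. b y * indicator {0..1} y * M"])
    show "(\<lambda>y. indicator {0..1} y *\<^sub>R (b y * u s)) \<in> borel_measurable lborel"
    proof -
      have "(\<lambda>y. indicator {0..1} y *\<^sub>R (b y * u s)) \<in> borel_measurable borel"
        by (intro borel_measurable_continuous_on_indicator continuous_intros)
          (use b in \<open>auto intro!: continuous_at_imp_continuous_on\<close>)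
      then show ?thesis by simp
    qed
    show "w n \<in> borel_measurable lborel" for n
    proof -
      have "w n \<in> borel_measurable borel"
        unfolding w_def
        by (intro borel_measurable_continuous_on_indicator continuous_intros continuous_on_compose2[OF u])
          (use b in_I sub in \<open>auto intro!: continuous_at_imp_continuous_on\<close>)
      then show ?thesis by simp
    qed
    show "integrable lborel (\<lambda>y. b y * indicator {0..1} y * M)"
      using intb by (auto simp: has_bochner_integral_iff)
    show "AE y in lborel. (\<lambda>n. w n y) \<longlonglongrightarrow> indicator {0..1} y *\<^sub>R (b y * u s)"
    proof (intro always_eventually allI)
      fix y
      show "(\<lambda>n. w n y) \<longlonglongrightarrow> indicator {0..1} y *\<^sub>R (b y * u s)"
      proof (cases "y \<in> {0..1}")
        case True
        have cu: "isCont u s" using u s by (simp add: continuous_on_eq_continuous_at)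
        have "(\<lambda>n. s + (1 / real (n + (n0 + 1))) * y) \<longlonglongrightarrow> s + 0 * y"
          by (intro tendsto_intros LIMSEQ_ignore_initial_segment[OF lim_1_over_n])
        then have "(\<lambda>n. u (s + (1 / real (n + (n0 + 1))) * y)) \<longlonglongrightarrow> u s"
          using isCont_tendsto_compose[OF cu] by simp
        then show ?thesis unfolding w_def by (intro tendsto_intros)
      qed (simp add: w_def)
    qed
    show "AE y in lborel. norm (w n y) \<le> b y * indicator {0..1} y * M" for n
    proof (intro always_eventually allI)
      fix y
      show "norm (w n y) \<le> b y * indicator {0..1} y * M"
        using M in_I[of y n] b(2)[of y]
        by (cases "y \<in> {0..1}") (auto simp: w_def abs_mult intro!: mult_left_mono)
    qed
  qed
  also have "(\<integral>y. indicator {0..1} y *\<^sub>R (b y * u s) \<partial>lborel) = u s"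
  proof -
    have "(\<integral>y. indicator {0..1} y *\<^sub>R (b y * u s) \<partial>lborel) = (\<integral>y. (b y * indicator {0..1} y) * u s \<partial>lborel)"
      by (rule Bochner_Integration.integral_cong) (auto simp: mult_ac)
    also have "\<dots> = u s"
      using intb \<rho>01 by (simp only: integral_mult_left_zero has_bochner_integral_iff) simp
    finally show ?thesis .
  qed
  finally have "(\<lambda>n. LBINT r:{\<alpha><..<\<beta>}. (real (n + (n0 + 1)) * b (real (n + (n0 + 1)) * (r - s))) * u r) \<longlonglongrightarrow> u s"
    using eq by simp
  then show ?thesis by (rule LIMSEQ_offset[of _ "n0 + 1"])
qed

text \<open>The smooth step differences tend to the indicator of \<open>(s, t]\<close>, and their derivatives are two kernels
  that concentrate at \<open>s\<close> and, with the opposite sign, at \<open>t\<close>. Passing to the limit in the weak equation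
  gives the fundamental theorem of calculus.\<close>

lemma weak_derivative_imp_increment:
  fixes u g :: "real \<Rightarrow> real"
  assumes u: "continuous_on {\<alpha><..<\<beta>} u"
    and g: "\<And>K. compact K \<Longrightarrow> K \<subseteq> {\<alpha><..<\<beta>} \<Longrightarrow> set_integrable lborel K g"
    and weak: "\<And>\<phi>. test_function {\<alpha><..<\<beta>} \<phi> \<Longrightarrow>
      - (LBINT t:{\<alpha><..<\<beta>}. deriv \<phi> t * u t) + (LBINT t:{\<alpha><..<\<beta>}. \<phi> t * g t) = 0"
    and st: "\<alpha> < s" "s < t" "t < \<beta>"
  shows "u t - u s = - (LBINT r:{s<..t}. g r)"
proof -
  let ?I = "{\<alpha><..<\<beta>}"
  obtain \<rho> c where \<rho>: "\<And>x. (\<rho> has_real_derivative c * flat_bump 1 0 x) (at x)"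
    "\<And>x. 0 \<le> \<rho> x" "\<And>x. \<rho> x \<le> 1" "\<And>x. x \<le> 0 \<Longrightarrow> \<rho> x = 0" "\<And>x. 1 \<le> x \<Longrightarrow> \<rho> x = 1" and c: "0 < c"
    using smooth_step_exists by blast
  define b where "b x = c * flat_bump 1 0 x" for x
  have b: "isCont b x" "0 \<le> b x" for x
    using c by (auto simp: b_def[abs_def] intro!: continuous_intros isCont_flat_bump)
      (auto simp: flat_bump_def)
  have b0: "b x = 0" if "x \<notin> {0<..<1}" for x using that by (auto simp: b_def flat_bump_def)
  have cb: "continuous_on UNIV b" using b by (auto intro: continuous_at_imp_continuous_on)
  have d\<rho>: "(\<rho> has_real_derivative b x) (at x)" for x using \<rho>(1) by (simp add: b_def)
  define \<delta> where "\<delta> = (\<beta> - t) / 2"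
  have \<delta>: "0 < \<delta>" "t + \<delta> < \<beta>" using st by (auto simp: \<delta>_def field_simps)
  let ?K = "{s..t + \<delta>}"
  have K: "?K \<subseteq> ?I" using st \<delta> by auto
  obtain n0 where n0: "1 / \<delta> \<le> real n0" using real_arch_simple by blast
  define \<phi> where "\<phi> n r = \<rho> (real n * (r - s)) - \<rho> (real n * (r - t))" for n r
  have \<phi>K: "\<phi> n r = 0" if "n0 \<le> n" "r \<notin> ?K" for n r
  proof (cases "r < s")
    case True
    then have "real n * (r - s) \<le> 0" "real n * (r - t) \<le> 0"
      using st by (auto intro!: mult_nonneg_nonpos)
    then show ?thesis by (simp add: \<phi>_def \<rho>(4))
  next
    case False
    then have r: "t + \<delta> \<le> r" using that by auto
    have "1 \<le> real n0 * \<delta>" using n0 \<delta> by (simp add: field_simps)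
    also have "\<dots> \<le> real n * (r - t)" using that r \<delta> by (intro mult_mono) auto
    finally have "1 \<le> real n * (r - t)" .
    moreover have "real n * (r - t) \<le> real n * (r - s)" using st by (intro mult_left_mono) auto
    ultimately show ?thesis by (simp add: \<phi>_def \<rho>(5))
  qed
  have d\<phi>: "(\<phi> n has_real_derivative real n * b (real n * (r - s)) - real n * b (real n * (r - t))) (at r)" for n r
    unfolding \<phi>_def[abs_def] by (auto intro!: derivative_eq_intros DERIV_chain2[OF d\<rho>])
  have test: "test_function ?I (\<phi> n)" if "n0 \<le> n" for n
    unfolding test_function_def
  proof (intro conjI allI exI[of _ ?K] impI)
    show "((deriv ^^ k) (\<phi> n)) field_differentiable at x" for k x
      unfolding \<phi>_def by (rule smooth_step_difference[OF \<rho>(1)])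
  qed (use \<phi>K[OF that] K in auto)
  have int_b: "set_integrable lborel ?I (\<lambda>r. real n * b (real n * (r - p)) * u r)"
    if p: "s \<le> p" "p \<le> t" and n: "n0 \<le> n" for p n
  proof -
    have iK: "set_integrable lborel ?K (\<lambda>r. real n * b (real n * (r - p)) * u r)"
      by (intro borel_integrable_atLeastAtMost' continuous_on_mult continuous_on_const
          continuous_on_subset[OF u K] continuous_on_compose2[OF cb] continuous_on_diff continuous_on_id) auto
    have eq: "indicator ?I r *\<^sub>R (real n * b (real n * (r - p)) * u r)
        = indicator ?K r *\<^sub>R (real n * b (real n * (r - p)) * u r)" for r
    proof (cases "r \<in> ?K")
      case False
      have "b (real n * (r - p)) = 0"
      proof (cases "r < s")
        case True
        then have "real n * (r - p) \<le> 0" using p by (simp add: mult_nonneg_nonpos)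
        then show ?thesis by (intro b0) auto
      next
        case 2: False
        then have r: "t + \<delta> \<le> r" using False by auto
        have "1 \<le> real n0 * \<delta>" using n0 \<delta> by (simp add: field_simps)
        also have "\<dots> \<le> real n * (r - p)" using n p r \<delta> by (intro mult_mono) auto
        finally show ?thesis by (intro b0) auto
      qed
      then show ?thesis by simp
    qed (use K in auto)
    show ?thesis using iK unfolding set_integrable_def eq .
  qed
  define X where "X p n = (LBINT r:?I. real n * b (real n * (r - p)) * u r)" for p n
  define Z where "Z n = (LBINT r:?I. \<phi> n r * g r)" for n
  have X: "X p \<longlonglongrightarrow> u p" if "s \<le> p" "p \<le> t" for p
    unfolding X_def
    by (rule concentrating_kernel_tendsto[OF d\<rho> b b0 _ _ _ _ u]) (use that st \<rho> in auto)
  have ev: "- (X s n - X t n) + Z n = 0" if "n0 \<le> n" for n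
  proof -
    have "(LBINT r:?I. deriv (\<phi> n) r * u r)
      = (LBINT r:?I. real n * b (real n * (r - s)) * u r - real n * b (real n * (r - t)) * u r)"
      by (intro set_lebesgue_integral_cong) (auto simp: DERIV_imp_deriv[OF d\<phi>] algebra_simps)
    also have "\<dots> = X s n - X t n"
      unfolding X_def by (intro set_integral_diff int_b) (use that st in auto)
    finally show ?thesis using weak[OF test[OF that]] by (simp add: Z_def)
  qed
  have gK: "set_integrable lborel ?K g" by (intro g K) auto
  have "(\<lambda>n. \<integral>r. indicator ?K r *\<^sub>R (\<phi> n r * g r) \<partial>lborel) \<longlonglongrightarrow> (\<integral>r. indicator {s<..t} r *\<^sub>R g r \<partial>lborel)"
  proof (rule integral_dominated_convergence[where w = "\<lambda>r. norm (indicator ?K r *\<^sub>R g r)"])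
    have sub: "set_integrable lborel {s<..t} g"
      by (rule set_integrable_subset[OF gK]) (use \<delta> in auto)
    then show "(\<lambda>r. indicator {s<..t} r *\<^sub>R g r) \<in> borel_measurable lborel"
      by (auto simp: set_integrable_def)
    show "integrable lborel (\<lambda>r. norm (indicator ?K r *\<^sub>R g r))"
      using gK by (auto simp: set_integrable_def)
    have \<phi>m: "\<phi> n \<in> borel_measurable borel" for n
      using d\<phi> DERIV_isCont by (intro borel_measurable_continuous_onI continuous_at_imp_continuous_on) blast
    have "(\<lambda>r. \<phi> n r * (indicator ?K r *\<^sub>R g r)) \<in> borel_measurable lborel" for n
      using gK \<phi>m by (intro borel_measurable_times) (auto simp: set_integrable_def)
    then show "(\<lambda>r. indicator ?K r *\<^sub>R (\<phi> n r * g r)) \<in> borel_measurable lborel" for n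
      by (simp add: algebra_simps)
    show "AE r in lborel. norm (indicator ?K r *\<^sub>R (\<phi> n r * g r)) \<le> norm (indicator ?K r *\<^sub>R g r)" for n
    proof (intro always_eventually allI)
      fix r
      have "\<bar>\<phi> n r\<bar> \<le> 1" using \<rho>(2,3) unfolding \<phi>_def by (smt (verit))
      then show "norm (indicator ?K r *\<^sub>R (\<phi> n r * g r)) \<le> norm (indicator ?K r *\<^sub>R g r)"
        by (auto simp: abs_mult indicator_def intro: mult_left_le_one_le)
    qed
    show "AE r in lborel. (\<lambda>n. indicator ?K r *\<^sub>R (\<phi> n r * g r)) \<longlonglongrightarrow> indicator {s<..t} r *\<^sub>R g r"
    proof (intro always_eventually allI)
      fix r
      have step: "(\<lambda>n. \<rho> (real n * x)) \<longlonglongrightarrow> (if 0 < x then 1 else 0)" for x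
      proof (cases "0 < x")
        case True
        obtain m where m: "1 / x \<le> real m" using real_arch_simple by blast
        have "\<rho> (real n * x) = 1" if "m \<le> n" for n
        proof -
          have "1 \<le> real m * x" using m True by (simp add: field_simps)
          also have "\<dots> \<le> real n * x" using that True by (intro mult_right_mono) auto
          finally show ?thesis by (rule \<rho>(5))
        qed
        then show ?thesis using True by (auto intro!: tendsto_eventually eventually_sequentiallyI[of m])
      next
        case False
        then show ?thesis by (auto simp: \<rho>(4) mult_nonneg_nonpos)
      qed
      have "(\<lambda>n. \<phi> n r) \<longlonglongrightarrow> (if 0 < r - s then 1 else 0) - (if 0 < r - t then 1 else 0)"
        unfolding \<phi>_def by (intro tendsto_diff step)
      then have "(\<lambda>n. indicator ?K r *\<^sub>R (\<phi> n r * g r)) \<longlonglongrightarrow>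
          indicator ?K r *\<^sub>R (((if 0 < r - s then 1 else 0) - (if 0 < r - t then 1 else 0)) * g r)"
        by (intro tendsto_intros)
      also have "indicator ?K r *\<^sub>R (((if 0 < r - s then 1 else 0) - (if 0 < r - t then 1 else 0)) * g r)
          = indicator {s<..t} r *\<^sub>R g r"
        using st \<delta> by (auto simp: indicator_def)
      finally show "(\<lambda>n. indicator ?K r *\<^sub>R (\<phi> n r * g r)) \<longlonglongrightarrow> indicator {s<..t} r *\<^sub>R g r" .
    qed
  qed
  moreover have "Z n = (\<integral>r. indicator ?K r *\<^sub>R (\<phi> n r * g r) \<partial>lborel)" if "n0 \<le> n" for n
    unfolding Z_def set_lebesgue_integral_def
  proof (intro Bochner_Integration.integral_cong refl)
    fix r show "indicator ?I r *\<^sub>R (\<phi> n r * g r) = indicator ?K r *\<^sub>R (\<phi> n r * g r)"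
      using \<phi>K[OF that] K by (cases "r \<in> ?K") auto
  qed
  ultimately have Z: "Z \<longlonglongrightarrow> (LBINT r:{s<..t}. g r)"
    unfolding set_lebesgue_integral_def
    by (subst tendsto_cong[where g = "\<lambda>n. \<integral>r. indicator ?K r *\<^sub>R (\<phi> n r * g r) \<partial>lborel"])
      (auto intro: eventually_sequentiallyI[of n0])
  have "(\<lambda>n. - (X s n - X t n) + Z n) \<longlonglongrightarrow> - (u s - u t) + (LBINT r:{s<..t}. g r)"
    by (intro tendsto_intros X Z) (use st in auto)
  moreover have "(\<lambda>n. - (X s n - X t n) + Z n) \<longlonglongrightarrow> 0"
    by (rule tendsto_eventually) (use ev in \<open>auto intro: eventually_sequentiallyI[of n0]\<close>)
  ultimately have "- (u s - u t) + (LBINT r:{s<..t}. g r) = 0"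
    by (rule LIMSEQ_unique)
  then show ?thesis by simp
qed

text \<open>Only the integrated form of the derivative of \<open>u\<close> is at hand. Inserting
  \<open>u x = u s - \<integral>\<^sub>s\<^sup>x g\<close> and exchanging the order of integration leaves the inner integral of \<open>\<phi>'\<close> over
  \<open>[r, t]\<close>, which is \<open>- \<phi> r\<close>.\<close>

lemma integral_by_parts_increment:
  fixes u g \<phi> \<phi>' :: "real \<Rightarrow> real"
  assumes incr: "\<And>s t. \<alpha> < s \<Longrightarrow> s < t \<Longrightarrow> t < \<beta> \<Longrightarrow> u t - u s = - (LBINT r:{s<..t}. g r)"
    and g: "\<And>K. compact K \<Longrightarrow> K \<subseteq> {\<alpha><..<\<beta>} \<Longrightarrow> set_integrable lborel K g"
    and \<phi>: "\<And>t. (\<phi> has_real_derivative \<phi>' t) (at t)" "\<And>t. isCont \<phi>' t"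
    and K: "compact K" "K \<subseteq> {\<alpha><..<\<beta>}" "\<And>t. t \<notin> K \<Longrightarrow> \<phi> t = 0" and "\<alpha> < \<beta>"
  shows "(LBINT t:{\<alpha><..<\<beta>}. \<phi>' t * u t) = (LBINT t:{\<alpha><..<\<beta>}. \<phi> t * g t)"
proof -
  let ?I = "{\<alpha><..<\<beta>}"
  obtain s t where st: "\<alpha> < s" "s < t" "t < \<beta>" "K \<subseteq> {s<..<t}"
  proof (cases "K = {}")
    case True
    obtain s where "\<alpha> < s" "s < \<beta>" using dense \<open>\<alpha> < \<beta>\<close> by blast
    moreover obtain t where "s < t" "t < \<beta>" using dense calculation by blast
    ultimately show thesis using that True by blast
  next
    case False
    obtain l where l: "l \<in> K" "\<And>x. x \<in> K \<Longrightarrow> l \<le> x" using compact_attains_inf[OF K(1) False] by blast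
    obtain m where m: "m \<in> K" "\<And>x. x \<in> K \<Longrightarrow> x \<le> m" using compact_attains_sup[OF K(1) False] by blast
    have "\<alpha> < l" "m < \<beta>" using l(1) m(1) K(2) by auto
    obtain s where s: "\<alpha> < s" "s < l" using dense[OF \<open>\<alpha> < l\<close>] by blast
    obtain t where t: "m < t" "t < \<beta>" using dense[OF \<open>m < \<beta>\<close>] by blast
    have "K \<subseteq> {s<..<t}" using l(2) m(2) s t by fastforce
    moreover have "s < t" using l(2)[OF m(1)] s t by linarith
    ultimately show thesis using that s t by blast
  qed
  let ?S = "{s<..t}"
  have S: "?S \<subseteq> ?I" using st by auto
  have d0: "\<phi>' r = 0" if "r \<notin> K" for r
  proof -
    have "open (- K)" using K(1) by (simp add: compact_imp_closed open_Compl)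
    moreover have "r \<in> - K" using that by simp
    ultimately have "\<forall>\<^sub>F x in nhds r. 0 = \<phi> x"
      unfolding eventually_nhds using K(3) by (intro exI[of _ "- K"]) auto
    then have "(\<phi> has_real_derivative 0) (at r)"
      by (rule DERIV_cong_ev[THEN iffD1, OF refl _ refl]) simp
    then show ?thesis using \<phi>(1) DERIV_unique by blast
  qed
  have \<phi>st: "\<phi> s = 0" "\<phi> t = 0" by (rule K(3); use st in auto)+
  have gS: "set_integrable lborel ?S g"
  proof (rule set_integrable_subset)
    show "set_integrable lborel {s..t} g" by (rule g) (use st in auto)
  qed auto
  have "\<exists>B. \<forall>r\<in>{s..t}. \<bar>\<phi>' r\<bar> \<le> B"
  proof -
    have "bounded (\<phi>' ` {s..t})"
      using \<phi>(2) by (intro compact_imp_bounded compact_continuous_image continuous_at_imp_continuous_on) auto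
    then show ?thesis unfolding bounded_iff by fastforce
  qed
  then obtain B where B: "\<And>r. r \<in> {s..t} \<Longrightarrow> \<bar>\<phi>' r\<bar> \<le> B" by blast
  have \<phi>'m [measurable]: "\<phi>' \<in> borel_measurable borel"
    using \<phi>(2) by (intro borel_measurable_continuous_onI continuous_at_imp_continuous_on) blast
  have gm: "(\<lambda>r. indicator ?S r * g r) \<in> borel_measurable borel"
    using gS by (auto simp: set_integrable_def)
  have m2: "(\<lambda>p. indicator ?S (snd p) * g (snd p)) \<in> borel_measurable (lborel \<Otimes>\<^sub>M lborel :: (real \<times> real) measure)"
    by (rule measurable_compose[OF measurable_snd]) (use gm in simp)
  have gi: "integrable lborel (\<lambda>r. indicator ?S r * g r)"
    using gS by (auto simp: set_integrable_def)
  define f where "f x r = (indicator ?S x * \<phi>' x) * (indicator ?S r * g r) * indicator {..x} r" for x r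
  have int_\<phi>': "has_bochner_integral lborel (\<lambda>x. \<phi>' x * indicator {p..t} x) (\<phi> t - \<phi> p)" if "p \<le> t" for p
    by (rule has_bochner_integral_FTC_Icc_real) (use that \<phi> in auto)
  have int_f: "integrable (lborel \<Otimes>\<^sub>M lborel) (case_prod f)"
  proof (rule Bochner_Integration.integrable_bound)
    have 1: "integrable lborel (\<lambda>x. indicator ?S x * B)"
      by (intro integrable_mult_left integrable_real_indicator) (use st in auto)
    show "integrable (lborel \<Otimes>\<^sub>M lborel) (\<lambda>(x, r). (indicator ?S x * B) * (indicator ?S r * g r))"
    proof (rule lborel_pair.Fubini_integrable)
      have "(\<lambda>p. (indicator ?S (fst p) * B) * (indicator ?S (snd p) * g (snd p))) \<in> borel_measurable (lborel \<Otimes>\<^sub>M lborel)"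
      proof (rule borel_measurable_times)
        show "(\<lambda>p. indicator ?S (fst p) * B) \<in> borel_measurable (lborel \<Otimes>\<^sub>M lborel :: (real \<times> real) measure)"
          by measurable
      qed (rule m2)
      then show "(\<lambda>(x, r). (indicator ?S x * B) * (indicator ?S r * g r)) \<in> borel_measurable (lborel \<Otimes>\<^sub>M lborel)"
        by (simp add: case_prod_beta)
      show "integrable lborel (\<lambda>x. \<integral>r. norm ((\<lambda>(x, r). (indicator ?S x * B) * (indicator ?S r * g r)) (x, r)) \<partial>lborel)"
        using 1 by (auto simp: abs_mult intro!: integrable_mult_left integrable_abs)
      show "AE x in lborel. integrable lborel (\<lambda>r. (\<lambda>(x, r). (indicator ?S x * B) * (indicator ?S r * g r)) (x, r))"
        using gi by auto
    qed
    have "case_prod f = (\<lambda>p. (indicator ?S (fst p) * \<phi>' (fst p)) * (indicator ?S (snd p) * g (snd p)) *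
        (if snd p \<le> fst p then 1 else 0))"
      by (auto simp: f_def fun_eq_iff indicator_def)
    also have "\<dots> \<in> borel_measurable (lborel \<Otimes>\<^sub>M lborel)"
    proof (rule borel_measurable_times, rule borel_measurable_times)
      show "(\<lambda>p. indicator ?S (fst p) * \<phi>' (fst p)) \<in> borel_measurable (lborel \<Otimes>\<^sub>M lborel :: (real \<times> real) measure)"
        by measurable
      show "(\<lambda>p. if snd p \<le> fst p then 1 else 0 :: real) \<in> borel_measurable (lborel \<Otimes>\<^sub>M lborel :: (real \<times> real) measure)"
        by measurable
    qed (rule m2)
    finally show "case_prod f \<in> borel_measurable (lborel \<Otimes>\<^sub>M lborel)" .
    show "AE p in lborel \<Otimes>\<^sub>M lborel. norm (case_prod f p)
        \<le> norm (case p of (x, r) \<Rightarrow> (indicator ?S x * B) * (indicator ?S r * g r))"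
    proof (intro always_eventually allI, clarify)
      fix x r
      have "\<bar>\<phi>' x\<bar> \<le> \<bar>B\<bar>" if "x \<in> ?S" using B[of x] that by auto
      then show "norm (f x r) \<le> norm ((indicator ?S x * B) * (indicator ?S r * g r))"
        unfolding f_def by (auto simp: abs_mult indicator_def intro: mult_right_mono)
    qed
  qed
  have left: "(\<integral>r. f x r \<partial>lborel) = indicator ?S x * (\<phi>' x * (u s - u x))" for x
  proof (cases "x \<in> ?S")
    case True
    then have x: "s < x" "x \<le> t" by auto
    have "(\<integral>r. f x r \<partial>lborel) = (\<integral>r. \<phi>' x * (indicator {s<..x} r *\<^sub>R g r) \<partial>lborel)"
      by (rule Bochner_Integration.integral_cong) (use x in \<open>auto simp: f_def indicator_def\<close>)
    also have "\<dots> = \<phi>' x * (LBINT r:{s<..x}. g r)"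
      by (simp add: set_lebesgue_integral_def)
    also have "\<dots> = \<phi>' x * (u s - u x)" using incr[of s x] x st by simp
    finally show ?thesis using True by simp
  qed (simp add: f_def)
  have right: "(\<integral>x. f x r \<partial>lborel) = - (indicator ?S r * (\<phi> r * g r))" for r
  proof (cases "r \<in> ?S")
    case True
    have "(\<integral>x. f x r \<partial>lborel) = (\<integral>x. g r * (\<phi>' x * indicator {r..t} x) \<partial>lborel)"
      by (rule Bochner_Integration.integral_cong) (use True in \<open>auto simp: f_def indicator_def\<close>)
    also have "\<dots> = g r * (\<phi> t - \<phi> r)"
      using int_\<phi>'[of r] True by (simp add: has_bochner_integral_iff)
    finally show ?thesis using True \<phi>st by simp
  qed (simp add: f_def)
  have "(\<integral>x. indicator ?S x * (\<phi>' x * (u s - u x)) \<partial>lborel) = (\<integral>r. - (indicator ?S r * (\<phi> r * g r)) \<partial>lborel)"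
    using lborel_pair.Fubini_integral[OF int_f] by (simp add: left right)
  then have eq: "(\<integral>x. indicator ?S x * (\<phi>' x * (u s - u x)) \<partial>lborel) = - (LBINT r:?S. \<phi> r * g r)"
    by (simp add: set_lebesgue_integral_def)
  have i1: "integrable lborel (\<lambda>x. u s * (\<phi>' x * indicator {s..t} x))"
    using int_\<phi>'[of s] st by (auto simp: has_bochner_integral_iff)
  have z: "(\<integral>x. u s * (\<phi>' x * indicator {s..t} x) \<partial>lborel) = 0"
    using int_\<phi>'[of s] st \<phi>st by (auto simp: has_bochner_integral_iff)
  have i2: "integrable lborel (\<lambda>x. indicator ?S x * (\<phi>' x * (u s - u x)))"
    using lborel_pair.integrable_fst[OF int_f] by (simp add: left)
  have "(LBINT x:?I. \<phi>' x * u x)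
     = (\<integral>x. u s * (\<phi>' x * indicator {s..t} x) - indicator ?S x * (\<phi>' x * (u s - u x)) \<partial>lborel)"
    unfolding set_lebesgue_integral_def
  proof (rule Bochner_Integration.integral_cong[OF refl])
    fix x
    show "indicator ?I x *\<^sub>R (\<phi>' x * u x)
        = u s * (\<phi>' x * indicator {s..t} x) - indicator ?S x * (\<phi>' x * (u s - u x))"
    proof (cases "x \<in> K")
      case True
      then have "x \<in> ?S" "x \<in> ?I" "x \<in> {s..t}" using st by auto
      then show ?thesis by (simp add: algebra_simps)
    qed (simp add: d0)
  qed
  also have "\<dots> = (LBINT r:?S. \<phi> r * g r)"
    using i1 i2 z eq by simp
  also have "\<dots> = (LBINT r:?I. \<phi> r * g r)"
    unfolding set_lebesgue_integral_def
  proof (rule Bochner_Integration.integral_cong[OF refl])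
    fix r
    show "indicator ?S r *\<^sub>R (\<phi> r * g r) = indicator ?I r *\<^sub>R (\<phi> r * g r)"
    proof (cases "r \<in> K")
      case True
      then have "r \<in> ?S" using st(4) by auto
      moreover from this have "r \<in> ?I" using S by blast
      ultimately show ?thesis by simp
    qed (simp add: K(3))
  qed
  finally show ?thesis .
qed

section \<open>Selection from curves of bounded variation\<close>

text \<open>With \<open>H\<^sub>n t\<close> the integral of \<open>h\<^sub>n\<close> up to time \<open>t\<close>, both \<open>H\<^sub>n\<close> and \<open>H\<^sub>n + u\<^sub>n\<close> are nondecreasing and
  bounded, so that Helly's selection theorem applies to each of them; \<open>u\<^sub>n\<close> is their difference. The
  exceptional set consists of the jumps of the two monotone limits.\<close>

lemma Helly_bounded_variation:
  fixes u h :: "nat \<Rightarrow> real \<Rightarrow> real"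
  assumes "\<alpha> < \<beta>"
    and u: "\<And>n. continuous_on {\<alpha><..<\<beta>} (u n)" "\<And>n t. t \<in> {\<alpha><..<\<beta>} \<Longrightarrow> \<bar>u n t\<bar> \<le> B"
    and h: "\<And>n. set_integrable lborel {\<alpha><..<\<beta>} (h n)" "\<And>n t. t \<in> {\<alpha><..<\<beta>} \<Longrightarrow> 0 \<le> h n t"
      "\<And>n. (LBINT t:{\<alpha><..<\<beta>}. h n t) \<le> C"
    and incr: "\<And>n s t. \<alpha> < s \<Longrightarrow> s < t \<Longrightarrow> t < \<beta> \<Longrightarrow> \<bar>u n t - u n s\<bar> \<le> (LBINT r:{s<..t}. h n r)"
  shows "\<exists>r N. strict_mono (r :: nat \<Rightarrow> nat) \<and> countable N \<and>
    (\<forall>t\<in>{\<alpha><..<\<beta>} - N. convergent (\<lambda>n. u (r n) t))"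
proof -
  let ?I = "{\<alpha><..<\<beta>}"
  \<comment> \<open>An increasing homeomorphism from the line onto the interval: Helly's theorem is about functions on the
    whole line, and a jump at an end point of the interval must not be created by an extension.\<close>
  define \<theta> where "\<theta> s = \<alpha> + (\<beta> - \<alpha>) * (arctan s / pi + 1 / 2)" for s
  have \<theta>_in: "\<theta> s \<in> ?I" for s
  proof -
    have "- (1 / 2) < arctan s / pi"
      by (subst pos_less_divide_eq) (use arctan_lbound[of s] in auto)
    moreover have "arctan s / pi < 1 / 2"
      by (subst pos_divide_less_eq) (use arctan_ubound[of s] in auto)
    ultimately have "0 < arctan s / pi + 1 / 2" "arctan s / pi + 1 / 2 < 1" by linarith+
    then have "0 < (\<beta> - \<alpha>) * (arctan s / pi + 1 / 2)" "(\<beta> - \<alpha>) * (arctan s / pi + 1 / 2) < (\<beta> - \<alpha>) * 1"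
      using \<open>\<alpha> < \<beta>\<close> by (auto intro: mult_strict_left_mono)
    then show ?thesis unfolding \<theta>_def by auto
  qed
  have \<theta>_mono: "\<theta> s \<le> \<theta> t" if "s \<le> t" for s t
    unfolding \<theta>_def using that \<open>\<alpha> < \<beta>\<close> by (intro add_left_mono mult_left_mono) (auto simp: divide_right_mono arctan_monotone')
  have \<theta>_cont: "continuous_on UNIV \<theta>" unfolding \<theta>_def by (intro continuous_intros) auto
  have \<theta>_surj: "\<exists>s. \<theta> s = t" if t: "t \<in> ?I" for t
  proof -
    define y where "y = pi * ((t - \<alpha>) / (\<beta> - \<alpha>) - 1 / 2)"
    have "0 < (t - \<alpha>) / (\<beta> - \<alpha>)" "(t - \<alpha>) / (\<beta> - \<alpha>) < 1" using t \<open>\<alpha> < \<beta>\<close> by auto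
    then have "- (1 / 2) < (t - \<alpha>) / (\<beta> - \<alpha>) - 1 / 2" "(t - \<alpha>) / (\<beta> - \<alpha>) - 1 / 2 < 1 / 2"
      by linarith+
    then have "pi * (- (1 / 2)) < y" "y < pi * (1 / 2)"
      unfolding y_def by (auto simp only: intro!: mult_strict_left_mono pi_gt_zero)
    then have "arctan (tan y) = y" by (intro arctan_tan) auto
    then have "\<theta> (tan y) = t" using \<open>\<alpha> < \<beta>\<close> by (simp add: \<theta>_def y_def)
    then show ?thesis by blast
  qed
  define h' where "h' n r = indicator ?I r * h n r" for n r
  have h'i: "integrable lborel (h' n)" for n using h(1)[of n] by (simp add: set_integrable_def h'_def[abs_def])
  have h'0: "0 \<le> h' n r" for n r using h(2) by (auto simp: h'_def indicator_def)
  define H where "H n t = (LBINT r:{\<alpha>..t}. h' n r)" for n t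
  have Hint: "set_integrable lborel A (h' n)" if "A \<in> sets borel" for A n
    using h'i integrable_mult_indicator[of A lborel "h' n"] that by (auto simp: set_integrable_def)
  have H_diff: "H n t - H n s = (LBINT r:{s<..t}. h n r)" if "\<alpha> < s" "s \<le> t" "t < \<beta>" for n s t
  proof -
    have "H n t = H n s + (LBINT r:{s<..t}. h' n r)"
    proof -
      have "{\<alpha>..t} = {\<alpha>..s} \<union> {s<..t}" using that by auto
      moreover have "{\<alpha>..s} \<inter> {s<..t} = {}" by auto
      ultimately show ?thesis unfolding H_def
        using set_integral_Un[of "{\<alpha>..s}" "{s<..t}" lborel "h' n"] Hint by simp
    qed
    moreover have "(LBINT r:{s<..t}. h' n r) = (LBINT r:{s<..t}. h n r)"
      by (rule set_lebesgue_integral_cong) (use that in \<open>auto simp: h'_def\<close>)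
    ultimately show ?thesis by simp
  qed
  have H0: "0 \<le> H n t" for n t
    unfolding H_def set_lebesgue_integral_def
    by (intro Bochner_Integration.integral_nonneg) (use h'0 in auto)
  have HC: "H n t \<le> C" for n t
  proof -
    have "H n t \<le> (\<integral>r. h' n r \<partial>lborel)"
      unfolding H_def set_lebesgue_integral_def
      by (intro integral_mono Hint[unfolded set_integrable_def] h'i) (auto simp: indicator_def h'0)
    also have "\<dots> = (LBINT t:?I. h n t)" by (simp add: h'_def set_lebesgue_integral_def)
    finally show ?thesis using h(3)[of n] by simp
  qed
  have H_mono: "H n s \<le> H n t" if "\<alpha> < s" "s \<le> t" "t < \<beta>" for n s t
  proof -
    have "0 \<le> (LBINT r:{s<..t}. h n r)"
      unfolding set_lebesgue_integral_def
      by (intro Bochner_Integration.integral_nonneg) (use h that in \<open>auto simp: indicator_def\<close>)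
    then show ?thesis using H_diff[OF that, of n] by simp
  qed
  have H_cont: "continuous_on ?I (H n)" for n
  proof -
    have eq: "H n t = integral {\<alpha>..t} (h' n)" for t
      unfolding H_def by (intro set_borel_integral_eq_integral Hint) auto
    have "h' n integrable_on {\<alpha>..\<beta>}"
      by (intro set_borel_integral_eq_integral Hint) auto
    from indefinite_integral_continuous_1[OF this] show ?thesis
      unfolding eq[abs_def] by (rule continuous_on_subset) auto
  qed
  have contR: "continuous (at_right x) (\<lambda>s. f (\<theta> s))" if "continuous_on ?I f" for f :: "real \<Rightarrow> real" and x
  proof -
    have "continuous_on UNIV (\<lambda>s. f (\<theta> s))"
      by (rule continuous_on_compose2[OF that \<theta>_cont]) (use \<theta>_in in auto)
    then show ?thesis by (simp add: continuous_on_eq_continuous_at continuous_at_imp_continuous_at_within)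
  qed
  obtain s1 F where s1: "strict_mono s1" "mono F"
    "\<And>x. isCont F x \<Longrightarrow> (\<lambda>n. H (s1 n) (\<theta> x)) \<longlonglongrightarrow> F x"
  proof -
    have "\<exists>s. strict_mono (s::nat \<Rightarrow> nat) \<and> (\<exists>F. (\<forall>x. continuous (at_right x) F) \<and> mono F \<and> (\<forall>x. \<bar>F x\<bar> \<le> C) \<and>
    (\<forall>x. continuous (at x) F \<longrightarrow> (\<lambda>n. H (s n) (\<theta> x)) \<longlonglongrightarrow> F x))"
    proof (rule Helly_selection)
      show "continuous (at_right x) (\<lambda>x. H n (\<theta> x))" for n x by (rule contR[OF H_cont])
      show "mono (\<lambda>x. H n (\<theta> x))" for n
        using \<theta>_in by (intro monoI H_mono \<theta>_mono) (auto simp del: \<theta>_def)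
      show "\<bar>H n (\<theta> x)\<bar> \<le> C" for n x using H0 HC by (simp add: abs_le_iff)
    qed
    then show thesis using that by blast
  qed
  define w where "w n t = H (s1 n) t + u (s1 n) t" for n t
  obtain s2 G where s2: "strict_mono s2" "mono G"
    "\<And>x. isCont G x \<Longrightarrow> (\<lambda>n. w (s2 n) (\<theta> x)) \<longlonglongrightarrow> G x"
  proof -
    have "\<exists>s. strict_mono (s::nat \<Rightarrow> nat) \<and> (\<exists>F. (\<forall>x. continuous (at_right x) F) \<and> mono F \<and> (\<forall>x. \<bar>F x\<bar> \<le> C + B) \<and>
    (\<forall>x. continuous (at x) F \<longrightarrow> (\<lambda>n. w (s n) (\<theta> x)) \<longlonglongrightarrow> F x))"
    proof (rule Helly_selection)
      show "continuous (at_right x) (\<lambda>x. w n (\<theta> x))" for n x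
        unfolding w_def by (intro contR continuous_on_add H_cont u)
      show "mono (\<lambda>x. w n (\<theta> x))" for n
      proof (rule monoI)
        fix x y :: real assume "x \<le> y"
        have *: "\<alpha> < \<theta> x" "\<theta> x \<le> \<theta> y" "\<theta> y < \<beta>" using \<theta>_in \<theta>_mono[OF \<open>x \<le> y\<close>] by auto
        show "w n (\<theta> x) \<le> w n (\<theta> y)"
          using H_diff[OF *, of "s1 n"] incr[of "\<theta> x" "\<theta> y" "s1 n"] *
          by (cases "\<theta> x = \<theta> y") (auto simp: w_def)
      qed
      show "\<bar>w n (\<theta> x)\<bar> \<le> C + B" for n x
        using H0[of "s1 n" "\<theta> x"] HC[of "s1 n" "\<theta> x"] u(2)[OF \<theta>_in, of "s1 n" x] unfolding w_def by linarith
    qed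
    then show thesis using that by blast
  qed
  define N where "N = \<theta> ` ({x. \<not> isCont F x} \<union> {x. \<not> isCont G x})"
  have "convergent (\<lambda>n. u ((s1 \<circ> s2) n) t)" if t: "t \<in> ?I - N" for t
  proof -
    obtain x where x: "\<theta> x = t" using \<theta>_surj t by blast
    then have c: "isCont F x" "isCont G x" using t by (auto simp: N_def)
    have "(\<lambda>n. H (s1 (s2 n)) (\<theta> x)) \<longlonglongrightarrow> F x"
      using LIMSEQ_subseq_LIMSEQ[OF s1(3)[OF c(1)] s2(1)] by (simp add: comp_def)
    from tendsto_diff[OF s2(3)[OF c(2)] this] show ?thesis
      unfolding convergent_def by (auto simp: w_def x)
  qed
  moreover have "countable N"
    unfolding N_def using mono_ctble_discont s1 s2 by blast
  moreover have "strict_mono (s1 \<circ> s2)" using s1 s2 strict_mono_o by blast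
  ultimately show ?thesis by blast
qed

section \<open>The topology of the torus\<close>

lemma to_torus_eq_iff: "to_torus x = to_torus y \<longleftrightarrow> (\<forall>i. x $ i - y $ i \<in> \<int>)"
  by (simp add: torus.abs_eq_iff torus_rel_def)

lemma to_torus_rep [simp]: "to_torus (rep_torus p) = p"
  by (rule Quotient_abs_rep[OF Quotient_torus])

lemma rep_to_torus_Ints: "rep_torus (to_torus x) $ i - x $ i \<in> \<int>"
  using to_torus_rep[of "to_torus x"] by (simp only: to_torus_eq_iff)

lemma open_torus_iff: "open U \<longleftrightarrow> open (to_torus -` U)"
  by (simp add: open_torus_def)

lemma continuous_on_torus_iff:
  "continuous_on UNIV f \<longleftrightarrow> continuous_on UNIV (\<lambda>x. f (to_torus x))"
  by (simp add: continuous_on_open_vimage open_torus_iff vimage_def)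

lemma continuous_to_torus: "continuous_on A to_torus"
  by (rule continuous_on_subset[of UNIV]) (simp_all add: continuous_on_open_vimage open_torus_iff)

text \<open>The preimage of the image is the union of all integer translates of \<open>S\<close>.\<close>

lemma open_image_to_torus:
  assumes "open S"
  shows "open (to_torus ` S)"
proof -
  have "to_torus -` (to_torus ` S) = (\<Union>k\<in>{k. \<forall>i. k $ i \<in> \<int>}. (\<lambda>x. k + x) ` S)"
  proof (intro set_eqI iffI)
    fix x assume "x \<in> to_torus -` (to_torus ` S)"
    then obtain y where y: "y \<in> S" "\<And>i. x $ i - y $ i \<in> \<int>" by (auto simp: to_torus_eq_iff)
    then show "x \<in> (\<Union>k\<in>{k. \<forall>i. k $ i \<in> \<int>}. (\<lambda>x. k + x) ` S)"
      by (intro UN_I[of "x - y"] image_eqI[of _ _ y]) auto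
  next
    fix x assume "x \<in> (\<Union>k\<in>{k. \<forall>i. k $ i \<in> \<int>}. (\<lambda>x. k + x) ` S)"
    then obtain k y where k: "\<forall>i. k $ i \<in> \<int>" "y \<in> S" "x = k + y" by auto
    then have "to_torus x = to_torus y" by (simp add: to_torus_eq_iff)
    then show "x \<in> to_torus -` (to_torus ` S)" using k by auto
  qed
  then show ?thesis using assms by (auto simp: open_torus_iff intro: open_translation)
qed

definition torus_cos :: "'d::finite \<Rightarrow> 'd torus \<Rightarrow> real" where
  "torus_cos i p = cos (2 * pi * rep_torus p $ i)"

definition torus_sin :: "'d::finite \<Rightarrow> 'd torus \<Rightarrow> real" where
  "torus_sin i p = sin (2 * pi * rep_torus p $ i)"

lemma torus_cos_sin_to_torus:
  "torus_cos i (to_torus x) = cos (2 * pi * x $ i)" "torus_sin i (to_torus x) = sin (2 * pi * x $ i)"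
proof -
  obtain n where n: "n \<in> \<int>" "rep_torus (to_torus x) $ i = x $ i + n"
    using rep_to_torus_Ints[of x i] by (metis add.commute diff_add_cancel)
  have "2 * pi * rep_torus (to_torus x) $ i = 2 * pi * x $ i + 2 * pi * n"
    using n by (simp add: algebra_simps)
  then show "torus_cos i (to_torus x) = cos (2 * pi * x $ i)" "torus_sin i (to_torus x) = sin (2 * pi * x $ i)"
    using n(1) by (simp_all only: torus_cos_def torus_sin_def cos_add sin_add cos_integer_2pi sin_integer_2pi mult_1_right mult_zero_right diff_0_right add_0_right)
qed

lemma continuous_torus_cos_sin:
  "continuous_on UNIV (torus_cos i)" "continuous_on UNIV (torus_sin i)"
  by (auto simp: continuous_on_torus_iff torus_cos_sin_to_torus intro!: continuous_intros)

lemma torus_cos_sin_separate: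
  assumes "p \<noteq> q"
  shows "\<exists>i. torus_cos i p \<noteq> torus_cos i q \<or> torus_sin i p \<noteq> torus_sin i q"
proof (rule ccontr)
  assume "\<not> ?thesis"
  then have "\<exists>n::int. 2 * pi * rep_torus p $ i = 2 * pi * rep_torus q $ i + 2 * pi * n" for i
    by (subst sin_cos_eq_iff[symmetric]) (simp add: torus_cos_def torus_sin_def)
  then have "\<exists>n::int. rep_torus p $ i - rep_torus q $ i = n" for i
  proof -
    obtain n :: int where "2 * pi * rep_torus p $ i = 2 * pi * (rep_torus q $ i + n)"
      using \<open>\<And>i. \<exists>n::int. _ i n\<close>[of i] by (auto simp: algebra_simps)
    then show ?thesis by (intro exI[of _ n]) simp
  qed
  then have "to_torus (rep_torus p) = to_torus (rep_torus q)"
    unfolding to_torus_eq_iff by (metis Ints_of_int)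
  then show False using assms by simp
qed

text \<open>Distinct points differ in one of the continuous functions \<open>cos (2 \<pi> x\<^sub>i)\<close>, \<open>sin (2 \<pi> x\<^sub>i)\<close>.\<close>

instance torus :: (finite) t2_space
proof
  fix p q :: "'a torus" assume "p \<noteq> q"
  then obtain f :: "'a torus \<Rightarrow> real" where f: "continuous_on UNIV f" "f p \<noteq> f q"
    using torus_cos_sin_separate continuous_torus_cos_sin by blast
  then obtain U V where UV: "open U" "open V" "f p \<in> U" "f q \<in> V" "U \<inter> V = {}"
    using hausdorff[of "f p" "f q"] by blast
  then show "\<exists>U V. open U \<and> open V \<and> p \<in> U \<and> q \<in> V \<and> U \<inter> V = {}"
    using f by (intro exI[of _ "f -` U"] exI[of _ "f -` V"]) (auto simp: open_vimage)
qed

text \<open>The quotient map is open, so it maps a countable base to a countable base.\<close>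

instance torus :: (finite) second_countable_topology
proof
  obtain B :: "(real ^ 'a) set set" where B: "countable B" "topological_basis B"
    using ex_countable_basis by blast
  have "topological_basis ((`) to_torus ` B)"
  proof (rule topological_basisI)
    show "open U" if "U \<in> (`) to_torus ` B" for U
      using that topological_basis_open[OF B(2)] open_image_to_torus by auto
  next
    fix O' :: "'a torus set" and p assume O': "open O'" "p \<in> O'"
    then have "open (to_torus -` O')" "rep_torus p \<in> to_torus -` O'" by (auto simp: open_torus_iff)
    then obtain b where "b \<in> B" "rep_torus p \<in> b" "b \<subseteq> to_torus -` O'"
      using topological_basisE[OF B(2)] by blast
    then show "\<exists>U\<in>(`) to_torus ` B. p \<in> U \<and> U \<subseteq> O'"
      by (intro bexI[of _ "to_torus ` b"]) (auto intro: image_eqI[of _ _ "rep_torus p"])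
  qed
  then show "\<exists>B::'a torus set set. countable B \<and> open = generate_topology B"
    using B(1) topological_basis_imp_subbasis by blast
qed

text \<open>While \<open>rep_torus\<close> chooses an arbitrary representative, this one lies in the unit cube.\<close>

definition frac_rep :: "('d::finite) torus \<Rightarrow> real ^ 'd" where
  "frac_rep p = (\<chi> i. frac (rep_torus p $ i))"

lemma frac_eq_if_diff_Ints: "frac x = frac y" if "x - y \<in> \<int>" for x y :: real
proof -
  obtain n where "x = y + of_int n" using \<open>x - y \<in> \<int>\<close> by (metis Ints_cases add.commute diff_add_cancel)
  then show ?thesis by (simp add: frac_def)
qed

lemma frac_rep_to_torus: "frac_rep (to_torus x) $ i = frac (x $ i)"
  using rep_to_torus_Ints[of x i] by (simp add: frac_rep_def frac_eq_if_diff_Ints)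

lemma to_torus_frac_rep [simp]: "to_torus (frac_rep p) = p"
proof -
  have "to_torus (frac_rep p) = to_torus (rep_torus p)"
    by (auto simp add: to_torus_eq_iff frac_rep_def frac_def simp del: to_torus_rep)
  then show ?thesis by simp
qed

lemma frac_rep_bounds: "0 \<le> frac_rep p $ i" "frac_rep p $ i < 1"
  by (simp_all add: frac_rep_def frac_lt_1)

lemma compact_torus: "compact (UNIV :: ('d::finite) torus set)"
proof -
  have "p \<in> to_torus ` cbox 0 1" for p :: "'d torus"
    by (rule image_eqI[of _ _ "frac_rep p"])
      (auto simp: cbox_def Basis_vec_def inner_axis frac_rep_bounds less_imp_le)
  then have "UNIV = to_torus ` cbox (0 :: real ^ 'd) 1" by blast
  then show ?thesis by (metis compact_continuous_image continuous_to_torus compact_cbox)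
qed

text \<open>The coordinate is discontinuous only where it vanishes, and the set of these points is closed, being
  the set where \<open>cos (2 \<pi> x\<^sub>i)\<close> equals 1.\<close>

lemma measurable_frac_rep_component: "(\<lambda>p. frac_rep p $ i) \<in> borel_measurable borel"
proof (rule borel_measurableI_less)
  fix c :: real
  let ?Z = "{p::'a torus. torus_cos i p = 1}"
  have Z: "torus_cos i p = 1 \<longleftrightarrow> frac_rep p $ i = 0" for p
  proof -
    have "cos (2 * pi * frac_rep p $ i) = 1 \<longleftrightarrow> frac_rep p $ i = 0"
    proof
      assume "cos (2 * pi * frac_rep p $ i) = 1"
      then obtain n :: int where "2 * pi * frac_rep p $ i = of_int n * 2 * pi"
        using cos_one_2pi_int by blast
      then have n: "frac_rep p $ i = of_int n" by simp
      then have "0 \<le> n" "n < 1" using frac_rep_bounds[of p i] by simp_all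
      then show "frac_rep p $ i = 0" using n by simp
    qed simp
    then show ?thesis using torus_cos_sin_to_torus(1)[of i "frac_rep p"] by simp
  qed
  have "closed ?Z"
    using continuous_torus_cos_sin(1)[of i] by (intro closed_Collect_eq) auto
  then have Zb: "?Z \<in> sets borel" by simp
  consider "c \<le> 0" | "1 < c" | "0 < c" "c \<le> 1" by linarith
  then show "{p \<in> space borel. frac_rep p $ i < c} \<in> sets borel"
  proof cases
    case 1
    then have "{p \<in> space borel. frac_rep p $ i < c} = {}"
      using frac_rep_bounds(1) by (force simp: not_less intro: order_trans)
    then show ?thesis by simp
  next
    case 2
    then have "{p \<in> space borel. frac_rep p $ i < c} = UNIV"
      using frac_rep_bounds(2) by (force intro: less_trans)
    then show ?thesis by simp
  next
    case 3
    have "to_torus -` {p. 0 < frac_rep p $ i \<and> frac_rep p $ i < c}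
        = (\<Union>n::int. {x. of_int n < x $ i} \<inter> {x. x $ i < of_int n + c})"
    proof (intro set_eqI iffI)
      fix x assume "x \<in> to_torus -` {p. 0 < frac_rep p $ i \<and> frac_rep p $ i < c}"
      then have "0 < frac (x $ i)" "frac (x $ i) < c" by (auto simp: frac_rep_to_torus)
      then show "x \<in> (\<Union>n::int. {x. of_int n < x $ i} \<inter> {x. x $ i < of_int n + c})"
        by (intro UN_I[of "\<lfloor>x $ i\<rfloor>"]) (auto simp: frac_def)
    next
      fix x assume "x \<in> (\<Union>n::int. {x. of_int n < x $ i} \<inter> {x. x $ i < of_int n + c})"
      then obtain n :: int where n: "of_int n < x $ i" "x $ i < of_int n + c" by auto
      then have "\<lfloor>x $ i\<rfloor> = n" using 3 by (simp add: floor_eq_iff)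
      then show "x \<in> to_torus -` {p. 0 < frac_rep p $ i \<and> frac_rep p $ i < c}"
        using n by (simp add: frac_rep_to_torus frac_def)
    qed
    also have "open \<dots>"
      by (intro open_UN ballI open_Int open_Collect_less continuous_intros)
    finally have "open {p::'a torus. 0 < frac_rep p $ i \<and> frac_rep p $ i < c}"
      by (simp add: open_torus_iff)
    moreover have "{p \<in> space borel. frac_rep p $ i < c} =
        {p. 0 < frac_rep p $ i \<and> frac_rep p $ i < c} \<union> ?Z"
      using 3 frac_rep_bounds(1)[of _ i] by (auto simp: Z less_le)
    ultimately show ?thesis using Zb by auto
  qed
qed

text \<open>The distance to the complement of the lifted set is invariant under integer translations and
  descends to the torus.\<close>

lemma torus_open_superlevel:
  fixes U :: "('d::finite) torus set"
  assumes "open U"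
  shows "\<exists>f :: 'd torus \<Rightarrow> real. continuous_on UNIV f \<and> (\<forall>p. 0 \<le> f p \<and> f p \<le> 1) \<and> U = {p. 0 < f p}"
proof (cases "U = UNIV")
  case True
  then show ?thesis by (intro exI[of _ "\<lambda>_. 1"]) auto
next
  case False
  define C where "C = - (to_torus -` U)"
  have closed: "closed C" using assms by (simp add: C_def open_torus_iff closed_def)
  obtain p where "p \<notin> U" using False by blast
  then have "rep_torus p \<in> C" by (simp add: C_def)
  then have ne: "C \<noteq> {}" by blast
  have le: "infdist x C \<le> infdist y C" if xy: "to_torus x = to_torus y" for x y
    unfolding infdist_notempty[OF ne, of y]
  proof (rule cINF_greatest[OF ne])
    fix a assume a: "a \<in> C"
    have "to_torus (a + (x - y)) = to_torus a"
      using xy by (simp add: to_torus_eq_iff)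
    then have "a + (x - y) \<in> C" using a by (simp add: C_def)
    then have "infdist x C \<le> dist x (a + (x - y))" by (rule infdist_le)
    also have "\<dots> = dist y a" by (simp add: dist_norm)
    finally show "infdist x C \<le> dist y a" .
  qed
  define f where "f p = min 1 (infdist (rep_torus p) C)" for p
  have f: "f (to_torus x) = min 1 (infdist x C)" for x
    unfolding f_def using le[of x "rep_torus (to_torus x)"] le[of "rep_torus (to_torus x)" x] by simp
  show ?thesis
  proof (intro exI[of _ f] conjI)
    show "continuous_on UNIV f"
      unfolding continuous_on_torus_iff[of f] f by (intro continuous_intros)
    show "U = {p. 0 < f p}"
    proof (intro set_eqI)
      fix p
      have "p \<in> U \<longleftrightarrow> rep_torus p \<notin> C" by (simp add: C_def)
      also have "\<dots> \<longleftrightarrow> 0 < infdist (rep_torus p) C"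
        using in_closed_iff_infdist_zero[OF closed ne] infdist_nonneg[of "rep_torus p" C] by (auto simp: less_le)
      finally show "p \<in> U \<longleftrightarrow> p \<in> {p. 0 < f p}" by (simp add: f_def)
    qed
  qed (auto simp: f_def infdist_nonneg)
qed

lemma bounded_continuous_torus:
  fixes f :: "('d::finite) torus \<Rightarrow> real"
  assumes "continuous_on UNIV f"
  obtains B where "\<And>p. \<bar>f p\<bar> \<le> B"
  using compact_imp_bounded[OF compact_continuous_image[OF assms compact_torus]]
  unfolding bounded_iff by auto

section \<open>Trigonometric monomials\<close>

text \<open>Parametrised by two functions on a finite type, these functions form a countable family, and
  products of them are again of this form.\<close>

definition trig_monomial :: "('d::finite \<Rightarrow> nat) \<Rightarrow> ('d \<Rightarrow> nat) \<Rightarrow> 'd torus \<Rightarrow> real" where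
  "trig_monomial a b p = (\<Prod>i\<in>UNIV. torus_cos i p ^ a i * torus_sin i p ^ b i)"

inductive trig_polynomial :: "(('d::finite) torus \<Rightarrow> real) \<Rightarrow> bool" where
  monomial: "trig_polynomial (trig_monomial a b)"
| scale: "trig_polynomial f \<Longrightarrow> trig_polynomial (\<lambda>p. c * f p)"
| add: "trig_polynomial f \<Longrightarrow> trig_polynomial g \<Longrightarrow> trig_polynomial (\<lambda>p. f p + g p)"

lemma trig_polynomial_mult:
  assumes "trig_polynomial f" "trig_polynomial g"
  shows "trig_polynomial (\<lambda>p. f p * g p)"
  using assms(1)
proof induction
  case (monomial a b)
  show ?case using assms(2)
  proof induction
    case (monomial c d)
    have "(\<lambda>p. trig_monomial a b p * trig_monomial c d p) = trig_monomial (\<lambda>i. a i + c i) (\<lambda>i. b i + d i)"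
      by (auto simp: trig_monomial_def prod.distrib[symmetric] power_add mult_ac fun_eq_iff)
    then show ?case by (simp add: trig_polynomial.monomial)
  next
    case (scale g c)
    then show ?case using trig_polynomial.scale[OF scale.IH, of c] by (simp add: mult_ac)
  next
    case (add g h)
    then show ?case using trig_polynomial.add[OF add.IH] by (simp add: algebra_simps)
  qed
next
  case (scale f c)
  then show ?case using trig_polynomial.scale[OF scale.IH, of c] by (simp add: mult_ac)
next
  case (add f h)
  then show ?case using trig_polynomial.add[OF add.IH] by (simp add: algebra_simps)
qed

lemma continuous_trig_monomial: "continuous_on UNIV (trig_monomial a b)"
  unfolding trig_monomial_def[abs_def]
  by (intro continuous_on_prod continuous_on_mult continuous_on_power continuous_torus_cos_sin)

lemma continuous_trig_polynomial: "trig_polynomial f \<Longrightarrow> continuous_on UNIV f"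
  by (induction rule: trig_polynomial.induct) (auto intro: continuous_trig_monomial continuous_intros)

lemma trig_monomial_0: "trig_monomial (\<lambda>_. 0) (\<lambda>_. 0) = (\<lambda>p. 1)"
  by (auto simp: trig_monomial_def)

lemma trig_polynomial_const: "trig_polynomial (\<lambda>p. c)"
  using scale[OF monomial, of c "\<lambda>_. 0" "\<lambda>_. 0"] by (simp add: trig_monomial_0)

lemma trig_monomial_single:
  "trig_monomial (\<lambda>j. if j = i then 1 else 0) (\<lambda>_. 0) = torus_cos i"
  "trig_monomial (\<lambda>_. 0) (\<lambda>j. if j = i then 1 else 0) = torus_sin i"
  by (auto simp: trig_monomial_def fun_eq_iff if_distrib[of "\<lambda>n. _ ^ n"] prod.delta cong: if_cong)

text \<open>The trigonometric polynomials are an algebra that separates the points of the torus, so the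
  theorem of Stone and Weierstrass applies.\<close>

lemma trig_polynomial_dense:
  fixes f :: "('d::finite) torus \<Rightarrow> real"
  assumes "continuous_on UNIV f" "0 < e"
  obtains g where "trig_polynomial g" "\<And>p. \<bar>f p - g p\<bar> < e"
proof -
  have "\<exists>g. trig_polynomial g \<and> (\<forall>x\<in>UNIV. \<bar>f x - g x\<bar> < e)"
  proof (rule Stone_Weierstrass_HOL[OF compact_torus])
    show "\<exists>g. trig_polynomial g \<and> g p \<noteq> g q" if "p \<in> UNIV \<and> q \<in> UNIV \<and> p \<noteq> q" for p q :: "'d torus"
      using that torus_cos_sin_separate[of p q] trig_monomial_single by (metis monomial)
  qed (use assms in \<open>auto intro: trig_polynomial_const continuous_trig_polynomial add trig_polynomial_mult\<close>)
  then show thesis using that by auto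
qed

definition torus_lipschitz :: "(('d::finite) torus \<Rightarrow> real) \<Rightarrow> real \<Rightarrow> bool" where
  "torus_lipschitz f L \<longleftrightarrow> (\<forall>x y. \<bar>f (to_torus x) - f (to_torus y)\<bar> \<le> L * norm (x - y))"

lemma torus_lipschitz_mult:
  assumes "torus_lipschitz f L" "torus_lipschitz g M" "\<And>p. \<bar>f p\<bar> \<le> 1" "\<And>p. \<bar>g p\<bar> \<le> 1"
  shows "torus_lipschitz (\<lambda>p. f p * g p) (L + M)"
  unfolding torus_lipschitz_def
proof (intro allI)
  fix x y
  let ?f = "\<lambda>x. f (to_torus x)" and ?g = "\<lambda>x. g (to_torus x)"
  have "\<bar>?f x * ?g x - ?f y * ?g y\<bar> = \<bar>(?f x - ?f y) * ?g x + ?f y * (?g x - ?g y)\<bar>"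
    by (simp add: algebra_simps)
  also have "\<dots> \<le> \<bar>?f x - ?f y\<bar> * \<bar>?g x\<bar> + \<bar>?f y\<bar> * \<bar>?g x - ?g y\<bar>"
    by (rule order_trans[OF abs_triangle_ineq]) (simp add: abs_mult)
  also have "\<dots> \<le> \<bar>?f x - ?f y\<bar> * 1 + 1 * \<bar>?g x - ?g y\<bar>"
    using assms(3,4) by (intro add_mono mult_mono) auto
  also have "\<dots> \<le> (L + M) * norm (x - y)"
    using assms(1,2) unfolding torus_lipschitz_def by (auto simp: distrib_right intro: add_mono)
  finally show "\<bar>?f x * ?g x - ?f y * ?g y\<bar> \<le> (L + M) * norm (x - y)" .
qed

lemma torus_lipschitz_cos_sin: "torus_lipschitz (torus_cos i) (2 * pi)" "torus_lipschitz (torus_sin i) (2 * pi)"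
proof -
  have "\<bar>x $ i - y $ i\<bar> \<le> norm (x - y)" for x y :: "real ^ 'a"
    using component_le_norm_cart[of "x - y" i] by simp
  then have le: "2 * pi * \<bar>x $ i - y $ i\<bar> \<le> 2 * pi * norm (x - y)" for x y :: "real ^ 'a"
    by (intro mult_left_mono) auto
  have lip: "\<bar>h (2 * pi * a) - h (2 * pi * b)\<bar> \<le> 2 * pi * \<bar>a - b\<bar>"
    if "\<And>x. (h has_real_derivative h' x) (at x)" "\<And>x. \<bar>h' x\<bar> \<le> 1" for h h' :: "real \<Rightarrow> real" and a b
  proof -
    have "norm (h (2 * pi * a) - h (2 * pi * b)) \<le> 1 * norm (2 * pi * a - 2 * pi * b)"
      by (rule field_differentiable_bound[of UNIV h h']) (use that in auto)
    also have "\<dots> = 2 * pi * \<bar>a - b\<bar>"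
      by (simp add: abs_mult right_diff_distrib[symmetric])
    finally show ?thesis by simp
  qed
  show "torus_lipschitz (torus_cos i) (2 * pi)"
    unfolding torus_lipschitz_def torus_cos_sin_to_torus
    using le by (intro allI order_trans[OF lip[where h' = "\<lambda>x. - sin x"]]) (auto intro!: derivative_eq_intros)
  show "torus_lipschitz (torus_sin i) (2 * pi)"
    unfolding torus_lipschitz_def torus_cos_sin_to_torus
    using le by (intro allI order_trans[OF lip[where h' = cos]]) (auto intro!: derivative_eq_intros)
qed

lemma abs_torus_cos_sin_le: "\<bar>torus_cos i p\<bar> \<le> 1" "\<bar>torus_sin i p\<bar> \<le> 1"
  by (auto simp: torus_cos_def torus_sin_def)

lemma torus_lipschitz_power:
  assumes "torus_lipschitz f L" "\<And>p. \<bar>f p\<bar> \<le> 1"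
  shows "torus_lipschitz (\<lambda>p. f p ^ n) (real n * L)"
proof (induction n)
  case (Suc n)
  have "\<bar>f p ^ n\<bar> \<le> 1" for p
    using assms(2)[of p] by (simp add: power_abs power_le_one)
  from torus_lipschitz_mult[OF assms(1) Suc assms(2) this] show ?case
    by (simp add: algebra_simps)
qed (simp add: torus_lipschitz_def)

lemma torus_lipschitz_trig_monomial: "\<exists>L. torus_lipschitz (trig_monomial a b) L"
proof -
  have "\<exists>L. torus_lipschitz (\<lambda>p. \<Prod>i\<in>I. torus_cos i p ^ a i * torus_sin i p ^ b i) L"
    if "finite I" for I
    using that
  proof induction
    case (insert i I)
    then obtain L where L: "torus_lipschitz (\<lambda>p. \<Prod>i\<in>I. torus_cos i p ^ a i * torus_sin i p ^ b i) L" by blast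
    have 1: "\<bar>torus_cos i p ^ m\<bar> \<le> 1" "\<bar>torus_sin i p ^ m\<bar> \<le> 1" for i :: 'a and p m
      by (auto simp: power_abs intro!: power_le_one abs_torus_cos_sin_le)
    have 2: "\<bar>torus_cos i p ^ a i * torus_sin i p ^ b i\<bar> \<le> 1" for i p
      using mult_mono[OF 1(1)[of i p "a i"] 1(2)[of i p "b i"]] by (simp add: abs_mult)
    have 3: "\<bar>\<Prod>i\<in>I. torus_cos i p ^ a i * torus_sin i p ^ b i\<bar> \<le> 1" for p
      unfolding abs_prod by (rule prod_le_1) (use 2 in auto)
    from torus_lipschitz_mult[OF torus_lipschitz_mult[OF torus_lipschitz_power[OF torus_lipschitz_cos_sin(1)]
          torus_lipschitz_power[OF torus_lipschitz_cos_sin(2)] 1] L 2 3, of i] insert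
    show ?case by (auto intro: abs_torus_cos_sin_le)
  qed (auto simp: torus_lipschitz_def intro!: exI[of _ 0])
  from this[OF finite] show ?thesis by (simp add: trig_monomial_def[abs_def])
qed

section \<open>The discrete torus and cell averages\<close>

lemma measurable_to_torus: "to_torus \<in> measurable borel borel"
  by (rule borel_measurable_continuous_onI[OF continuous_to_torus])

definition unit_cube :: "(real ^ 'd) set" where
  "unit_cube = {x. \<forall>i. 0 \<le> x $ i \<and> x $ i < 1}"

lemma sets_unit_cube: "(unit_cube :: (real ^ 'd::finite) set) \<in> sets borel"
proof -
  have "(unit_cube :: (real ^ 'd) set) = (\<Inter>i\<in>UNIV. {x. 0 \<le> x $ i} \<inter> {x. x $ i < 1})"
    by (auto simp: unit_cube_def)
  also have "\<dots> \<in> sets borel"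
    by (intro sets.finite_INT sets.Int borel_closed borel_open closed_Collect_le open_Collect_less
        continuous_intros) auto
  finally show ?thesis .
qed

lemma emeasure_unit_cube_le: "emeasure lborel (unit_cube :: (real ^ 'd::finite) set) \<le> 1"
proof -
  have "unit_cube \<subseteq> cbox (0 :: real ^ 'd) 1"
    by (auto simp: unit_cube_def cbox_def Basis_vec_def inner_axis less_imp_le)
  then have "emeasure lborel (unit_cube :: (real ^ 'd) set) \<le> emeasure lborel (cbox (0 :: real ^ 'd) 1)"
    by (intro emeasure_mono) auto
  also have "\<dots> = (\<Prod>b\<in>Basis. (1 - 0 :: real ^ 'd) \<bullet> b)"
    by (subst emeasure_lborel_cbox) (auto simp: Basis_vec_def inner_axis)
  also have "\<dots> = 1"
    by (auto simp: Basis_vec_def inner_axis intro!: prod.neutral)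
  finally show ?thesis .
qed

lemma integrable_unit_cube:
  assumes "f \<in> borel_measurable borel" "\<And>x. \<bar>f x\<bar> \<le> B"
  shows "integrable lborel (\<lambda>x :: real ^ 'd::finite. indicator unit_cube x * f x :: real)"
proof (rule Bochner_Integration.integrable_bound)
  show "integrable lborel (\<lambda>x. indicator unit_cube x * B :: real)"
    using emeasure_unit_cube_le sets_unit_cube
    by (intro integrable_mult_left integrable_real_indicator) (auto intro: le_less_trans)
  show "(\<lambda>x. indicator unit_cube x * f x) \<in> borel_measurable lborel"
  proof -
    have "(\<lambda>x. indicator unit_cube x * f x) \<in> borel_measurable borel"
      by (intro borel_measurable_times borel_measurable_indicator assms(1) sets_unit_cube)
    then show ?thesis by simp
  qed
  have "\<bar>f x\<bar> \<le> \<bar>B\<bar>" for x using assms(2)[of x] by linarith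
  then show "AE x in lborel. norm (indicator unit_cube x * f x) \<le> norm (indicator unit_cube x * B)"
    by (auto simp: abs_mult indicator_def)
qed

lemma integral_unit_cube_le:
  fixes f :: "real ^ 'd::finite \<Rightarrow> real"
  assumes "f \<in> borel_measurable borel" "\<And>x. \<bar>f x\<bar> \<le> B"
  shows "\<bar>\<integral>x. indicator unit_cube x * f x \<partial>(lborel :: (real ^ 'd::finite) measure)\<bar> \<le> B"
proof -
  have B: "0 \<le> B" using order_trans[OF abs_ge_zero assms(2)] .
  have m: "measure lborel (unit_cube :: (real ^ 'd) set) \<le> 1"
    unfolding measure_def using emeasure_unit_cube_le[where 'd = 'd] by (intro enn2real_leI) auto
  have "\<bar>\<integral>x. indicator unit_cube x * f x \<partial>(lborel :: (real ^ 'd) measure)\<bar>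
      \<le> (\<integral>x. indicator unit_cube x * B \<partial>(lborel :: (real ^ 'd) measure))"
  proof (rule order_trans[OF integral_abs_bound], rule integral_mono)
    show "integrable lborel (\<lambda>x :: real ^ 'd. \<bar>indicator unit_cube x * f x\<bar>)"
      by (intro integrable_abs integrable_unit_cube[OF assms])
    show "integrable lborel (\<lambda>x :: real ^ 'd. indicator unit_cube x * B)"
      by (rule integrable_unit_cube[of _ B]) (use B in auto)
    show "\<bar>indicator unit_cube x * f x\<bar> \<le> indicator unit_cube x * B" for x
      using assms(2)[of x] by (auto simp: indicator_def)
  qed
  also have "\<dots> = measure lborel (unit_cube :: (real ^ 'd) set) * B" by simp
  also have "\<dots> \<le> B" using m B by (simp add: mult_left_le_one_le)
  finally show ?thesis .
qed

lemma sets_torus_lebesgue: "sets torus_lebesgue = sets borel"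
  by (simp add: torus_lebesgue_def)

lemma integral_torus_lebesgue:
  assumes "f \<in> borel_measurable borel"
  shows "(\<integral>p. f p \<partial>(torus_lebesgue :: ('d::finite) torus measure)) =
    (\<integral>x. indicator unit_cube x * f (to_torus x) \<partial>lborel :: real)"
proof -
  have "(\<integral>p. f p \<partial>torus_lebesgue) = (\<integral>x. f (to_torus x) \<partial>restrict_space lborel (unit_cube :: (real ^ 'd) set))"
    unfolding torus_lebesgue_def unit_cube_def[symmetric]
    by (intro integral_distr assms measurable_restrict_space1) (simp add: measurable_to_torus)
  also have "\<dots> = (\<integral>x. indicator unit_cube x *\<^sub>R f (to_torus x) \<partial>lborel)"
    by (rule integral_restrict_space) (simp add: sets_unit_cube)
  finally show ?thesis by simp
qed

lemma finite_measure_torus_lebesgue: "finite_measure (torus_lebesgue :: ('d::finite) torus measure)"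
proof (rule finite_measureI)
  have "emeasure (torus_lebesgue :: 'd torus measure) (space torus_lebesgue)
      = emeasure (restrict_space lborel (unit_cube :: (real ^ 'd) set)) (to_torus -` UNIV \<inter> space (restrict_space lborel unit_cube))"
    unfolding torus_lebesgue_def unit_cube_def[symmetric] space_distr space_borel
    by (rule emeasure_distr) (auto intro!: measurable_restrict_space1 simp: measurable_to_torus)
  also have "\<dots> = emeasure lborel (unit_cube :: (real ^ 'd) set)"
    by (subst emeasure_restrict_space) (auto simp: sets_unit_cube space_restrict_space)
  also have "\<dots> \<noteq> \<infinity>" using emeasure_unit_cube_le[where 'd = 'd] by (auto simp: top_unique)
  finally show "emeasure (torus_lebesgue :: 'd torus measure) (space torus_lebesgue) \<noteq> \<infinity>" .
qed

lemma scalesE: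
  assumes "\<epsilon> \<in> scales E"
  obtains N :: nat where "0 < N" "\<epsilon> = 1 / real N" "0 < \<epsilon>"
proof -
  have *: "0 < \<epsilon>" "1 / \<epsilon> \<in> \<nat>" using assms by (auto simp: scales_def)
  then obtain N where N: "1 / \<epsilon> = real N" by (auto elim: Nats_cases)
  then have "\<epsilon> = 1 / real N" using * by (metis divide_divide_eq_right div_by_1 mult_1 mult.commute)
  then show thesis using that[of N] * by (cases "N = 0") auto
qed

definition scaled_site :: "real \<Rightarrow> int ^ 'd \<Rightarrow> real ^ 'd" where
  "scaled_site \<epsilon> z = (\<chi> i. \<epsilon> * real_of_int (z $ i))"

lemma T_eps_eq: "T_eps \<epsilon> z x = (to_torus (scaled_site \<epsilon> (z + fst x)), snd x)"
  by (simp add: T_eps_def scaled_site_def)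

lemma to_torus_scaled_site_eq_iff:
  assumes "0 < N"
  shows "to_torus (scaled_site (1 / real N) z) = to_torus (scaled_site (1 / real N) z') \<longleftrightarrow>
    (\<forall>i. int N dvd z $ i - z' $ i)"
proof -
  have "1 / real N * of_int a - 1 / real N * of_int b \<in> \<int> \<longleftrightarrow> int N dvd a - b" for a b
  proof
    assume "1 / real N * of_int a - 1 / real N * of_int b \<in> \<int>"
    then obtain k where "1 / real N * of_int a - 1 / real N * of_int b = of_int k" by (auto elim: Ints_cases)
    then have "of_int (a - b) = (of_int (int N * k) :: real)" using assms by (simp add: field_simps)
    then have "a - b = int N * k" by (simp only: of_int_eq_iff)
    then show "int N dvd a - b" by simp
  next
    assume "int N dvd a - b"
    then obtain k where "a - b = int N * k" by blast
    then have "of_int a - of_int b = (real N * of_int k :: real)"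
      by (metis of_int_diff of_int_mult of_int_of_nat_eq)
    then have "1 / real N * of_int a - 1 / real N * of_int b = of_int k"
      using assms by (simp add: field_simps)
    then show "1 / real N * of_int a - 1 / real N * of_int b \<in> \<int>" by simp
  qed
  then show ?thesis by (simp add: to_torus_eq_iff scaled_site_def)
qed

lemma Zd_eq: "Zd (1 / real N) = {z. \<forall>i. z $ i \<in> {0..<int N}}"
proof -
  have "real_of_int a < real N \<longleftrightarrow> a < int N" for a by linarith
  then show ?thesis by (simp add: Zd_def)
qed

lemma finite_int_vectors:
  fixes S :: "int set"
  assumes "finite S"
  shows "finite {z :: int ^ 'd::finite. \<forall>i. z $ i \<in> S}" "card {z :: int ^ 'd. \<forall>i. z $ i \<in> S} \<le> card S ^ CARD('d)"
proof -
  have eq: "{z :: int ^ 'd. \<forall>i. z $ i \<in> S} = vec_lambda ` (UNIV \<rightarrow>\<^sub>E S)"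
  proof (intro set_eqI iffI)
    fix z :: "int ^ 'd" assume "z \<in> {z. \<forall>i. z $ i \<in> S}"
    then show "z \<in> vec_lambda ` (UNIV \<rightarrow>\<^sub>E S)" by (intro image_eqI[of _ _ "vec_nth z"]) auto
  qed auto
  have fin: "finite (UNIV \<rightarrow>\<^sub>E S :: ('d \<Rightarrow> int) set)" by (intro finite_PiE assms) auto
  then show "finite {z :: int ^ 'd. \<forall>i. z $ i \<in> S}" unfolding eq by (rule finite_imageI)
  have "card (vec_lambda ` (UNIV \<rightarrow>\<^sub>E S :: ('d \<Rightarrow> int) set)) \<le> card (UNIV \<rightarrow>\<^sub>E S :: ('d \<Rightarrow> int) set)"
    by (rule card_image_le[OF fin])
  then show "card {z :: int ^ 'd. \<forall>i. z $ i \<in> S} \<le> card S ^ CARD('d)"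
    unfolding eq by (simp add: card_PiE)
qed

lemma finite_Zd: "\<epsilon> \<in> scales E \<Longrightarrow> finite (Zd \<epsilon> :: (int ^ 'd::finite) set)"
  by (erule scalesE) (simp only: Zd_eq finite_int_vectors(1) finite_atLeastLessThan_int)

lemma card_Zd_le:
  assumes "\<epsilon> \<in> scales E"
  shows "\<epsilon> ^ CARD('d) * real (card (Zd \<epsilon> :: (int ^ 'd::finite) set)) \<le> 1"
proof -
  obtain N where N: "0 < N" "\<epsilon> = 1 / real N" using scalesE[OF assms] by blast
  have "card (Zd \<epsilon> :: (int ^ 'd) set) \<le> N ^ CARD('d)"
    using finite_int_vectors(2)[of "{0..<int N}", where 'd = 'd] N by (simp add: Zd_eq)
  then have "real (card (Zd \<epsilon> :: (int ^ 'd) set)) \<le> real N ^ CARD('d)"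
    by (metis of_nat_le_iff of_nat_power)
  then have "\<epsilon> ^ CARD('d) * real (card (Zd \<epsilon> :: (int ^ 'd) set)) \<le> \<epsilon> ^ CARD('d) * real N ^ CARD('d)"
    using N by (intro mult_left_mono) auto
  also have "\<dots> = 1" using N by (simp add: power_mult_distrib[symmetric])
  finally show ?thesis .
qed

lemma Zd_representative:
  assumes "\<epsilon> \<in> scales E"
  obtains z' where "z' \<in> Zd \<epsilon>" "\<And>u. to_torus (scaled_site \<epsilon> (z' + u)) = to_torus (scaled_site \<epsilon> (z + u))"
proof -
  obtain N where N: "0 < N" "\<epsilon> = 1 / real N" using scalesE[OF assms] by blast
  show thesis
  proof (rule that[of "\<chi> i. z $ i mod int N"])
    show "(\<chi> i. z $ i mod int N) \<in> Zd \<epsilon>" using N by (simp add: Zd_eq)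
    show "to_torus (scaled_site \<epsilon> ((\<chi> i. z $ i mod int N) + u)) = to_torus (scaled_site \<epsilon> (z + u))" for u
      unfolding N(2) by (simp add: to_torus_scaled_site_eq_iff[OF N(1)] mod_eq_dvd_iff[symmetric])
  qed
qed

lemma scaled_site_inj_on_Zd:
  assumes "\<epsilon> \<in> scales E" "z \<in> Zd \<epsilon>" "z' \<in> Zd \<epsilon>"
    "to_torus (scaled_site \<epsilon> (z + u)) = to_torus (scaled_site \<epsilon> (z' + u))"
  shows "z = z'"
proof -
  obtain N where N: "0 < N" "\<epsilon> = 1 / real N" using scalesE[OF assms(1)] by blast
  have "z $ i = z' $ i" for i
  proof -
    have "int N dvd z $ i - z' $ i"
      using assms(4) unfolding N(2) to_torus_scaled_site_eq_iff[OF N(1)] by simp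
    moreover have "0 \<le> z $ i" "z $ i < int N" "0 \<le> z' $ i" "z' $ i < int N"
      using assms(2,3) N by (auto simp: Zd_eq)
    ultimately show ?thesis by (metis mod_eq_dvd_iff mod_pos_pos_trivial)
  qed
  then show ?thesis by (simp add: vec_eq_iff)
qed

lemma X_eps_eq:
  assumes "\<epsilon> \<in> scales E"
  shows "(X_eps \<epsilon> :: ('a::finite torus \<times> 'b) set) = (\<lambda>(z, v). (to_torus (scaled_site \<epsilon> z), v)) ` (Zd \<epsilon> \<times> UNIV)"
proof (intro set_eqI iffI)
  fix x :: "'a torus \<times> 'b" assume "x \<in> X_eps \<epsilon>"
  then obtain z v where x: "x = (to_torus (scaled_site \<epsilon> z), v)" by (auto simp: X_eps_def T_eps_eq)
  obtain z' where "z' \<in> Zd \<epsilon>" "to_torus (scaled_site \<epsilon> z') = to_torus (scaled_site \<epsilon> z)"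
    using Zd_representative[OF assms, of z] by (metis add_0_right)
  then show "x \<in> (\<lambda>(z, v). (to_torus (scaled_site \<epsilon> z), v)) ` (Zd \<epsilon> \<times> UNIV)"
    using x by (intro image_eqI[of _ _ "(z', v)"]) auto
next
  fix x :: "'a torus \<times> 'b" assume "x \<in> (\<lambda>(z, v). (to_torus (scaled_site \<epsilon> z), v)) ` (Zd \<epsilon> \<times> UNIV)"
  then obtain z v where "x = (to_torus (scaled_site \<epsilon> z), v)" by auto
  then show "x \<in> X_eps \<epsilon>" unfolding X_eps_def by (intro range_eqI[of _ _ "(z, v)"]) (simp add: T_eps_eq)
qed

lemma finite_X_eps: "\<epsilon> \<in> scales E \<Longrightarrow> finite (X_eps \<epsilon> :: (('d::finite) torus \<times> 'v::finite) set)"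
  by (simp add: X_eps_eq finite_Zd)

lemma T_eps_in_X_eps: "T_eps \<epsilon> z x \<in> X_eps \<epsilon>"
  unfolding X_eps_def by (rule range_eqI[of _ _ "(z + fst x, snd x)"]) (simp add: T_eps_eq)

lemma z_of_X_eps:
  assumes "\<epsilon> \<in> scales E" "x \<in> X_eps \<epsilon>"
  shows "z_of \<epsilon> x \<in> Zd \<epsilon>" "fst x = to_torus (scaled_site \<epsilon> (z_of \<epsilon> x))"
proof -
  obtain z where z: "z \<in> Zd \<epsilon>" "fst x = to_torus (scaled_site \<epsilon> z)"
    using assms(2) unfolding X_eps_eq[OF assms(1)] by auto
  have "z_of \<epsilon> x = z"
    unfolding z_of_def scaled_site_def[symmetric]
  proof (rule the_equality)
    fix z' assume "z' \<in> Zd \<epsilon> \<and> fst x = to_torus (scaled_site \<epsilon> z')"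
    then have "z' \<in> Zd \<epsilon>" "to_torus (scaled_site \<epsilon> (z' + 0)) = to_torus (scaled_site \<epsilon> (z + 0))"
      using z(2) by simp_all
    then show "z' = z" by (rule scaled_site_inj_on_Zd[OF assms(1) _ z(1)])
  qed (use z in simp)
  then show "z_of \<epsilon> x \<in> Zd \<epsilon>" "fst x = to_torus (scaled_site \<epsilon> (z_of \<epsilon> x))" using z by simp_all
qed

text \<open>A cell with index in \<open>Zd \<epsilon>\<close> does not wrap around: its representatives in the unit cube form a
  cube.\<close>

lemma cell_eq:
  assumes "\<epsilon> \<in> scales E" "z \<in> Zd \<epsilon>"
  shows "cell \<epsilon> z = {p. \<forall>i. \<epsilon> * z $ i \<le> frac_rep p $ i \<and> frac_rep p $ i < \<epsilon> * z $ i + \<epsilon>}"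
proof -
  obtain N where N: "0 < N" "\<epsilon> = 1 / real N" "0 < \<epsilon>" using scalesE[OF assms(1)] by blast
  have bound: "0 \<le> \<epsilon> * z $ i" "\<epsilon> * z $ i + \<epsilon> \<le> 1" for i
  proof -
    have "0 \<le> z $ i" "z $ i < int N" using assms(2) unfolding N(2) Zd_eq by auto
    then have "0 \<le> real_of_int (z $ i)" "real_of_int (z $ i) + 1 \<le> real N" by linarith+
    then have "0 \<le> \<epsilon> * z $ i" "\<epsilon> * (z $ i + 1) \<le> \<epsilon> * real N"
      using N(3) by (auto intro!: mult_left_mono simp del: of_int_add)
    moreover have "\<epsilon> * real N = 1" using N by simp
    ultimately show "0 \<le> \<epsilon> * z $ i" "\<epsilon> * z $ i + \<epsilon> \<le> 1" by (simp_all add: distrib_left)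
  qed
  show ?thesis
  proof (intro set_eqI iffI)
    fix p assume "p \<in> cell \<epsilon> z"
    then obtain y where y: "p = to_torus y" "\<And>i. \<epsilon> * z $ i \<le> y $ i \<and> y $ i < \<epsilon> * z $ i + \<epsilon>"
      by (auto simp: cell_def)
    have "frac (y $ i) = y $ i" for i
      unfolding frac_eq using y(2)[of i] bound[of i] by auto
    then show "p \<in> {p. \<forall>i. \<epsilon> * z $ i \<le> frac_rep p $ i \<and> frac_rep p $ i < \<epsilon> * z $ i + \<epsilon>}"
      using y by (simp add: frac_rep_to_torus)
  next
    fix p assume "p \<in> {p. \<forall>i. \<epsilon> * z $ i \<le> frac_rep p $ i \<and> frac_rep p $ i < \<epsilon> * z $ i + \<epsilon>}"
    then show "p \<in> cell \<epsilon> z"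
      unfolding cell_def by (intro image_eqI[of _ _ "frac_rep p"]) auto
  qed
qed

lemma sets_cell:
  assumes "\<epsilon> \<in> scales E" "z \<in> Zd \<epsilon>"
  shows "cell \<epsilon> z \<in> sets borel"
proof -
  have "cell \<epsilon> z = (\<Inter>i\<in>UNIV. {p. \<epsilon> * z $ i \<le> frac_rep p $ i} \<inter> {p. frac_rep p $ i < \<epsilon> * z $ i + \<epsilon>})"
    unfolding cell_eq[OF assms] by auto
  also have "\<dots> \<in> sets borel"
  proof (intro sets.finite_INT sets.Int)
    fix i
    note [measurable] = measurable_frac_rep_component[of i]
    show "{p. \<epsilon> * z $ i \<le> frac_rep p $ i} \<in> sets borel" "{p. frac_rep p $ i < \<epsilon> * z $ i + \<epsilon>} \<in> sets borel"
      by measurable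
  qed auto
  finally show ?thesis .
qed

text \<open>Averaging over the cell of a site is the adjoint of \<open>embed\<close>; see \<open>integral_embed\<close> below.\<close>

definition cell_average :: "real \<Rightarrow> (('d::finite) torus \<Rightarrow> real) \<Rightarrow> 'd torus \<times> 'v \<Rightarrow> real" where
  "cell_average \<epsilon> f x = (\<integral>p. (1 / \<epsilon> ^ CARD('d)) * indicator (cell \<epsilon> (z_of \<epsilon> x)) p * f p \<partial>torus_lebesgue)"

lemma integral_lborel_affine:
  fixes h :: "'a::euclidean_space \<Rightarrow> real"
  assumes "h \<in> borel_measurable borel" "0 < c"
  shows "(\<integral>x. h x \<partial>lborel) = c ^ DIM('a) * (\<integral>x. h (t + c *\<^sub>R x) \<partial>lborel)"
proof -
  have m: "(\<lambda>x. t + c *\<^sub>R x) \<in> measurable lborel borel" by simp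
  have "(\<integral>x. h x \<partial>lborel) = (\<integral>x. h x \<partial>density (distr lborel borel (\<lambda>x. t + c *\<^sub>R x)) (\<lambda>_. ennreal (c ^ DIM('a))))"
    using lborel_affine[of c t] assms(2) by (simp add: ennreal_power)
  also have "\<dots> = (\<integral>x. c ^ DIM('a) *\<^sub>R h x \<partial>distr lborel borel (\<lambda>x. t + c *\<^sub>R x))"
    by (rule integral_density) (use assms in auto)
  also have "\<dots> = (\<integral>x. c ^ DIM('a) *\<^sub>R h (t + c *\<^sub>R x) \<partial>lborel)"
    by (rule integral_distr[OF m]) (use assms in auto)
  finally show ?thesis by simp
qed

text \<open>The affine change of variables that maps the unit cube to the cell, and periodicity. Any
  representative \<open>w\<close> of the site may be used: the two ends of an edge across the boundary of the unit
  cube can then be compared through representatives that are close to each other.\<close>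

lemma cell_average_eq:
  fixes f :: "('d::finite) torus \<Rightarrow> real" and x :: "'d torus \<times> 'v::finite"
  assumes \<epsilon>: "\<epsilon> \<in> scales E" and x: "x \<in> X_eps \<epsilon>" and f: "f \<in> borel_measurable borel"
    and w: "fst x = to_torus w"
  shows "cell_average \<epsilon> f x = (\<integral>y. indicator unit_cube y * f (to_torus (w + \<epsilon> *\<^sub>R y)) \<partial>lborel)"
proof -
  let ?z = "z_of \<epsilon> x"
  have z: "?z \<in> Zd \<epsilon>" "fst x = to_torus (scaled_site \<epsilon> ?z)" using z_of_X_eps[OF \<epsilon> x] .
  obtain N where N: "0 < N" "\<epsilon> = 1 / real N" "0 < \<epsilon>" using scalesE[OF \<epsilon>] by blast
  define C where "C = {y :: real ^ 'd. \<forall>i. \<epsilon> * ?z $ i \<le> y $ i \<and> y $ i < \<epsilon> * ?z $ i + \<epsilon>}"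
  have fm: "(\<lambda>y. f (to_torus y)) \<in> borel_measurable borel"
    using measurable_compose[OF measurable_to_torus f] .
  have "cell_average \<epsilon> f x = (\<integral>y. indicator unit_cube y *
      ((1 / \<epsilon> ^ CARD('d)) * indicator (cell \<epsilon> ?z) (to_torus y) * f (to_torus y)) \<partial>lborel)"
    unfolding cell_average_def
    by (rule integral_torus_lebesgue) (use sets_cell[OF \<epsilon> z(1)] f in measurable)
  also have "\<dots> = \<epsilon> ^ DIM(real ^ 'd) * (\<integral>y. indicator unit_cube (scaled_site \<epsilon> ?z + \<epsilon> *\<^sub>R y) *
      ((1 / \<epsilon> ^ CARD('d)) * indicator (cell \<epsilon> ?z) (to_torus (scaled_site \<epsilon> ?z + \<epsilon> *\<^sub>R y)) *
        f (to_torus (scaled_site \<epsilon> ?z + \<epsilon> *\<^sub>R y))) \<partial>lborel)"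
  proof (rule integral_lborel_affine[OF _ N(3)])
    note [measurable] = measurable_to_torus fm sets_cell[OF \<epsilon> z(1)] sets_unit_cube
    show "(\<lambda>y. indicator unit_cube y * ((1 / \<epsilon> ^ CARD('d)) * indicator (cell \<epsilon> ?z) (to_torus y) * f (to_torus y)))
      \<in> borel_measurable borel" by measurable
  qed
  also have "\<dots> = (\<integral>y. \<epsilon> ^ DIM(real ^ 'd) * (indicator unit_cube (scaled_site \<epsilon> ?z + \<epsilon> *\<^sub>R y) *
      ((1 / \<epsilon> ^ CARD('d)) * indicator (cell \<epsilon> ?z) (to_torus (scaled_site \<epsilon> ?z + \<epsilon> *\<^sub>R y)) *
        f (to_torus (scaled_site \<epsilon> ?z + \<epsilon> *\<^sub>R y)))) \<partial>lborel)"
    by (rule integral_mult_right_zero[symmetric])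
  also have "\<dots> = (\<integral>y. indicator unit_cube y * f (to_torus (w + \<epsilon> *\<^sub>R y)) \<partial>lborel)"
  proof (rule Bochner_Integration.integral_cong[OF refl])
    fix y :: "real ^ 'd"
    let ?y = "scaled_site \<epsilon> ?z + \<epsilon> *\<^sub>R y"
    have yi: "?y $ i = \<epsilon> * ?z $ i + \<epsilon> * y $ i" for i by (simp add: scaled_site_def)
    have torus: "to_torus ?y = to_torus (w + \<epsilon> *\<^sub>R y)"
      using z(2) unfolding w by (simp add: to_torus_eq_iff Ints_minus[of "_ - _"] minus_diff_commute) (metis Ints_minus minus_diff_eq)
    have "?y \<in> unit_cube \<and> to_torus ?y \<in> cell \<epsilon> ?z \<longleftrightarrow> y \<in> unit_cube"
    proof -
      have bd: "0 \<le> \<epsilon> * ?z $ i" "\<epsilon> * ?z $ i + \<epsilon> \<le> 1" for i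
      proof -
        have "0 \<le> ?z $ i" "?z $ i < int N" using z(1) unfolding N(2) Zd_eq by auto
        then have "0 \<le> real_of_int (?z $ i)" "real_of_int (?z $ i) + 1 \<le> real N" by linarith+
        then have "0 \<le> \<epsilon> * ?z $ i" "\<epsilon> * (?z $ i + 1) \<le> \<epsilon> * real N"
          using N(3) by (auto intro!: mult_left_mono simp del: of_int_add)
        moreover have "\<epsilon> * real N = 1" using N by simp
        ultimately show "0 \<le> \<epsilon> * ?z $ i" "\<epsilon> * ?z $ i + \<epsilon> \<le> 1" by (simp_all add: distrib_left)
      qed
      have fr: "frac (?y $ i) = ?y $ i" if "?y \<in> unit_cube" for i
        using that unfolding frac_eq by (simp add: unit_cube_def)
      have "?y \<in> unit_cube" if "y \<in> unit_cube"
        unfolding unit_cube_def mem_Collect_eq yi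
      proof (intro allI)
        fix i
        have "0 \<le> \<epsilon> * y $ i" "\<epsilon> * y $ i < \<epsilon>" using that N(3) by (simp_all add: unit_cube_def)
        then show "0 \<le> \<epsilon> * ?z $ i + \<epsilon> * y $ i \<and> \<epsilon> * ?z $ i + \<epsilon> * y $ i < 1"
          using bd[of i] by linarith
      qed
      moreover have "to_torus ?y \<in> cell \<epsilon> ?z \<longleftrightarrow> y \<in> unit_cube" if "?y \<in> unit_cube"
        unfolding cell_eq[OF \<epsilon> z(1)] mem_Collect_eq frac_rep_to_torus fr[OF that]
        unfolding yi unit_cube_def mem_Collect_eq using N(3) by (simp add: zero_le_mult_iff)
      ultimately show ?thesis by blast
    qed
    then have "indicator unit_cube ?y * indicator (cell \<epsilon> ?z) (to_torus ?y) = (indicator unit_cube y :: real)"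
      by (auto simp: indicator_def)
    then show "\<epsilon> ^ DIM(real ^ 'd) * (indicator unit_cube ?y *
      ((1 / \<epsilon> ^ CARD('d)) * indicator (cell \<epsilon> ?z) (to_torus ?y) * f (to_torus ?y)))
      = indicator unit_cube y * f (to_torus (w + \<epsilon> *\<^sub>R y))"
      using N(3) torus by (simp add: mult_ac)
  qed
  finally show ?thesis .
qed

lemma cell_average_const:
  fixes x x' :: "('d::finite) torus \<times> 'v::finite"
  assumes "\<epsilon> \<in> scales E" "x \<in> X_eps \<epsilon>" "x' \<in> X_eps \<epsilon>"
  shows "cell_average \<epsilon> (\<lambda>_. c) x = cell_average \<epsilon> (\<lambda>_. c) x'"
proof -
  have "cell_average \<epsilon> (\<lambda>_. c) u = (\<integral>y. indicator unit_cube y * c \<partial>(lborel :: (real ^ 'd) measure))"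
    if u: "u \<in> X_eps \<epsilon>" for u :: "'d torus \<times> 'v"
    by (rule cell_average_eq[where f = "\<lambda>_. c", OF assms(1) u borel_measurable_const z_of_X_eps(2)[OF assms(1) u]])
  then show ?thesis using assms(2,3) by (simp only:)
qed

lemma measurable_to_torus_affine:
  assumes "f \<in> borel_measurable borel"
  shows "(\<lambda>y. f (to_torus (w + \<epsilon> *\<^sub>R y))) \<in> borel_measurable borel"
proof -
  have "(\<lambda>y. to_torus (w + \<epsilon> *\<^sub>R y)) \<in> measurable borel borel"
    by (rule measurable_compose[OF _ measurable_to_torus]) simp
  from measurable_compose[OF this assms] show ?thesis .
qed

lemma abs_cell_average_le:
  fixes x :: "('d::finite) torus \<times> 'v::finite"
  assumes "\<epsilon> \<in> scales E" "x \<in> X_eps \<epsilon>" "f \<in> borel_measurable borel" "\<And>p. \<bar>f p\<bar> \<le> B"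
  shows "\<bar>cell_average \<epsilon> f x\<bar> \<le> B"
  unfolding cell_average_eq[OF assms(1,2,3) z_of_X_eps(2)[OF assms(1,2)]]
  by (rule integral_unit_cube_le) (use measurable_to_torus_affine[OF assms(3)] assms(4) in auto)

lemma cell_average_lipschitz:
  fixes x x' :: "('d::finite) torus \<times> 'v::finite"
  assumes \<epsilon>: "\<epsilon> \<in> scales E" and x: "x \<in> X_eps \<epsilon>" "x' \<in> X_eps \<epsilon>"
    and f: "f \<in> borel_measurable borel" "\<And>p. \<bar>f p\<bar> \<le> B" "torus_lipschitz f L"
    and w: "fst x = to_torus w" "fst x' = to_torus w'"
  shows "\<bar>cell_average \<epsilon> f x - cell_average \<epsilon> f x'\<bar> \<le> L * norm (w - w')"
proof -
  note int = integrable_unit_cube[OF measurable_to_torus_affine[OF f(1)] f(2)]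
  have "cell_average \<epsilon> f x - cell_average \<epsilon> f x' =
      (\<integral>y. indicator unit_cube y * (f (to_torus (w + \<epsilon> *\<^sub>R y)) - f (to_torus (w' + \<epsilon> *\<^sub>R y))) \<partial>lborel)"
    unfolding cell_average_eq[OF \<epsilon> x(1) f(1) w(1)] cell_average_eq[OF \<epsilon> x(2) f(1) w(2)]
    by (subst Bochner_Integration.integral_diff[OF int int, symmetric]) (simp add: right_diff_distrib)
  also have "\<bar>\<dots>\<bar> \<le> L * norm (w - w')"
  proof (rule integral_unit_cube_le)
    show "(\<lambda>y. f (to_torus (w + \<epsilon> *\<^sub>R y)) - f (to_torus (w' + \<epsilon> *\<^sub>R y))) \<in> borel_measurable borel"
      by (intro borel_measurable_diff measurable_to_torus_affine f)
    show "\<bar>f (to_torus (w + \<epsilon> *\<^sub>R y)) - f (to_torus (w' + \<epsilon> *\<^sub>R y))\<bar> \<le> L * norm (w - w')" for y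
      using f(3)[unfolded torus_lipschitz_def, rule_format, of "w + \<epsilon> *\<^sub>R y" "w' + \<epsilon> *\<^sub>R y"] by simp
  qed
  finally show ?thesis .
qed

lemma sets_embed [simp]: "sets (embed \<epsilon> m) = sets borel"
  by (simp add: embed_def sets_torus_lebesgue)

lemma
  fixes m :: "('d::finite) torus \<times> 'v::finite \<Rightarrow> real"
  assumes \<epsilon>: "\<epsilon> \<in> scales E" and m: "\<And>x. x \<in> X_eps \<epsilon> \<Longrightarrow> 0 \<le> m x"
  shows integral_embed: "f \<in> borel_measurable borel \<Longrightarrow> (\<And>p. \<bar>f p\<bar> \<le> B) \<Longrightarrow>
      (\<integral>p. f p \<partial>embed \<epsilon> m) = (\<Sum>x\<in>X_eps \<epsilon>. m x * cell_average \<epsilon> f x)"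
    and finite_measure_embed: "finite_measure (embed \<epsilon> m)"
proof -
  interpret tl: finite_measure "torus_lebesgue :: 'd torus measure" by (rule finite_measure_torus_lebesgue)
  have cells: "cell \<epsilon> (z_of \<epsilon> x) \<in> sets borel" if "x \<in> X_eps \<epsilon>" for x :: "'d torus \<times> 'v"
    by (rule sets_cell[OF \<epsilon> z_of_X_eps(1)[OF \<epsilon> that]])
  have "0 < \<epsilon>" using \<epsilon> by (simp add: scales_def)
  define D where "D p = 1 / \<epsilon> ^ CARD('d) * (\<Sum>x\<in>X_eps \<epsilon>. m x * indicator (cell \<epsilon> (z_of \<epsilon> x)) p)" for p
  have D: "embed \<epsilon> m = density torus_lebesgue (\<lambda>p. ennreal (D p))" by (simp add: embed_def D_def)
  have D0: "0 \<le> D p" for p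
    unfolding D_def using m \<open>0 < \<epsilon>\<close> by (intro mult_nonneg_nonneg sum_nonneg) auto
  have "D \<in> borel_measurable borel"
    unfolding D_def[abs_def] using cells
    by (intro borel_measurable_times borel_measurable_sum borel_measurable_const borel_measurable_indicator) auto
  then have Dm: "D \<in> borel_measurable torus_lebesgue"
    by (subst measurable_cong_sets[OF sets_torus_lebesgue refl])
  define C where "C = 1 / \<epsilon> ^ CARD('d) * (\<Sum>x\<in>X_eps \<epsilon>. m x)"
  have DC: "D p \<le> C" for p
    unfolding D_def C_def using m \<open>0 < \<epsilon>\<close>
    by (intro mult_left_mono sum_mono) (auto simp: indicator_def)
  show "finite_measure (embed \<epsilon> m)"
  proof (rule finite_measureI)
    have "emeasure (embed \<epsilon> m) (space (embed \<epsilon> m)) = (\<integral>\<^sup>+p. ennreal (D p) \<partial>torus_lebesgue)"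
      unfolding D using Dm by (subst emeasure_density) (auto intro!: nn_integral_cong)
    also have "\<dots> \<le> (\<integral>\<^sup>+p. ennreal C \<partial>(torus_lebesgue :: 'd torus measure))"
      by (rule nn_integral_mono) (rule ennreal_leI, rule DC)
    also have "\<dots> = ennreal C * emeasure (torus_lebesgue :: 'd torus measure) (space torus_lebesgue)"
      by (rule nn_integral_const)
    also have "\<dots> < \<infinity>"
      using tl.emeasure_finite[of "space torus_lebesgue"]
      by (auto simp: ennreal_mult_eq_top_iff less_top[symmetric])
    finally show "emeasure (embed \<epsilon> m) (space (embed \<epsilon> m)) \<noteq> \<infinity>" by simp
  qed
  assume f: "f \<in> borel_measurable borel" "\<And>p. \<bar>f p\<bar> \<le> B"
  have fm: "f \<in> borel_measurable torus_lebesgue"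
    by (subst measurable_cong_sets[OF sets_torus_lebesgue refl]) (rule f(1))
  have int: "integrable torus_lebesgue (\<lambda>p. (1 / \<epsilon> ^ CARD('d)) * indicator (cell \<epsilon> (z_of \<epsilon> x)) p * f p)"
    if "x \<in> X_eps \<epsilon>" for x :: "'d torus \<times> 'v"
  proof (rule tl.integrable_const_bound)
    show "AE p in torus_lebesgue. norm ((1 / \<epsilon> ^ CARD('d)) * indicator (cell \<epsilon> (z_of \<epsilon> x)) p * f p) \<le> (1 / \<epsilon> ^ CARD('d)) * \<bar>B\<bar>"
    proof (intro always_eventually allI)
      fix p
      have "\<bar>f p\<bar> \<le> \<bar>B\<bar>" using f(2)[of p] by linarith
      then show "norm ((1 / \<epsilon> ^ CARD('d)) * indicator (cell \<epsilon> (z_of \<epsilon> x)) p * f p) \<le> (1 / \<epsilon> ^ CARD('d)) * \<bar>B\<bar>"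
        using \<open>0 < \<epsilon>\<close> by (auto simp: abs_mult indicator_def divide_right_mono)
    qed
    have "(\<lambda>p. (1 / \<epsilon> ^ CARD('d)) * indicator (cell \<epsilon> (z_of \<epsilon> x)) p * f p) \<in> borel_measurable borel"
      by (intro borel_measurable_times borel_measurable_const borel_measurable_indicator cells[OF that] f)
    then show "(\<lambda>p. (1 / \<epsilon> ^ CARD('d)) * indicator (cell \<epsilon> (z_of \<epsilon> x)) p * f p) \<in> borel_measurable torus_lebesgue"
      by (subst measurable_cong_sets[OF sets_torus_lebesgue refl])
  qed
  have "(\<integral>p. f p \<partial>embed \<epsilon> m) = (\<integral>p. D p *\<^sub>R f p \<partial>torus_lebesgue)"
    unfolding D by (rule integral_density) (use fm Dm D0 in auto)
  also have "\<dots> = (\<integral>p. (\<Sum>x\<in>X_eps \<epsilon>. m x * ((1 / \<epsilon> ^ CARD('d)) * indicator (cell \<epsilon> (z_of \<epsilon> x)) p * f p)) \<partial>torus_lebesgue)"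
    by (rule Bochner_Integration.integral_cong) (auto simp: D_def sum_distrib_left sum_distrib_right mult_ac)
  also have "\<dots> = (\<Sum>x\<in>X_eps \<epsilon>. (\<integral>p. m x * ((1 / \<epsilon> ^ CARD('d)) * indicator (cell \<epsilon> (z_of \<epsilon> x)) p * f p) \<partial>torus_lebesgue))"
    by (rule Bochner_Integration.integral_sum) (intro integrable_mult_right int)
  also have "\<dots> = (\<Sum>x\<in>X_eps \<epsilon>. m x * cell_average \<epsilon> f x)"
    unfolding cell_average_def by (intro sum.cong refl integral_mult_right_zero)
  finally show "(\<integral>p. f p \<partial>embed \<epsilon> m) = (\<Sum>x\<in>X_eps \<epsilon>. m x * cell_average \<epsilon> f x)" .
qed

section \<open>Weak compactness of probability measures on the torus\<close>

text \<open>At the first index where the membership of \<open>p\<close> and \<open>q\<close> differs the two series differ by \<open>(1 / 3)\<^sup>n\<close>,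
  while all later terms together contribute at most half of this.\<close>

lemma ternary_code_difference:
  fixes S :: "nat \<Rightarrow> 'a set"
  defines "g \<equiv> \<lambda>p. \<Sum>j. (1 / 3) ^ j * indicator (S j) p :: real"
  assumes "\<bar>g p - g q\<bar> < (1 / 3) ^ N / 2" "j \<le> N"
  shows "p \<in> S j \<longleftrightarrow> q \<in> S j"
proof (rule ccontr)
  assume differ: "\<not> ?thesis"
  define n where "n = (LEAST j. (p \<in> S j) \<noteq> (q \<in> S j))"
  have n: "(p \<in> S n) \<noteq> (q \<in> S n)" unfolding n_def by (rule LeastI[of _ j]) (use differ in blast)
  have "n \<le> j" unfolding n_def by (rule Least_le) (use differ in blast)
  then have nN: "n \<le> N" using \<open>j \<le> N\<close> by simp
  have less: "(p \<in> S i) = (q \<in> S i)" if "i < n" for i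
    using not_less_Least[of i "\<lambda>j. (p \<in> S j) \<noteq> (q \<in> S j)"] that by (simp add: n_def)
  define d where "d i = (1 / 3) ^ i * (indicator (S i) p - indicator (S i) q :: real)" for i
  have d_le: "\<bar>d i\<bar> \<le> (1 / 3) ^ i" for i
    by (auto simp: d_def abs_mult indicator_def)
  have sg: "summable (\<lambda>i. (1 / 3 :: real) ^ i)" by (rule summable_geometric) simp
  have s1: "summable (\<lambda>j. (1 / 3) ^ j * indicator (S j) x :: real)" for x
    by (rule summable_comparison_test'[OF sg, of 0]) (auto simp: indicator_def)
  have sd: "summable d" by (rule summable_comparison_test'[OF sg, of 0]) (use d_le in auto)
  have "g p - g q = suminf d"
    unfolding g_def d_def by (subst suminf_diff[OF s1 s1]) (simp add: algebra_simps)
  also have "\<dots> = (\<Sum>i. d (i + Suc n)) + (\<Sum>i<Suc n. d i)"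
    by (rule suminf_split_initial_segment[OF sd])
  also have "(\<Sum>i<Suc n. d i) = d n" using less by (simp add: d_def indicator_def)
  finally have eq: "g p - g q = (\<Sum>i. d (i + Suc n)) + d n" .
  have "\<bar>\<Sum>i. d (i + Suc n)\<bar> \<le> (\<Sum>i. (1 / 3) ^ Suc n * (1 / 3) ^ i)"
  proof (rule order_trans[OF summable_rabs])
    have *: "\<bar>d (i + Suc n)\<bar> \<le> (1 / 3) ^ Suc n * (1 / 3) ^ i" for i
      using d_le[of "i + Suc n"] by (simp add: power_add mult_ac)
    show s: "summable (\<lambda>i. \<bar>d (i + Suc n)\<bar>)"
      by (rule summable_comparison_test'[OF summable_mult[OF sg], of 0 _ "(1 / 3) ^ Suc n"]) (use * in auto)
    show "(\<Sum>i. \<bar>d (i + Suc n)\<bar>) \<le> (\<Sum>i. (1 / 3) ^ Suc n * (1 / 3) ^ i)"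
      by (rule suminf_le[OF * s summable_mult[OF sg]])
  qed
  also have "\<dots> = (1 / 3) ^ Suc n * (1 / (1 - 1 / 3))"
    by (subst suminf_mult[OF sg], subst suminf_geometric) auto
  also have "\<dots> = (1 / 3) ^ n / 2" by simp
  finally have "\<bar>\<Sum>i. d (i + Suc n)\<bar> \<le> (1 / 3) ^ n / 2" .
  moreover have "\<bar>d n\<bar> = (1 / 3) ^ n" using n by (auto simp: d_def abs_mult indicator_def)
  ultimately have "(1 / 3) ^ n / 2 \<le> \<bar>g p - g q\<bar>" unfolding eq by linarith
  moreover have "(1 / 3 :: real) ^ N \<le> (1 / 3) ^ n" by (rule power_decreasing[OF nN]) auto
  ultimately show False using assms(2) by simp
qed

text \<open>The code of a point records, as a ternary expansion with digits 0 and 1, which sets of a countable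
  base contain the point. Given \<open>f\<close> and \<open>e\<close>, finitely many base sets on which \<open>f\<close> oscillates by less than
  \<open>e\<close> cover the compact space; two points with close codes belong to a common one. So a continuous
  function is a uniformly continuous function of the code, although the code itself is only Borel.\<close>

lemma borel_code_exists:
  assumes compact: "compact (UNIV :: 'a::second_countable_topology set)"
  obtains g :: "'a::second_countable_topology \<Rightarrow> real" where "g \<in> borel_measurable borel" "\<And>p. 0 \<le> g p" "\<And>p. g p \<le> 2"
    "\<And>(f :: 'a::second_countable_topology \<Rightarrow> real) e. continuous_on UNIV f \<Longrightarrow> 0 < e \<Longrightarrow> \<exists>\<delta>>0. \<forall>p q. \<bar>g p - g q\<bar> < \<delta> \<longrightarrow> \<bar>f p - f q\<bar> < e"
proof -
  obtain B :: "'a set set" where B: "countable B" "topological_basis B" using ex_countable_basis by blast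
  have "B \<noteq> {}" using topological_basisE[OF B(2) open_UNIV UNIV_I] by blast
  define S where "S = from_nat_into B"
  have S: "S j \<in> B" for j unfolding S_def by (rule from_nat_into[OF \<open>B \<noteq> {}\<close>])
  have S_open: "open (S j)" for j using topological_basis_open[OF B(2) S] .
  define g where "g p = (\<Sum>j. (1 / 3) ^ j * indicator (S j) p :: real)" for p
  have sg: "summable (\<lambda>i. (1 / 3 :: real) ^ i)" by (rule summable_geometric) simp
  have s1: "summable (\<lambda>j. (1 / 3) ^ j * indicator (S j) x :: real)" for x
    by (rule summable_comparison_test'[OF sg, of 0]) (auto simp: indicator_def)
  show thesis
  proof
    show "g \<in> borel_measurable borel"
      unfolding g_def[abs_def] using S_open by (intro borel_measurable_suminf) auto
    show "0 \<le> g p" for p unfolding g_def by (intro suminf_nonneg s1) auto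
    show "g p \<le> 2" for p
    proof -
      have "g p \<le> (\<Sum>i. (1 / 3) ^ i)"
        unfolding g_def by (intro suminf_le s1 sg) (auto simp: indicator_def)
      also have "\<dots> \<le> 2" by (subst suminf_geometric) auto
      finally show ?thesis .
    qed
    fix f :: "'a \<Rightarrow> real" and e :: real
    assume f: "continuous_on UNIV f" "0 < e"
    define J where "J = {j. \<forall>p\<in>S j. \<forall>q\<in>S j. \<bar>f p - f q\<bar> < e}"
    have "UNIV \<subseteq> (\<Union>j\<in>J. S j)"
    proof
      fix p :: 'a
      have "open (f -` ball (f p) (e / 2))" using f by (intro open_vimage) auto
      moreover have "p \<in> f -` ball (f p) (e / 2)" using f by simp
      ultimately obtain b where b: "b \<in> B" "p \<in> b" "b \<subseteq> f -` ball (f p) (e / 2)"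
        using topological_basisE[OF B(2)] by blast
      then obtain j where j: "S j = b" unfolding S_def using from_nat_into_surj[OF B(1)] by blast
      have "\<bar>f x - f y\<bar> < e" if "x \<in> b" "y \<in> b" for x y
      proof -
        have "\<bar>f p - f x\<bar> < e / 2" "\<bar>f p - f y\<bar> < e / 2" using b(3) that by (auto simp: dist_real_def)
        then show ?thesis by linarith
      qed
      then show "p \<in> (\<Union>j\<in>J. S j)" using b(2) j by (intro UN_I[of j]) (auto simp: J_def)
    qed
    from compactE_image[OF compact _ this] obtain J' where J': "J' \<subseteq> J" "finite J'" "UNIV \<subseteq> (\<Union>j\<in>J'. S j)"
      using S_open by blast
    have "\<bar>f p - f q\<bar> < e" if "\<bar>g p - g q\<bar> < (1 / 3) ^ Max J' / 2" for p q
    proof -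
      obtain j where j: "j \<in> J'" "p \<in> S j" using J'(3) by blast
      have "q \<in> S j"
        using ternary_code_difference[of S p q "Max J'" j] that j J'(2) by (auto simp: g_def)
      then show ?thesis using j J'(1) by (auto simp: J_def)
    qed
    then show "\<exists>\<delta>>0. \<forall>p q. \<bar>g p - g q\<bar> < \<delta> \<longrightarrow> \<bar>f p - f q\<bar> < e"
      by (intro exI[of _ "(1 / 3) ^ Max J' / 2"]) auto
  qed
qed

text \<open>The images of the measures under the code are probability measures on a bounded interval, hence have a
  weakly convergent subsequence with a limit \<open>M\<close>. To return to the torus, each point \<open>y\<close> of the closure \<open>K\<close>
  of the set of codes is decoded to a point \<open>\<gamma> y\<close> that is approached by points with codes near \<open>y\<close>.
  For continuous \<open>f\<close> the function \<open>f \<circ> \<gamma>\<close> is continuous on \<open>K\<close>, extends to the line, and recovers \<open>f\<close> from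
  the code; so the image of \<open>M\<close> under \<open>\<gamma>\<close> is the limit.\<close>

lemma torus_prob_weakly_compact:
  fixes \<nu> :: "nat \<Rightarrow> ('d::finite) torus measure"
  assumes \<nu>: "\<And>n. sets (\<nu> n) = sets borel" "\<And>n. prob_space (\<nu> n)"
  shows "\<exists>r \<mu>. strict_mono (r :: nat \<Rightarrow> nat) \<and> sets \<mu> = sets borel \<and> prob_space \<mu> \<and>
    (\<forall>f :: 'd torus \<Rightarrow> real. continuous_on UNIV f \<longrightarrow> (\<lambda>n. \<integral>p. f p \<partial>\<nu> (r n)) \<longlonglongrightarrow> (\<integral>p. f p \<partial>\<mu>))"
proof -
  obtain g :: "'d torus \<Rightarrow> real" where g: "g \<in> borel_measurable borel" "\<And>p. 0 \<le> g p" "\<And>p. g p \<le> 2"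
    and unif: "\<And>(f :: 'd torus \<Rightarrow> real) e. continuous_on UNIV f \<Longrightarrow> 0 < e \<Longrightarrow>
      \<exists>\<delta>>0. \<forall>p q. \<bar>g p - g q\<bar> < \<delta> \<longrightarrow> \<bar>f p - f q\<bar> < e"
    by (rule borel_code_exists[OF compact_torus]) (rule that)
  have g\<nu>: "g \<in> measurable (\<nu> n) borel" for n
    unfolding measurable_cong_sets[OF \<nu>(1) refl] by (rule g(1))
  define P where "P n = distr (\<nu> n) borel g" for n
  have P: "real_distribution (P n)" for n
  proof -
    interpret prob_space "\<nu> n" by (rule \<nu>(2))
    show ?thesis unfolding P_def by (rule real_distribution_distr[OF g\<nu>])
  qed
  have "tight P"
    unfolding tight_def
  proof (intro conjI allI impI P)
    fix e :: real assume "0 < e"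
    have "measure (P n) {-1<..3} = 1" for n
    proof -
      interpret prob_space "\<nu> n" by (rule \<nu>(2))
      have "-1 < g p \<and> g p \<le> 3" for p using g(2)[of p] g(3)[of p] by linarith
      then have "g -` {-1<..3} \<inter> space (\<nu> n) = space (\<nu> n)" by auto
      then show ?thesis unfolding P_def by (subst measure_distr[OF g\<nu>]) (auto simp: prob_space)
    qed
    then show "\<exists>a b. a < b \<and> (\<forall>n. 1 - e < measure (P n) {a<..b})"
      using \<open>0 < e\<close> by (intro exI[of _ "-1"] exI[of _ 3]) auto
  qed
  then obtain r M where r: "strict_mono r" and M: "real_distribution M" and conv: "weak_conv_m (P \<circ> id \<circ> r) M"
    using tight_imp_convergent_subsubsequence[of P id] strict_mono_id by blast
  interpret M: real_distribution M by (rule M)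
  have lim: "(\<lambda>n. \<integral>y. F y \<partial>P (r n)) \<longlonglongrightarrow> (\<integral>y. F y \<partial>M)"
    if "continuous_on UNIV F" "\<And>y. \<bar>F y\<bar> \<le> C" for F :: "real \<Rightarrow> real" and C
    using weak_conv_imp_integral_bdd_continuous_conv[of "P \<circ> id \<circ> r" M F C] conv P M that
    by (auto simp: comp_def continuous_on_eq_continuous_at)
  define K where "K = closure (range g)"
  have K: "closed K" "K \<noteq> {}" "g p \<in> K" for p
    using closure_subset[of "range g"] by (auto simp: K_def)
  have "\<exists>p. \<forall>e>0. p \<in> closure (g -` ball y e)" if "y \<in> K" for y
  proof -
    let ?A = "(\<lambda>e. closure (g -` ball y e)) ` {0<..}"
    have "UNIV \<inter> \<Inter>?A \<noteq> {}"
    proof (rule compact_imp_fip[OF compact_torus])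
      fix B assume B: "finite B" "B \<subseteq> ?A"
      then obtain E where E: "E \<subseteq> {0<..}" "finite E" "B = (\<lambda>e. closure (g -` ball y e)) ` E"
        using finite_subset_image by metis
      define e where "e = Min (insert 1 E)"
      have e: "0 < e" "\<And>e'. e' \<in> E \<Longrightarrow> e \<le> e'" using E by (auto simp: e_def)
      have "y \<in> closure (range g)" using that by (simp add: K_def)
      from closure_approachable[THEN iffD1, OF this] e(1) obtain p where p: "dist (g p) y < e" by blast
      have "p \<in> closure (g -` ball y e')" if "e' \<in> E" for e'
        using p e(2)[OF that] by (intro closure_subset[THEN subsetD]) (simp add: dist_commute)
      then show "UNIV \<inter> \<Inter>B \<noteq> {}" using E(3) by blast
    qed auto
    then show ?thesis by auto
  qed
  then obtain \<gamma> where \<gamma>: "\<And>y e. y \<in> K \<Longrightarrow> 0 < e \<Longrightarrow> \<gamma> y \<in> closure (g -` ball y e)" by metis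
  have closure_le: "\<bar>f p - c\<bar> \<le> e" if "continuous_on UNIV f" "p \<in> closure A" "\<And>s. s \<in> A \<Longrightarrow> \<bar>f s - c\<bar> \<le> e"
    for f :: "'d torus \<Rightarrow> real" and p A c e
  proof -
    have "closed {p. \<bar>f p - c\<bar> \<le> e}"
      by (intro closed_Collect_le continuous_intros that(1))
    then have "closure A \<subseteq> {p. \<bar>f p - c\<bar> \<le> e}" using that(3) by (intro closure_minimal) auto
    then show ?thesis using that(2) by auto
  qed
  have \<gamma>g: "f (\<gamma> (g p)) = f p" if f: "continuous_on UNIV f" for f :: "'d torus \<Rightarrow> real" and p
  proof -
    have "\<bar>f (\<gamma> (g p)) - f p\<bar> \<le> e" if e: "0 < e" for e
    proof -
      obtain \<delta> where \<delta>: "0 < \<delta>" "\<And>p q. \<bar>g p - g q\<bar> < \<delta> \<Longrightarrow> \<bar>f p - f q\<bar> < e"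
        using unif[OF f e] by blast
      show ?thesis
      proof (rule closure_le[OF f \<gamma>[OF K(3) \<delta>(1)]])
        fix q assume "q \<in> g -` ball (g p) \<delta>"
        then have "\<bar>g q - g p\<bar> < \<delta>" by (simp add: dist_real_def abs_minus_commute)
        from \<delta>(2)[OF this] show "\<bar>f q - f p\<bar> \<le> e" by simp
      qed
    qed
    from this[of "\<bar>f (\<gamma> (g p)) - f p\<bar> / 2"] show ?thesis
      by (cases "f (\<gamma> (g p)) = f p") simp_all
  qed
  have F_cont: "continuous_on K (\<lambda>y. f (\<gamma> y))" if f: "continuous_on UNIV f" for f :: "'d torus \<Rightarrow> real"
  proof (rule uniformly_continuous_imp_continuous, unfold uniformly_continuous_on_def, intro allI impI)
    fix e :: real assume "0 < e"
    then obtain \<delta> where \<delta>: "0 < \<delta>" "\<And>p q. \<bar>g p - g q\<bar> < \<delta> \<Longrightarrow> \<bar>f p - f q\<bar> < e / 2"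
      using unif[OF f, of "e / 2"] by auto
    have "dist (f (\<gamma> y')) (f (\<gamma> y)) < e" if y: "y \<in> K" "y' \<in> K" "dist y' y < \<delta> / 3" for y y'
    proof -
      have "\<bar>f (\<gamma> y') - f (\<gamma> y)\<bar> \<le> e / 2"
      proof (rule closure_le[OF f \<gamma>[OF y(2)]])
        show "0 < \<delta> / 3" using \<delta> by simp
        fix p' assume p': "p' \<in> g -` ball y' (\<delta> / 3)"
        have "\<bar>f (\<gamma> y) - f p'\<bar> \<le> e / 2"
        proof (rule closure_le[OF f \<gamma>[OF y(1)]])
          show "0 < \<delta> / 3" using \<delta> by simp
          fix p assume p: "p \<in> g -` ball y (\<delta> / 3)"
          have "\<bar>y - g p\<bar> < \<delta> / 3" "\<bar>y' - g p'\<bar> < \<delta> / 3" "\<bar>y' - y\<bar> < \<delta> / 3"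
            using p p' y(3) by (simp_all add: dist_real_def)
          then have "\<bar>g p - g p'\<bar> < \<delta>" by linarith
          from \<delta>(2)[OF this] show "\<bar>f p - f p'\<bar> \<le> e / 2" by simp
        qed
        then show "\<bar>f p' - f (\<gamma> y)\<bar> \<le> e / 2" by (simp add: abs_minus_commute)
      qed
      then show ?thesis using \<open>0 < e\<close> by (simp add: dist_real_def)
    qed
    then show "\<exists>d>0. \<forall>x\<in>K. \<forall>x'\<in>K. dist x' x < d \<longrightarrow> dist (f (\<gamma> x')) (f (\<gamma> x)) < e"
      using \<delta>(1) by (intro exI[of _ "\<delta> / 3"]) auto
  qed
  have ext: "\<exists>F C. continuous_on UNIV F \<and> (\<forall>y. \<bar>F y\<bar> \<le> C) \<and> (\<forall>y\<in>K. F y = f (\<gamma> y))"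
    if f: "continuous_on UNIV f" for f :: "'d torus \<Rightarrow> real"
  proof -
    obtain C where C: "\<And>p. \<bar>f p\<bar> \<le> C" using bounded_continuous_torus[OF f] by blast
    have "0 \<le> C" using C[of undefined] by linarith
    obtain F where "continuous_on UNIV F" "\<And>y. y \<in> K \<Longrightarrow> F y = f (\<gamma> y)" "\<And>y. y \<in> UNIV \<Longrightarrow> norm (F y) \<le> C"
      by (rule Tietze[OF F_cont[OF f], of UNIV C]) (use K C \<open>0 \<le> C\<close> in auto)
    then show ?thesis by auto
  qed
  \<comment> \<open>The distance to \<open>K\<close>, cut off at 1, is a bounded continuous function that vanishes on all codes.\<close>
  have AE_K: "AE y in M. y \<in> K"
  proof -
    define \<phi> where "\<phi> y = min 1 (infdist y K)" for y
    have \<phi>: "continuous_on UNIV \<phi>" unfolding \<phi>_def by (intro continuous_intros)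
    have \<phi>0: "0 \<le> \<phi> y" "\<phi> y \<le> 1" for y by (auto simp: \<phi>_def infdist_nonneg)
    have "(\<integral>y. \<phi> y \<partial>P n) = 0" for n
    proof -
      have "(\<integral>y. \<phi> y \<partial>P n) = (\<integral>p. \<phi> (g p) \<partial>\<nu> n)"
        unfolding P_def by (intro integral_distr g\<nu> borel_measurable_continuous_onI \<phi>)
      also have "\<phi> (g p) = 0" for p using K(3)[of p] by (simp add: \<phi>_def)
      then have "(\<integral>p. \<phi> (g p) \<partial>\<nu> n) = 0" by simp
      finally show ?thesis .
    qed
    with lim[OF \<phi>, of 1] have "(\<integral>y. \<phi> y \<partial>M) = 0"
      using \<phi>0 by (auto simp: LIMSEQ_const_iff)
    moreover have "integrable M \<phi>"
      by (rule M.integrable_const_bound[of _ 1])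
        (use \<phi>0 borel_measurable_continuous_onI[OF \<phi>] in auto)
    ultimately have "AE y in M. \<phi> y = 0"
      using integral_nonneg_eq_0_iff_AE[of M \<phi>] \<phi>0 by auto
    then show ?thesis
    proof eventually_elim
      case (elim y)
      then have "infdist y K = 0" by (simp add: \<phi>_def min_def split: if_splits)
      then show ?case using in_closed_iff_infdist_zero[OF K(1,2)] by simp
    qed
  qed
  define \<gamma>' where "\<gamma>' y = (if y \<in> K then \<gamma> y else undefined)" for y
  have \<gamma>'m: "\<gamma>' \<in> measurable M borel"
  proof (rule borel_measurableI)
    fix U :: "'d torus set" assume "open U"
    obtain f :: "'d torus \<Rightarrow> real" where f: "continuous_on UNIV f" "U = {p. 0 < f p}"
      using torus_open_superlevel[OF \<open>open U\<close>] by blast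
    obtain F where F: "continuous_on UNIV F" "\<And>y. y \<in> K \<Longrightarrow> F y = f (\<gamma> y)" using ext[OF f(1)] by blast
    have "open {y. 0 < F y}" by (intro open_Collect_less continuous_intros F)
    moreover have "\<gamma>' -` U \<inter> space M = (K \<inter> {y. 0 < F y}) \<union> (if undefined \<in> U then - K else {})"
      using F(2) by (auto simp: f(2) \<gamma>'_def split: if_splits)
    moreover have "K \<in> sets borel" using K(1) by simp
    ultimately show "\<gamma>' -` U \<inter> space M \<in> sets M" by auto
  qed
  define \<mu> where "\<mu> = distr M borel \<gamma>'"
  have "(\<lambda>n. \<integral>p. f p \<partial>\<nu> (r n)) \<longlonglongrightarrow> (\<integral>p. f p \<partial>\<mu>)" if f: "continuous_on UNIV f" for f :: "'d torus \<Rightarrow> real"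
  proof -
    obtain F C where F: "continuous_on UNIV F" "\<And>y. \<bar>F y\<bar> \<le> C" "\<And>y. y \<in> K \<Longrightarrow> F y = f (\<gamma> y)"
      using ext[OF f] by blast
    have Fm: "F \<in> borel_measurable borel" by (rule borel_measurable_continuous_onI[OF F(1)])
    have fm: "f \<in> borel_measurable borel" by (rule borel_measurable_continuous_onI[OF f])
    have "(\<integral>y. F y \<partial>P n) = (\<integral>p. f p \<partial>\<nu> n)" for n
    proof -
      have "(\<integral>y. F y \<partial>P n) = (\<integral>p. F (g p) \<partial>\<nu> n)"
        unfolding P_def by (intro integral_distr g\<nu> Fm)
      then show ?thesis using F(3)[OF K(3)] \<gamma>g[OF f] by simp
    qed
    moreover have "(\<integral>p. f p \<partial>\<mu>) = (\<integral>y. F y \<partial>M)"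
    proof -
      have "(\<integral>p. f p \<partial>\<mu>) = (\<integral>y. f (\<gamma>' y) \<partial>M)"
        unfolding \<mu>_def by (intro integral_distr \<gamma>'m fm)
      also have "\<dots> = (\<integral>y. F y \<partial>M)"
      proof (rule integral_cong_AE)
        show "(\<lambda>y. f (\<gamma>' y)) \<in> borel_measurable M" using measurable_compose[OF \<gamma>'m fm] .
        show "F \<in> borel_measurable M" using Fm by simp
        show "AE y in M. f (\<gamma>' y) = F y"
          using AE_K by eventually_elim (simp add: \<gamma>'_def F(3))
      qed
      finally show ?thesis .
    qed
    ultimately show ?thesis using lim[OF F(1,2)] by simp
  qed
  moreover have "prob_space \<mu>" unfolding \<mu>_def by (rule M.prob_space_distr[OF \<gamma>'m])
  moreover have "sets \<mu> = sets borel" by (simp add: \<mu>_def)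
  ultimately show ?thesis using r by blast
qed

text \<open>A measure is its mass times a probability measure, which is arbitrary if the mass is zero; masses
  and probability measures converge along a common subsequence.\<close>

lemma torus_finite_measures_weakly_compact:
  fixes \<nu> :: "nat \<Rightarrow> ('d::finite) torus measure"
  assumes \<nu>: "\<And>n. sets (\<nu> n) = sets borel" "\<And>n. finite_measure (\<nu> n)" "\<And>n. measure (\<nu> n) UNIV \<le> C"
  shows "\<exists>r \<mu>. strict_mono (r :: nat \<Rightarrow> nat) \<and> sets \<mu> = sets borel \<and> finite_measure \<mu> \<and>
    (\<forall>f :: 'd torus \<Rightarrow> real. continuous_on UNIV f \<longrightarrow> (\<lambda>n. \<integral>p. f p \<partial>\<nu> (r n)) \<longlonglongrightarrow> (\<integral>p. f p \<partial>\<mu>))"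
proof -
  define c where "c n = measure (\<nu> n) UNIV" for n
  have c: "0 \<le> c n" "c n \<le> C" for n using \<nu>(3) by (auto simp: c_def)
  define \<nu>' where "\<nu>' n = (if 0 < c n then density (\<nu> n) (\<lambda>_. ennreal (1 / c n)) else return borel undefined)" for n
  have space: "space (\<nu> n) = UNIV" for n using sets_eq_imp_space_eq[OF \<nu>(1)] by simp
  have sets': "sets (\<nu>' n) = sets borel" for n using \<nu>(1) by (simp add: \<nu>'_def)
  have prob': "prob_space (\<nu>' n)" for n
  proof (cases "0 < c n")
    case True
    interpret finite_measure "\<nu> n" by (rule \<nu>(2))
    have "emeasure (\<nu>' n) (space (\<nu>' n)) = ennreal (1 / c n) * emeasure (\<nu> n) (space (\<nu> n))"
      using True by (simp add: \<nu>'_def emeasure_density nn_integral_cmult)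
    also have "\<dots> = ennreal (1 / c n) * ennreal (c n)"
      by (simp add: space c_def emeasure_eq_measure)
    also have "\<dots> = 1" using True by (simp add: ennreal_mult[symmetric])
    finally show ?thesis by (rule prob_spaceI)
  qed (auto simp: \<nu>'_def intro: prob_space_return)
  have int': "(\<integral>p. f p \<partial>\<nu> n) = c n * (\<integral>p. f p \<partial>\<nu>' n)" if f: "continuous_on UNIV f" for f :: "'d torus \<Rightarrow> real" and n
  proof (cases "0 < c n")
    case True
    have fm: "f \<in> borel_measurable (\<nu> n)"
      unfolding measurable_cong_sets[OF \<nu>(1) refl] by (rule borel_measurable_continuous_onI[OF f])
    have "(\<integral>p. f p \<partial>\<nu>' n) = (\<integral>p. (1 / c n) *\<^sub>R f p \<partial>\<nu> n)"
      unfolding \<nu>'_def using True fm by (simp add: integral_density)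
    then show ?thesis using True by simp
  next
    case False
    then have "c n = 0" using c(1)[of n] by simp
    interpret finite_measure "\<nu> n" by (rule \<nu>(2))
    have "emeasure (\<nu> n) (space (\<nu> n)) = 0" using \<open>c n = 0\<close> by (simp add: space c_def emeasure_eq_measure)
    then have "AE p in \<nu> n. f p = 0" by (intro AE_I[of _ _ "space (\<nu> n)"]) auto
    then have "(\<integral>p. f p \<partial>\<nu> n) = 0" by (rule integral_eq_zero_AE)
    then show ?thesis using \<open>c n = 0\<close> by simp
  qed
  obtain r1 l where r1: "strict_mono r1" "(c \<circ> r1) \<longlonglongrightarrow> l"
    using seq_compactE[OF compact_imp_seq_compact[OF compact_Icc[of 0 C]], of c] c
    by (metis atLeastAtMost_iff)
  then have l: "0 \<le> l" using c(1) by (intro LIMSEQ_le_const[OF r1(2)]) auto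
  obtain r2 \<mu>' where r2: "strict_mono r2" "sets \<mu>' = sets borel" "prob_space \<mu>'"
    and lim: "\<And>f :: 'd torus \<Rightarrow> real. continuous_on UNIV f \<Longrightarrow>
      (\<lambda>n. \<integral>p. f p \<partial>\<nu>' (r1 (r2 n))) \<longlonglongrightarrow> (\<integral>p. f p \<partial>\<mu>')"
    using torus_prob_weakly_compact[of "\<nu>' \<circ> r1"] sets' prob' by (auto simp: comp_def)
  interpret \<mu>': prob_space \<mu>' by (rule r2(3))
  define \<mu> where "\<mu> = density \<mu>' (\<lambda>_. ennreal l)"
  have "finite_measure \<mu>"
    by (rule finite_measureI) (simp add: \<mu>_def emeasure_density nn_integral_cmult \<mu>'.emeasure_space_1)
  moreover have "(\<lambda>n. \<integral>p. f p \<partial>\<nu> ((r1 \<circ> r2) n)) \<longlonglongrightarrow> (\<integral>p. f p \<partial>\<mu>)" if f: "continuous_on UNIV f" for f :: "'d torus \<Rightarrow> real"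
  proof -
    have fm: "f \<in> borel_measurable \<mu>'"
      unfolding measurable_cong_sets[OF r2(2) refl] by (rule borel_measurable_continuous_onI[OF f])
    have "(\<integral>p. f p \<partial>\<mu>) = l * (\<integral>p. f p \<partial>\<mu>')"
      unfolding \<mu>_def using fm l by (simp add: integral_density)
    moreover have "(\<lambda>n. c (r1 (r2 n)) * (\<integral>p. f p \<partial>\<nu>' (r1 (r2 n)))) \<longlonglongrightarrow> l * (\<integral>p. f p \<partial>\<mu>')"
      using LIMSEQ_subseq_LIMSEQ[OF r1(2) r2(1)] by (intro tendsto_mult lim f) (simp add: comp_def)
    ultimately show ?thesis by (simp add: int'[OF f])
  qed
  moreover have "strict_mono (r1 \<circ> r2)" using r1 r2 strict_mono_o by blast
  moreover have "sets \<mu> = sets borel" using r2(2) by (simp add: \<mu>_def)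
  ultimately show ?thesis by blast
qed

section \<open>Fluxes on the discrete torus\<close>

lemma T_eps_shift: "T_eps \<epsilon> z (shift k x) = T_eps \<epsilon> (z + k) x"
  by (simp add: T_eps_eq shift_def add.assoc)

lemma E_eps_T_eps:
  assumes "periodic_graph E" "(x, y) \<in> E"
  shows "(T_eps \<epsilon> z x, T_eps \<epsilon> z y) \<in> E_eps E \<epsilon>"
proof -
  have "(shift z x, shift z y) \<in> E" using assms unfolding periodic_graph_def by blast
  then have "(T_eps \<epsilon> 0 (shift z x), T_eps \<epsilon> 0 (shift z y)) \<in> E_eps E \<epsilon>"
    unfolding E_eps_def by (intro image_eqI[of _ _ "(shift z x, shift z y)"]) auto
  then show ?thesis by (simp add: T_eps_shift)
qed

text \<open>Translating the first end of an edge to the cell at the origin shows that the rescaled graph consists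
  of translates, by \<open>Zd \<epsilon>\<close>, of the finitely many edges in \<open>edges_Q E\<close>.\<close>

lemma E_eps_cover:
  assumes E: "periodic_graph E" and \<epsilon>: "\<epsilon> \<in> scales E" and xy: "(x, y) \<in> E_eps E \<epsilon>"
  obtains z e where "z \<in> Zd \<epsilon>" "e \<in> edges_Q E" "x = T_eps \<epsilon> z (fst e)" "y = T_eps \<epsilon> z (snd e)"
proof -
  obtain p q where pq: "(p, q) \<in> E" "x = T_eps \<epsilon> 0 p" "y = T_eps \<epsilon> 0 q"
    using xy by (auto simp: E_eps_def)
  obtain z where z: "z \<in> Zd \<epsilon>" "\<And>u. to_torus (scaled_site \<epsilon> (z + u)) = to_torus (scaled_site \<epsilon> (fst p + u))"
    using Zd_representative[OF \<epsilon>, of "fst p"] by blast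
  have T: "T_eps \<epsilon> z (shift (- fst p) u) = T_eps \<epsilon> 0 u" for u :: "('a, 'b) site"
    using z(2)[of "- fst p + fst u"] by (simp add: T_eps_eq shift_def)
  have "(shift (- fst p) p, shift (- fst p) q) \<in> edges_Q E"
  proof -
    have "(shift (- fst p) p, shift (- fst p) q) \<in> E"
      using E pq(1) unfolding periodic_graph_def by blast
    moreover have "fst (shift (- fst p) p) = 0" by (simp add: shift_def)
    ultimately show ?thesis unfolding edges_Q_def by blast
  qed
  then show thesis using that[OF z(1)] pq by (metis T fst_conv snd_conv)
qed

lemma E_eps_subset: "E_eps E \<epsilon> \<subseteq> X_eps \<epsilon> \<times> X_eps \<epsilon>"
  by (auto simp: E_eps_def T_eps_in_X_eps)

lemma sym_E_eps: "periodic_graph E \<Longrightarrow> (x, y) \<in> E_eps E \<epsilon> \<Longrightarrow> (y, x) \<in> E_eps E \<epsilon>"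
  unfolding E_eps_def periodic_graph_def sym_def by force

lemma finite_edges_Q:
  fixes E :: "(('d::finite, 'v::finite) site \<times> ('d, 'v) site) set"
  assumes "periodic_graph E"
  shows "finite (edges_Q E)"
proof -
  have "edges_Q E \<subseteq> (\<Union>v\<in>UNIV. Pair (0, v) ` {y. ((0, v), y) \<in> E})"
    by (auto simp: edges_Q_def image_iff)
  moreover have "finite (\<Union>v\<in>UNIV. Pair (0, v) ` {y. ((0, v), y) \<in> E})"
    using assms by (auto simp: periodic_graph_def)
  ultimately show ?thesis by (rule finite_subset)
qed

text \<open>Up to translation and scaling by \<open>\<epsilon>\<close> there are only finitely many edges.\<close>

lemma edge_displacement:
  fixes E :: "(('d::finite, 'v::finite) site \<times> ('d, 'v) site) set"
  assumes E: "periodic_graph E"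
  obtains D where "0 \<le> D" "\<And>\<epsilon> x y. \<epsilon> \<in> scales E \<Longrightarrow> (x, y) \<in> E_eps E \<epsilon> \<Longrightarrow>
    \<exists>w w'. fst x = to_torus w \<and> fst y = to_torus w' \<and> norm (w - w') \<le> \<epsilon> * D"
proof -
  define l where "l e = norm (scaled_site 1 (fst (fst e) - fst (snd e)))" for e :: "('d, 'v) site \<times> ('d, 'v) site"
  define D where "D = Max (insert 0 (l ` edges_Q E))"
  have D: "l e \<le> D" if "e \<in> edges_Q E" for e
    unfolding D_def using that finite_edges_Q[OF E] by (intro Max_ge) auto
  have D0: "0 \<le> D" unfolding D_def using finite_edges_Q[OF E] by (intro Max_ge) auto
  show thesis
  proof (rule that[OF D0])
    fix \<epsilon> x y assume \<epsilon>: "\<epsilon> \<in> scales E" and xy: "(x, y) \<in> E_eps E \<epsilon>"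
    obtain z e where ze: "e \<in> edges_Q E" "x = T_eps \<epsilon> z (fst e)" "y = T_eps \<epsilon> z (snd e)"
      using E_eps_cover[OF E \<epsilon> xy] by blast
    have "0 < \<epsilon>" using \<epsilon> by (simp add: scales_def)
    have "scaled_site \<epsilon> (z + fst (fst e)) - scaled_site \<epsilon> (z + fst (snd e))
        = \<epsilon> *\<^sub>R scaled_site 1 (fst (fst e) - fst (snd e))"
      by (simp add: vec_eq_iff scaled_site_def algebra_simps)
    then have "norm (scaled_site \<epsilon> (z + fst (fst e)) - scaled_site \<epsilon> (z + fst (snd e))) = \<epsilon> * l e"
      using \<open>0 < \<epsilon>\<close> by (simp add: l_def)
    also have "\<dots> \<le> \<epsilon> * D" using D[OF ze(1)] \<open>0 < \<epsilon>\<close> by (simp add: mult_left_mono)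
    finally show "\<exists>w w'. fst x = to_torus w \<and> fst y = to_torus w' \<and> norm (w - w') \<le> \<epsilon> * D"
      using ze(2,3) by (auto simp: T_eps_eq)
  qed
qed

lemma sum_E_eps_le:
  fixes E :: "(('d::finite, 'v::finite) site \<times> ('d, 'v) site) set" and J :: "_ \<Rightarrow> real"
  assumes E: "periodic_graph E" and \<epsilon>: "\<epsilon> \<in> scales E"
  shows "(\<Sum>e\<in>E_eps E \<epsilon>. \<bar>J e\<bar>) \<le> (\<Sum>z\<in>Zd \<epsilon>. \<Sum>e\<in>edges_Q E. \<bar>J (T_eps \<epsilon> z (fst e), T_eps \<epsilon> z (snd e))\<bar>)"
proof -
  let ?h = "\<lambda>(z, e). (T_eps \<epsilon> z (fst e), T_eps \<epsilon> z (snd e))"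
  let ?D = "Zd \<epsilon> \<times> edges_Q E"
  have fin: "finite ?D" by (intro finite_cartesian_product finite_Zd[OF \<epsilon>] finite_edges_Q[OF E])
  have "E_eps E \<epsilon> \<subseteq> ?h ` ?D"
  proof
    fix e assume "e \<in> E_eps E \<epsilon>"
    then obtain x y where xy: "e = (x, y)" "(x, y) \<in> E_eps E \<epsilon>" by (cases e) auto
    obtain z e' where "z \<in> Zd \<epsilon>" "e' \<in> edges_Q E" "x = T_eps \<epsilon> z (fst e')" "y = T_eps \<epsilon> z (snd e')"
      using E_eps_cover[OF E \<epsilon> xy(2)] by blast
    then show "e \<in> ?h ` ?D" using xy(1) by (intro image_eqI[of _ _ "(z, e')"]) auto
  qed
  then have "(\<Sum>e\<in>E_eps E \<epsilon>. \<bar>J e\<bar>) \<le> (\<Sum>e\<in>?h ` ?D. \<bar>J e\<bar>)"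
    by (intro sum_mono2 finite_imageI fin) auto
  also have "\<dots> \<le> (\<Sum>p\<in>?D. \<bar>J (?h p)\<bar>)"
    using sum_image_le[OF fin, of "\<lambda>e. \<bar>J e\<bar>" ?h] by (simp add: comp_def)
  also have "\<dots> = (\<Sum>z\<in>Zd \<epsilon>. \<Sum>e\<in>edges_Q E. \<bar>J (T_eps \<epsilon> z (fst e), T_eps \<epsilon> z (snd e))\<bar>)"
    by (simp add: sum.cartesian_product case_prod_beta)
  finally show ?thesis .
qed

lemma sum_divergence:
  fixes E :: "(('d::finite, 'v::finite) site \<times> ('d, 'v) site) set"
  assumes \<epsilon>: "\<epsilon> \<in> scales E"
  shows "(\<Sum>x\<in>X_eps \<epsilon>. \<phi> x * divergence (E_eps E \<epsilon>) J x) = (\<Sum>(x, y)\<in>E_eps E \<epsilon>. \<phi> x * J (x, y))"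
proof -
  have fin: "finite (X_eps \<epsilon> :: ('d torus \<times> 'v) set)" by (rule finite_X_eps[OF \<epsilon>])
  have sub: "{y. (x, y) \<in> E_eps E \<epsilon>} \<subseteq> X_eps \<epsilon>" for x using E_eps_subset by blast
  have "(\<Sum>x\<in>X_eps \<epsilon>. \<phi> x * divergence (E_eps E \<epsilon>) J x)
      = (\<Sum>x\<in>X_eps \<epsilon>. \<Sum>y\<in>{y. (x, y) \<in> E_eps E \<epsilon>}. \<phi> x * J (x, y))"
    by (simp add: divergence_def sum_distrib_left)
  also have "\<dots> = (\<Sum>(x, y)\<in>(SIGMA x:X_eps \<epsilon>. {y. (x, y) \<in> E_eps E \<epsilon>}). \<phi> x * J (x, y))"
    by (rule sum.Sigma) (use fin finite_subset[OF sub fin] in auto)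
  also have "(SIGMA x:X_eps \<epsilon>. {y. (x, y) \<in> E_eps E \<epsilon>}) = E_eps E \<epsilon>"
    using E_eps_subset by blast
  finally show ?thesis .
qed

text \<open>Summation by parts: exchanging the two ends of every edge preserves the edge set and reverses the sign
  of the flux. The factor 2 accounts for the two orientations of an edge.\<close>

lemma sum_divergence_gradient:
  fixes E :: "(('d::finite, 'v::finite) site \<times> ('d, 'v) site) set"
  assumes E: "periodic_graph E" and \<epsilon>: "\<epsilon> \<in> scales E" and J: "J \<in> antisym_fluxes (E_eps E \<epsilon>)"
  shows "2 * (\<Sum>x\<in>X_eps \<epsilon>. \<phi> x * divergence (E_eps E \<epsilon>) J x) = (\<Sum>(x, y)\<in>E_eps E \<epsilon>. (\<phi> x - \<phi> y) * J (x, y))"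
proof -
  have "(\<Sum>(x, y)\<in>E_eps E \<epsilon>. \<phi> x * J (x, y)) = (\<Sum>(x, y)\<in>E_eps E \<epsilon>. \<phi> y * J (y, x))"
    by (rule sum.reindex_bij_witness[of _ prod.swap prod.swap]) (auto simp: sym_E_eps[OF E])
  also have "\<dots> = (\<Sum>(x, y)\<in>E_eps E \<epsilon>. - (\<phi> y * J (x, y)))"
    using J by (intro sum.cong) (auto simp: antisym_fluxes_def)
  finally have "2 * (\<Sum>(x, y)\<in>E_eps E \<epsilon>. \<phi> x * J (x, y))
      = (\<Sum>(x, y)\<in>E_eps E \<epsilon>. \<phi> x * J (x, y)) + (\<Sum>(x, y)\<in>E_eps E \<epsilon>. - (\<phi> y * J (x, y)))" by simp
  also have "\<dots> = (\<Sum>(x, y)\<in>E_eps E \<epsilon>. (\<phi> x - \<phi> y) * J (x, y))"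
    by (subst sum.distrib[symmetric]) (auto intro!: sum.cong simp: algebra_simps)
  finally show ?thesis by (simp add: sum_divergence[OF \<epsilon>])
qed

lemma abs_sum_divergence_le:
  fixes E :: "(('d::finite, 'v::finite) site \<times> ('d, 'v) site) set"
  assumes E: "periodic_graph E" and \<epsilon>: "\<epsilon> \<in> scales E" and J: "J \<in> antisym_fluxes (E_eps E \<epsilon>)"
    and \<phi>: "\<And>x y. (x, y) \<in> E_eps E \<epsilon> \<Longrightarrow> \<bar>\<phi> x - \<phi> y\<bar> \<le> K"
  shows "\<bar>\<Sum>x\<in>X_eps \<epsilon>. \<phi> x * divergence (E_eps E \<epsilon>) J x\<bar> \<le> K * (\<Sum>e\<in>E_eps E \<epsilon>. \<bar>J e\<bar>)"
proof -
  define S where "S = (\<Sum>x\<in>X_eps \<epsilon>. \<phi> x * divergence (E_eps E \<epsilon>) J x)"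
  have "\<bar>2 * S\<bar> \<le> (\<Sum>(x, y)\<in>E_eps E \<epsilon>. \<bar>(\<phi> x - \<phi> y) * J (x, y)\<bar>)"
    unfolding S_def sum_divergence_gradient[OF E \<epsilon> J] case_prod_beta by (rule sum_abs)
  also have "\<dots> \<le> (\<Sum>e\<in>E_eps E \<epsilon>. K * \<bar>J e\<bar>)"
    using \<phi> by (intro sum_mono) (auto simp: abs_mult intro: mult_right_mono)
  finally have "2 * \<bar>S\<bar> \<le> K * (\<Sum>e\<in>E_eps E \<epsilon>. \<bar>J e\<bar>)" by (simp add: sum_distrib_left abs_mult)
  then show ?thesis unfolding S_def[symmetric] using abs_ge_zero[of S] by linarith
qed

section \<open>Coercivity\<close>

text \<open>The coercivity estimates of the cells are added up. The fluxes enter with the factor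
  \<open>\<epsilon>\<^sup>d / \<epsilon>\<^sup>d\<^sup>-\<^sup>1 = \<epsilon>\<close>; the mass of a site is counted at most once for every site of the coercivity
  ball; and there are at most \<open>\<epsilon>\<^sup>-\<^sup>d\<close> cells.\<close>

lemma energy_lower_bound:
  fixes E :: "(('d::finite, 'v::finite) site \<times> ('d, 'v) site) set" and F :: "('d, 'v) cost"
  assumes E: "periodic_graph E" and F: "admissible_cost E F"
  obtains c C where "0 < c" "0 \<le> C" "\<And>\<epsilon> m J. \<epsilon> \<in> scales E \<Longrightarrow> \<forall>x\<in>X_eps \<epsilon>. 0 \<le> m x \<Longrightarrow>
    J \<in> antisym_fluxes (E_eps E \<epsilon>) \<Longrightarrow>
    ereal (c * (\<epsilon> * (\<Sum>e\<in>E_eps E \<epsilon>. \<bar>J e\<bar>)) - C * (1 + (\<Sum>x\<in>X_eps \<epsilon>. m x))) \<le> energy E F \<epsilon> m J"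
proof -
  obtain R1 where "coercive_cost E F R1" using F by (auto simp: admissible_cost_def)
  then obtain c C0 where c: "0 < c" and coer: "\<And>m J. m \<in> nonneg_densities \<Longrightarrow> J \<in> antisym_fluxes E \<Longrightarrow>
      ereal (c * (\<Sum>e\<in>edges_Q E. \<bar>J e\<bar>) - C0 * (1 + (\<Sum>x\<in>ball_sites (max (R0 E) R1). m x))) \<le> F m J"
    unfolding coercive_cost_def by blast
  define B :: "('d, 'v) site set" where "B = ball_sites (max (R0 E) R1)"
  define C where "C = \<bar>C0\<bar> * (1 + real (card B))"
  show thesis
  proof (rule that[OF c])
    show "0 \<le> C" by (simp add: C_def)
    fix \<epsilon> :: real and m :: "'d torus \<times> 'v \<Rightarrow> real" and J
    assume \<epsilon>: "\<epsilon> \<in> scales E" and m': "\<forall>x\<in>X_eps \<epsilon>. 0 \<le> m x" and J: "J \<in> antisym_fluxes (E_eps E \<epsilon>)"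
    have m: "0 \<le> m x" if "x \<in> X_eps \<epsilon>" for x using m' that by blast
    have pos: "0 < \<epsilon>" using \<epsilon> by (simp add: scales_def)
    define d where "d = CARD('d)"
    have d: "0 < d" by (simp add: d_def)
    define mz where "mz z = (\<lambda>x. tau_density \<epsilon> z m x / \<epsilon> ^ d)" for z
    define Jz where "Jz z = (\<lambda>e. tau_flux E \<epsilon> z J e / \<epsilon> ^ (d - 1))" for z
    define M where "M = (\<Sum>x\<in>X_eps \<epsilon>. m x)"
    have mz: "mz z \<in> nonneg_densities" for z
      using m[OF T_eps_in_X_eps] pos by (simp add: mz_def nonneg_densities_def tau_density_def del: split_paired_All)
    have Jz: "Jz z \<in> antisym_fluxes E" for z
    proof -
      have Jz_eq: "Jz z (x, y) = (if (x, y) \<in> E then J (T_eps \<epsilon> z x, T_eps \<epsilon> z y) / \<epsilon> ^ (d - 1) else 0)" for x y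
        by (simp add: Jz_def tau_flux_def)
      have sym: "(y, x) \<in> E" if "(x, y) \<in> E" for x y
        using E that unfolding periodic_graph_def sym_def by blast
      have anti: "J (T_eps \<epsilon> z y, T_eps \<epsilon> z x) = - J (T_eps \<epsilon> z x, T_eps \<epsilon> z y)" if "(x, y) \<in> E" for x y
        using J E_eps_T_eps[OF E that] unfolding antisym_fluxes_def by blast
      show ?thesis
        unfolding antisym_fluxes_def mem_Collect_eq
      proof (intro conjI allI impI)
        fix x y assume xy: "(x, y) \<in> E"
        show "Jz z (y, x) = - Jz z (x, y)" unfolding Jz_eq using xy sym[OF xy] anti[OF xy] by simp
      next
        fix e assume "e \<notin> E"
        then show "Jz z e = 0" by (cases e) (simp only: Jz_eq if_False)
      qed
    qed
    have split: "\<epsilon> ^ d = \<epsilon> * \<epsilon> ^ (d - 1)" using d by (cases d) auto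
    define g where "g z = c * \<epsilon> * (\<Sum>e\<in>edges_Q E. \<bar>J (T_eps \<epsilon> z (fst e), T_eps \<epsilon> z (snd e))\<bar>)
        - \<bar>C0\<bar> * (\<epsilon> ^ d + (\<Sum>x\<in>B. m (T_eps \<epsilon> z x)))" for z
    have g: "ereal (g z) \<le> ereal (\<epsilon> ^ d) * F (mz z) (Jz z)" for z
    proof -
      let ?S = "\<Sum>e\<in>edges_Q E. \<bar>J (T_eps \<epsilon> z (fst e), T_eps \<epsilon> z (snd e))\<bar>"
      let ?N = "\<Sum>x\<in>B. m (T_eps \<epsilon> z x)"
      have sumJ: "(\<Sum>e\<in>edges_Q E. \<bar>Jz z e\<bar>) = ?S / \<epsilon> ^ (d - 1)"
        unfolding sum_divide_distrib using pos
        by (intro sum.cong) (auto simp: Jz_def tau_flux_def edges_Q_def)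
      have summ: "(\<Sum>x\<in>B. mz z x) = ?N / \<epsilon> ^ d"
        by (simp add: mz_def tau_density_def sum_divide_distrib)
      have N0: "0 \<le> ?N" by (intro sum_nonneg m T_eps_in_X_eps)
      have "g z = \<epsilon> ^ d * (c * (?S / \<epsilon> ^ (d - 1)) - \<bar>C0\<bar> * (1 + ?N / \<epsilon> ^ d))"
        using pos by (simp add: g_def split field_simps)
      also have "\<dots> \<le> \<epsilon> ^ d * (c * (?S / \<epsilon> ^ (d - 1)) - C0 * (1 + ?N / \<epsilon> ^ d))"
        using pos N0 by (intro mult_left_mono diff_left_mono mult_right_mono) auto
      finally have "ereal (g z) \<le> ereal (\<epsilon> ^ d) * ereal (c * (\<Sum>e\<in>edges_Q E. \<bar>Jz z e\<bar>) - C0 * (1 + (\<Sum>x\<in>B. mz z x)))"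
        by (simp add: sumJ summ)
      also have "\<dots> \<le> ereal (\<epsilon> ^ d) * F (mz z) (Jz z)"
        using coer[OF mz Jz, of z z] pos unfolding B_def by (intro ereal_mult_left_mono) auto
      finally show ?thesis .
    qed
    have "c * (\<epsilon> * (\<Sum>e\<in>E_eps E \<epsilon>. \<bar>J e\<bar>)) - C * (1 + M) \<le> (\<Sum>z\<in>Zd \<epsilon>. g z)"
    proof -
      let ?S = "\<Sum>z\<in>Zd \<epsilon>. \<Sum>e\<in>edges_Q E. \<bar>J (T_eps \<epsilon> z (fst e), T_eps \<epsilon> z (snd e))\<bar>"
      let ?N = "\<Sum>z\<in>Zd \<epsilon>. \<Sum>x\<in>B. m (T_eps \<epsilon> z x)"
      have M0: "0 \<le> M" unfolding M_def by (intro sum_nonneg m)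
      have "?N = (\<Sum>x\<in>B. \<Sum>z\<in>Zd \<epsilon>. m (T_eps \<epsilon> z x))" by (rule sum.swap)
      also have "\<dots> \<le> (\<Sum>x\<in>B. M)"
      proof (rule sum_mono)
        fix x assume "x \<in> B"
        have inj: "inj_on (\<lambda>z. T_eps \<epsilon> z x) (Zd \<epsilon>)"
          using scaled_site_inj_on_Zd[OF \<epsilon>] by (auto simp: inj_on_def T_eps_eq)
        have "(\<Sum>z\<in>Zd \<epsilon>. m (T_eps \<epsilon> z x)) = (\<Sum>y\<in>(\<lambda>z. T_eps \<epsilon> z x) ` Zd \<epsilon>. m y)"
          by (simp add: sum.reindex[OF inj])
        also have "\<dots> \<le> M"
          unfolding M_def
        proof (rule sum_mono2[OF finite_X_eps[OF \<epsilon>]])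
          show "(\<lambda>z. T_eps \<epsilon> z x) ` Zd \<epsilon> \<subseteq> X_eps \<epsilon>"
            by (rule image_subsetI) (rule T_eps_in_X_eps)
        qed (use m in blast)
        finally show "(\<Sum>z\<in>Zd \<epsilon>. m (T_eps \<epsilon> z x)) \<le> M" .
      qed
      finally have N: "?N \<le> real (card B) * M" by simp
      have "\<epsilon> ^ d * real (card (Zd \<epsilon> :: (int ^ 'd) set)) \<le> 1"
        using card_Zd_le[OF \<epsilon>] by (simp add: d_def)
      then have "\<epsilon> ^ d * real (card (Zd \<epsilon> :: (int ^ 'd) set)) + ?N \<le> 1 + real (card B) * M" using N by linarith
      also have "\<dots> \<le> (1 + real (card B)) * (1 + M)" using M0 by (simp add: algebra_simps)
      finally have 1: "\<bar>C0\<bar> * (\<epsilon> ^ d * real (card (Zd \<epsilon> :: (int ^ 'd) set)) + ?N) \<le> C * (1 + M)"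
        unfolding C_def mult.assoc by (rule mult_left_mono) simp
      have 2: "c * (\<epsilon> * (\<Sum>e\<in>E_eps E \<epsilon>. \<bar>J e\<bar>)) \<le> c * (\<epsilon> * ?S)"
        using c pos by (intro mult_left_mono sum_E_eps_le[OF E \<epsilon>]) auto
      have "(\<Sum>z\<in>Zd \<epsilon>. g z) = c * (\<epsilon> * ?S) - \<bar>C0\<bar> * (\<epsilon> ^ d * real (card (Zd \<epsilon> :: (int ^ 'd) set)) + ?N)"
        by (simp add: g_def sum_subtractf sum.distrib sum_distrib_left[symmetric] mult.assoc mult.commute[of "real _"])
      then show ?thesis using 1 2 by linarith
    qed
    then have "ereal (c * (\<epsilon> * (\<Sum>e\<in>E_eps E \<epsilon>. \<bar>J e\<bar>)) - C * (1 + M)) \<le> ereal (\<Sum>z\<in>Zd \<epsilon>. g z)" by simp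
    also have "\<dots> = (\<Sum>z\<in>Zd \<epsilon>. ereal (g z))" by simp
    also have "\<dots> \<le> energy E F \<epsilon> m J"
      unfolding energy_def d_def[symmetric] using g by (intro sum_mono) (simp add: mz_def Jz_def)
    finally show "ereal (c * (\<epsilon> * (\<Sum>e\<in>E_eps E \<epsilon>. \<bar>J e\<bar>)) - C * (1 + (\<Sum>x\<in>X_eps \<epsilon>. m x))) \<le> energy E F \<epsilon> m J"
      by (simp add: M_def)
  qed
qed

text \<open>Without measurability of \<open>f\<close> its integrals are suprema over simple functions below and need not be
  additive. The pointwise bound is therefore rearranged to \<open>h \<le> (h - w)\<^sup>+ + w\<close>, where all functions
  are measurable and \<open>(h - w)\<^sup>+\<close> is dominated by the positive part of \<open>f\<close>. The weight \<open>w\<close> is paid for twice: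
  once here and once for the negative part of \<open>f\<close>.\<close>

lemma nn_integral_le_ereal_integral:
  fixes f :: "real \<Rightarrow> ereal" and h w :: "real \<Rightarrow> real"
  assumes lower: "\<And>t. t \<in> I \<Longrightarrow> ereal (h t - w t) \<le> f t"
    and h: "\<And>t. t \<in> I \<Longrightarrow> 0 \<le> h t" "(\<lambda>t. indicator I t * h t) \<in> borel_measurable lborel"
    and w: "\<And>t. t \<in> I \<Longrightarrow> 0 \<le> w t" "(\<lambda>t. indicator I t * w t) \<in> borel_measurable lborel"
    and W: "(\<integral>\<^sup>+t\<in>I. ennreal (w t) \<partial>lborel) \<le> ennreal W" "0 \<le> W"
    and f: "ereal_integral I f \<le> ereal A" and A: "0 \<le> A"
  shows "(\<integral>\<^sup>+t\<in>I. ennreal (h t) \<partial>lborel) \<le> ennreal (A + 2 * W)"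
proof -
  define P where "P = (\<integral>\<^sup>+t\<in>I. e2ennreal (f t) \<partial>lborel)"
  define N where "N = (\<integral>\<^sup>+t\<in>I. e2ennreal (- f t) \<partial>lborel)"
  have "N \<le> (\<integral>\<^sup>+t\<in>I. ennreal (w t) \<partial>lborel)"
    unfolding N_def
  proof (rule nn_integral_mono)
    fix t
    show "e2ennreal (- f t) * indicator I t \<le> ennreal (w t) * indicator I t"
    proof (cases "t \<in> I")
      case True
      have "- f t \<le> - ereal (h t - w t)" using lower[OF True] by (simp only: ereal_minus_le_minus)
      also have "\<dots> \<le> ereal (w t)" using h(1)[OF True] by simp
      finally have "e2ennreal (- f t) \<le> e2ennreal (ereal (w t))" by (rule e2ennreal_mono)
      then show ?thesis using True by simp
    qed simp
  qed
  then have N: "N \<le> ennreal W" using W(1) by (rule order_trans)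
  then have Nr: "enn2ereal N \<le> ereal W"
    using W(2) by (metis enn2ereal_ennreal less_eq_ennreal.rep_eq)
  have "enn2ereal P - enn2ereal N \<le> ereal A" using f by (simp add: ereal_integral_def P_def N_def)
  moreover have "enn2ereal N \<noteq> \<infinity>" using Nr by auto
  moreover have "0 \<le> enn2ereal N" by simp
  ultimately have "enn2ereal P \<le> ereal A + ereal W"
    using Nr by (cases "enn2ereal N"; cases "enn2ereal P") auto
  also have "\<dots> = enn2ereal (ennreal (A + W))" using A W(2) by (subst enn2ereal_ennreal) auto
  finally have P: "P \<le> ennreal (A + W)" by (simp only: less_eq_ennreal.rep_eq)
  have "(\<integral>\<^sup>+t\<in>I. ennreal (h t) \<partial>lborel)
      \<le> (\<integral>\<^sup>+t. ennreal (indicator I t * h t - indicator I t * w t) + ennreal (indicator I t * w t) \<partial>lborel)"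
  proof (rule nn_integral_mono)
    fix t
    have "ennreal x \<le> ennreal (x - y) + ennreal y" if "0 \<le> y" for x y :: real
    proof (cases "y \<le> x")
      case True
      then show ?thesis using that by (simp add: ennreal_plus[symmetric] del: ennreal_plus)
    next
      case False
      then have "ennreal x \<le> ennreal y" by (intro ennreal_leI) simp
      then show ?thesis by (simp add: add_increasing)
    qed
    from this[OF w(1)] show "ennreal (h t) * indicator I t
        \<le> ennreal (indicator I t * h t - indicator I t * w t) + ennreal (indicator I t * w t)"
      by (cases "t \<in> I") auto
  qed
  also have "\<dots> = (\<integral>\<^sup>+t. ennreal (indicator I t * h t - indicator I t * w t) \<partial>lborel)
      + (\<integral>\<^sup>+t. ennreal (indicator I t * w t) \<partial>lborel)"
    by (rule nn_integral_add) (use h(2) w(2) in measurable)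
  also have "\<dots> \<le> ennreal (A + W) + ennreal W"
  proof (rule add_mono)
    have "(\<integral>\<^sup>+t. ennreal (indicator I t * h t - indicator I t * w t) \<partial>lborel) \<le> P"
      unfolding P_def
    proof (rule nn_integral_mono)
      fix t
      show "ennreal (indicator I t * h t - indicator I t * w t) \<le> e2ennreal (f t) * indicator I t"
      proof (cases "t \<in> I")
        case True
        have "e2ennreal (ereal (h t - w t)) \<le> e2ennreal (f t)" by (rule e2ennreal_mono[OF lower[OF True]])
        then show ?thesis using True by simp
      qed simp
    qed
    then show "(\<integral>\<^sup>+t. ennreal (indicator I t * h t - indicator I t * w t) \<partial>lborel) \<le> ennreal (A + W)"
      using P by (rule order_trans)
    have "(\<integral>\<^sup>+t. ennreal (indicator I t * w t) \<partial>lborel) = (\<integral>\<^sup>+t\<in>I. ennreal (w t) \<partial>lborel)"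
      by (intro nn_integral_cong) (auto simp: indicator_def)
    then show "(\<integral>\<^sup>+t. ennreal (indicator I t * w t) \<partial>lborel) \<le> ennreal W" using W(1) by simp
  qed
  also have "\<dots> = ennreal (A + 2 * W)" using A W(2) by (simp add: ennreal_plus[symmetric] del: ennreal_plus)
  finally show ?thesis .
qed

section \<open>Measures on space-time\<close>

text \<open>Bounded kernels from \<open>I\<close> to the torus.\<close>

definition measure_curve :: "real set \<Rightarrow> real \<Rightarrow> (real \<Rightarrow> ('d::finite) torus measure) \<Rightarrow> bool" where
  "measure_curve I C \<mu> \<longleftrightarrow>
     (\<forall>t\<in>I. sets (\<mu> t) = sets borel \<and> finite_measure (\<mu> t) \<and> measure (\<mu> t) UNIV \<le> C) \<and>
     (\<forall>A\<in>sets borel. (\<lambda>t. emeasure (\<mu> t) A) \<in> borel_measurable (restrict_space borel I))"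

lemma sets_borel_torus_product:
  "sets (borel :: (real \<times> ('d::finite) torus) measure) =
     sigma_sets UNIV {A \<times> B | A B. A \<in> sets (borel :: real measure) \<and> B \<in> sets (borel :: 'd torus measure)}"
proof -
  have "sets (borel :: (real \<times> 'd torus) measure) = sets (borel \<Otimes>\<^sub>M borel)"
    by (simp only: borel_prod)
  then show ?thesis by (simp only: sets_pair_measure space_borel UNIV_Times_UNIV)
qed

lemma sets_section:
  assumes "A \<in> sets (borel :: (real \<times> ('d::finite) torus) measure)"
  shows "Pair t -` A \<in> sets borel"
proof -
  have "Pair t \<in> measurable borel (borel :: (real \<times> 'd torus) measure)"
    by (rule borel_measurable_continuous_onI) (intro continuous_intros)
  from measurable_sets[OF this assms] show ?thesis by simp
qed

text \<open>For a rectangle the assertion is the measurability of the kernel; a Dynkin class argument extends it to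
  the product \<open>\<sigma>\<close>-algebra.\<close>

lemma measure_curve_section_measurable:
  fixes \<mu> :: "real \<Rightarrow> ('d::finite) torus measure"
  assumes \<mu>: "measure_curve I C \<mu>" and I: "I \<in> sets borel" and A: "A \<in> sets borel"
  shows "(\<lambda>t. emeasure (\<mu> t) (Pair t -` A)) \<in> borel_measurable (restrict_space borel I)"
proof -
  let ?G = "{X \<times> Y | X Y. X \<in> sets (borel :: real measure) \<and> Y \<in> sets (borel :: 'd torus measure)}"
  let ?M = "restrict_space borel I"
  have sets\<mu>: "sets (\<mu> t) = sets borel" and fin\<mu>: "finite_measure (\<mu> t)" if "t \<in> space ?M" for t
    using \<mu> that by (auto simp: measure_curve_def space_restrict_space)
  have "Int_stable ?G"
  proof (rule Int_stableI)
    fix a b assume "a \<in> ?G" "b \<in> ?G"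
    then obtain X Y X' Y' where *: "a = X \<times> Y" "b = X' \<times> Y'" "X \<in> sets borel" "X' \<in> sets borel" "Y \<in> sets borel" "Y' \<in> sets borel"
      by blast
    have "a \<inter> b = (X \<inter> X') \<times> (Y \<inter> Y')" using * by auto
    then show "a \<inter> b \<in> ?G" using * by blast
  qed
  moreover have "?G \<subseteq> Pow UNIV" by simp
  moreover have "A \<in> sigma_sets UNIV ?G" using A by (simp only: sets_borel_torus_product)
  ultimately show ?thesis
  proof (induction rule: sigma_sets_induct_disjoint)
    case (basic a)
    then obtain X Y where a: "a = X \<times> Y" "X \<in> sets borel" "Y \<in> sets borel" by auto
    have "emeasure (\<mu> t) (Pair t -` a) = indicator X t * emeasure (\<mu> t) Y" for t
    proof (cases "t \<in> X")
      case True
      then have "Pair t -` a = Y" by (auto simp: a)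
      then show ?thesis using True by simp
    next
      case False
      then have "Pair t -` a = {}" by (auto simp: a)
      then show ?thesis using False by simp
    qed
    moreover have "(\<lambda>t. indicator X t * emeasure (\<mu> t) Y) \<in> borel_measurable ?M"
    proof (rule borel_measurable_times_ennreal)
      show "indicator X \<in> borel_measurable ?M"
        by (intro measurable_restrict_space1 borel_measurable_indicator a)
      show "(\<lambda>t. emeasure (\<mu> t) Y) \<in> borel_measurable ?M"
        using \<mu> a(3) unfolding measure_curve_def by blast
    qed
    ultimately show ?case by simp
  next
    case empty
    then show ?case by simp
  next
    case (compl a)
    have a: "a \<in> sets borel" using compl(1) by (simp only: sets_borel_torus_product)
    have "emeasure (\<mu> t) (Pair t -` (UNIV - a)) = emeasure (\<mu> t) UNIV - emeasure (\<mu> t) (Pair t -` a)"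
      if t: "t \<in> space ?M" for t
    proof -
      interpret finite_measure "\<mu> t" by (rule fin\<mu>[OF t])
      have sp: "space (\<mu> t) = UNIV" using sets_eq_imp_space_eq[OF sets\<mu>[OF t]] by simp
      have "Pair t -` (UNIV - a) = space (\<mu> t) - Pair t -` a" by (auto simp: sp)
      then show ?thesis
        using emeasure_compl[of "Pair t -` a" "\<mu> t"] sets_section[OF a] sets\<mu>[OF t] sp by simp
    qed
    moreover have "(\<lambda>t. emeasure (\<mu> t) UNIV - emeasure (\<mu> t) (Pair t -` a)) \<in> borel_measurable ?M"
    proof (rule borel_measurable_minus_ennreal)
      show "(\<lambda>t. emeasure (\<mu> t) UNIV) \<in> borel_measurable ?M"
        using \<mu> sets.top[of "borel :: 'd torus measure"] unfolding measure_curve_def by auto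
    qed (rule compl)
    ultimately show ?case by (subst measurable_cong) auto
  next
    case (union a)
    have a: "a i \<in> sets borel" for i using union(2) by (simp only: sets_borel_torus_product) auto
    have "emeasure (\<mu> t) (Pair t -` (\<Union>i. a i)) = (\<Sum>i. emeasure (\<mu> t) (Pair t -` a i))"
      if t: "t \<in> space ?M" for t
    proof -
      have "(\<Sum>i. emeasure (\<mu> t) (Pair t -` a i)) = emeasure (\<mu> t) (\<Union>i. Pair t -` a i)"
        using union(1) sets_section[OF a] sets\<mu>[OF t]
        by (intro suminf_emeasure) (auto simp: disjoint_family_on_def)
      then show ?thesis by (simp add: vimage_UN)
    qed
    moreover have "(\<lambda>t. \<Sum>i. emeasure (\<mu> t) (Pair t -` a i)) \<in> borel_measurable ?M"
      by (intro borel_measurable_suminf_order union(3))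
    ultimately show ?case by (subst measurable_cong) auto
  qed
qed

lemma sets_spacetime:
  assumes "I \<in> sets borel"
  shows "sets (spacetime I \<mu>) = sets (restrict_space borel (I \<times> UNIV))"
    and "space (spacetime I \<mu>) = I \<times> UNIV"
proof -
  let ?R = "restrict_space borel (I \<times> UNIV) :: (real \<times> 'a) measure"
  have sp: "space ?R = I \<times> UNIV" by (simp add: space_restrict_space)
  have sub: "sets ?R \<subseteq> Pow (I \<times> UNIV)" using sets.space_closed[of ?R] by (simp only: sp)
  show "space (spacetime I \<mu>) = I \<times> UNIV"
    unfolding spacetime_def by (rule space_measure_of[OF sub])
  show "sets (spacetime I \<mu>) = sets ?R"
    unfolding spacetime_def sets_measure_of[OF sub] using sets.sigma_sets_eq[of ?R] by (simp only: sp)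
qed

lemma emeasure_spacetime:
  fixes \<mu> :: "real \<Rightarrow> ('d::finite) torus measure"
  assumes \<mu>: "measure_curve I C \<mu>" and I: "I \<in> sets borel"
    and A: "A \<in> sets borel" "A \<subseteq> I \<times> UNIV"
  shows "emeasure (spacetime I \<mu>) A = (\<integral>\<^sup>+t\<in>I. emeasure (\<mu> t) (Pair t -` A) \<partial>lborel)"
proof -
  let ?R = "restrict_space borel (I \<times> UNIV) :: (real \<times> 'd torus) measure"
  have sp: "space ?R = I \<times> UNIV" by (simp add: space_restrict_space)
  have IU: "(I \<times> UNIV :: (real \<times> 'd torus) set) \<in> sets borel"
    unfolding borel_prod[symmetric] using I by simp
  have sR: "X \<in> sets borel" if "X \<in> sets ?R" for X
    using that IU by (auto simp: sets_restrict_space)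
  have "A \<in> sets ?R" using A IU by (auto simp: sets_restrict_space_iff)
  show ?thesis unfolding spacetime_def
  proof (rule emeasure_measure_of_sigma[OF _ _ _ \<open>A \<in> sets ?R\<close>])
    show "sigma_algebra (I \<times> UNIV) (sets ?R)"
      using sets.sigma_algebra_axioms[of ?R] by (simp only: sp)
    show "positive (sets ?R) (\<lambda>A. \<integral>\<^sup>+t\<in>I. emeasure (\<mu> t) (Pair t -` A) \<partial>lborel)"
      by (simp add: positive_def)
    show "countably_additive (sets ?R) (\<lambda>A. \<integral>\<^sup>+t\<in>I. emeasure (\<mu> t) (Pair t -` A) \<partial>lborel)"
    proof (rule countably_additiveI)
      fix X :: "nat \<Rightarrow> (real \<times> 'd torus) set"
      assume X: "range X \<subseteq> sets ?R" "disjoint_family X"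
      then have Xb: "X i \<in> sets borel" for i using sR by blast
      have "(\<Sum>i. \<integral>\<^sup>+t\<in>I. emeasure (\<mu> t) (Pair t -` X i) \<partial>lborel)
          = (\<integral>\<^sup>+t. (\<Sum>i. emeasure (\<mu> t) (Pair t -` X i) * indicator I t) \<partial>lborel)"
      proof (rule nn_integral_suminf[symmetric])
        show "(\<lambda>t. emeasure (\<mu> t) (Pair t -` X i) * indicator I t) \<in> borel_measurable lborel" for i
          using measure_curve_section_measurable[OF \<mu> I Xb[of i]] I
          by (simp add: borel_measurable_restrict_space_iff_ennreal)
      qed
      also have "\<dots> = (\<integral>\<^sup>+t\<in>I. emeasure (\<mu> t) (Pair t -` (\<Union>i. X i)) \<partial>lborel)"
      proof (rule nn_integral_cong)
        fix t
        show "(\<Sum>i. emeasure (\<mu> t) (Pair t -` X i) * indicator I t) = emeasure (\<mu> t) (Pair t -` (\<Union>i. X i)) * indicator I t"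
        proof (cases "t \<in> I")
          case True
          have "sets (\<mu> t) = sets borel" using \<mu> True by (simp add: measure_curve_def)
          then have "(\<Sum>i. emeasure (\<mu> t) (Pair t -` X i)) = emeasure (\<mu> t) (\<Union>i. Pair t -` X i)"
            using X(2) sets_section[OF Xb] by (intro suminf_emeasure) (auto simp: disjoint_family_on_def)
          then show ?thesis using True by (simp add: vimage_UN)
        qed simp
      qed
      finally show "(\<Sum>i. \<integral>\<^sup>+t\<in>I. emeasure (\<mu> t) (Pair t -` X i) \<partial>lborel)
          = (\<integral>\<^sup>+t\<in>I. emeasure (\<mu> t) (Pair t -` (\<Union>i. X i)) \<partial>lborel)" .
    qed
  qed
qed

text \<open>Fubini's theorem for a kernel: the defining formula of the measure is the case of indicators, and
  the monotone class argument does the rest.\<close>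

lemma nn_integral_spacetime:
  fixes \<mu> :: "real \<Rightarrow> ('d::finite) torus measure" and f :: "real \<times> 'd torus \<Rightarrow> ennreal"
  assumes \<mu>: "measure_curve I C \<mu>" and I: "I \<in> sets borel" and f: "f \<in> borel_measurable borel"
  shows "(\<lambda>t. \<integral>\<^sup>+p. f (t, p) \<partial>\<mu> t) \<in> borel_measurable (restrict_space borel I)"
    and "(\<integral>\<^sup>+z. f z \<partial>spacetime I \<mu>) = (\<integral>\<^sup>+t\<in>I. (\<integral>\<^sup>+p. f (t, p) \<partial>\<mu> t) \<partial>lborel)"
proof -
  let ?M = "restrict_space borel I"
  have IU: "(I \<times> UNIV :: (real \<times> 'd torus) set) \<in> sets borel"
    unfolding borel_prod[symmetric] using I by simp
  have sets\<mu>: "sets (\<mu> t) = sets borel" if "t \<in> I" for t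
    using \<mu> that by (auto simp: measure_curve_def)
  have Pair: "(\<lambda>p. g (t, p)) \<in> borel_measurable (\<mu> t)" if "t \<in> I" "g \<in> borel_measurable borel"
    for t and g :: "real \<times> 'd torus \<Rightarrow> ennreal"
  proof -
    have "Pair t \<in> measurable borel (borel :: (real \<times> 'd torus) measure)"
      by (rule borel_measurable_continuous_onI) (intro continuous_intros)
    from measurable_compose[OF this that(2)] show ?thesis
      unfolding measurable_cong_sets[OF sets\<mu>[OF that(1)] refl] .
  qed
  have st: "g \<in> borel_measurable (spacetime I \<mu>)" if "g \<in> borel_measurable borel" for g :: "real \<times> 'd torus \<Rightarrow> ennreal"
    unfolding measurable_cong_sets[OF sets_spacetime(1)[OF I] refl] by (rule measurable_restrict_space1[OF that])
  have toI: "(\<lambda>t. h t * indicator I t) \<in> borel_measurable lborel" if "h \<in> borel_measurable ?M" for h :: "real \<Rightarrow> ennreal"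
    using that I by (simp add: borel_measurable_restrict_space_iff_ennreal)
  from f have "(\<lambda>t. \<integral>\<^sup>+p. f (t, p) \<partial>\<mu> t) \<in> borel_measurable ?M \<and>
    (\<integral>\<^sup>+z. f z \<partial>spacetime I \<mu>) = (\<integral>\<^sup>+t\<in>I. (\<integral>\<^sup>+p. f (t, p) \<partial>\<mu> t) \<partial>lborel)"
  proof (induction rule: borel_measurable_induct)
    case (cong f g)
    then have "f = g" by auto
    then show ?case using cong by simp
  next
    case (set A)
    have A': "A \<inter> (I \<times> UNIV) \<in> sets borel" using set IU by blast
    have e: "(\<integral>\<^sup>+p. indicator A (t, p) \<partial>\<mu> t) = emeasure (\<mu> t) (Pair t -` A)" if "t \<in> I" for t
    proof -
      have "(\<integral>\<^sup>+p. indicator A (t, p) \<partial>\<mu> t) = (\<integral>\<^sup>+p. indicator (Pair t -` A) p \<partial>\<mu> t)"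
        by (intro nn_integral_cong) (auto simp: indicator_def)
      then show ?thesis using sets_section[OF set] sets\<mu>[OF that] by simp
    qed
    have "(\<lambda>t. \<integral>\<^sup>+p. indicator A (t, p) \<partial>\<mu> t) \<in> borel_measurable ?M"
      using measure_curve_section_measurable[OF \<mu> I set] e
      by (subst measurable_cong[where g = "\<lambda>t. emeasure (\<mu> t) (Pair t -` A)"]) (auto simp: space_restrict_space)
    moreover have "(\<integral>\<^sup>+z. indicator A z \<partial>spacetime I \<mu>) = emeasure (spacetime I \<mu>) (A \<inter> (I \<times> UNIV))"
    proof -
      have "(\<integral>\<^sup>+z. indicator A z \<partial>spacetime I \<mu>) = (\<integral>\<^sup>+z. indicator (A \<inter> (I \<times> UNIV)) z \<partial>spacetime I \<mu>)"
        by (intro nn_integral_cong) (auto simp: sets_spacetime(2)[OF I] indicator_def)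
      also have "\<dots> = emeasure (spacetime I \<mu>) (A \<inter> (I \<times> UNIV))"
        using A' IU by (intro nn_integral_indicator) (auto simp: sets_spacetime(1)[OF I] sets_restrict_space_iff)
      finally show ?thesis .
    qed
    moreover have "\<dots> = (\<integral>\<^sup>+t\<in>I. emeasure (\<mu> t) (Pair t -` (A \<inter> (I \<times> UNIV))) \<partial>lborel)"
      by (rule emeasure_spacetime[OF \<mu> I A']) auto
    moreover have "\<dots> = (\<integral>\<^sup>+t\<in>I. (\<integral>\<^sup>+p. indicator A (t, p) \<partial>\<mu> t) \<partial>lborel)"
    proof (rule nn_integral_cong)
      fix t
      have "Pair t -` (A \<inter> (I \<times> UNIV)) = Pair t -` A" if "t \<in> I" using that by auto
      then show "emeasure (\<mu> t) (Pair t -` (A \<inter> (I \<times> UNIV))) * indicator I t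
          = (\<integral>\<^sup>+p. indicator A (t, p) \<partial>\<mu> t) * indicator I t"
        using e[of t] by (auto simp: indicator_def)
    qed
    ultimately show ?case by simp
  next
    case (mult u c)
    have inner: "(\<integral>\<^sup>+p. c * u (t, p) \<partial>\<mu> t) = c * (\<integral>\<^sup>+p. u (t, p) \<partial>\<mu> t)" if "t \<in> I" for t
      by (rule nn_integral_cmult[OF Pair[OF that mult(2)]])
    have m: "(\<lambda>t. \<integral>\<^sup>+p. u (t, p) \<partial>\<mu> t) \<in> borel_measurable ?M" using mult by blast
    have "(\<lambda>t. \<integral>\<^sup>+p. c * u (t, p) \<partial>\<mu> t) \<in> borel_measurable ?M"
      using m inner
      by (subst measurable_cong[where g = "\<lambda>t. c * (\<integral>\<^sup>+p. u (t, p) \<partial>\<mu> t)"])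
        (auto simp: space_restrict_space)
    moreover have "(\<integral>\<^sup>+t\<in>I. (\<integral>\<^sup>+p. c * u (t, p) \<partial>\<mu> t) \<partial>lborel) = c * (\<integral>\<^sup>+t\<in>I. (\<integral>\<^sup>+p. u (t, p) \<partial>\<mu> t) \<partial>lborel)"
    proof -
      have "(\<integral>\<^sup>+t\<in>I. (\<integral>\<^sup>+p. c * u (t, p) \<partial>\<mu> t) \<partial>lborel) = (\<integral>\<^sup>+t. c * ((\<integral>\<^sup>+p. u (t, p) \<partial>\<mu> t) * indicator I t) \<partial>lborel)"
        by (intro nn_integral_cong) (auto simp: indicator_def inner)
      also have "\<dots> = c * (\<integral>\<^sup>+t\<in>I. (\<integral>\<^sup>+p. u (t, p) \<partial>\<mu> t) \<partial>lborel)"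
        by (rule nn_integral_cmult[OF toI[OF m]])
      finally show ?thesis .
    qed
    moreover have "(\<integral>\<^sup>+z. c * u z \<partial>spacetime I \<mu>) = c * (\<integral>\<^sup>+z. u z \<partial>spacetime I \<mu>)"
      by (rule nn_integral_cmult[OF st[OF mult(2)]])
    ultimately show ?case using mult by simp
  next
    case (add u v)
    have inner: "(\<integral>\<^sup>+p. v (t, p) + u (t, p) \<partial>\<mu> t) = (\<integral>\<^sup>+p. v (t, p) \<partial>\<mu> t) + (\<integral>\<^sup>+p. u (t, p) \<partial>\<mu> t)" if "t \<in> I" for t
      by (intro nn_integral_add Pair[OF that] add)
    have m: "(\<lambda>t. \<integral>\<^sup>+p. u (t, p) \<partial>\<mu> t) \<in> borel_measurable ?M" "(\<lambda>t. \<integral>\<^sup>+p. v (t, p) \<partial>\<mu> t) \<in> borel_measurable ?M"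
      using add by blast+
    have "(\<lambda>t. \<integral>\<^sup>+p. v (t, p) + u (t, p) \<partial>\<mu> t) \<in> borel_measurable ?M"
      using m inner
      by (subst measurable_cong[where g = "\<lambda>t. (\<integral>\<^sup>+p. v (t, p) \<partial>\<mu> t) + (\<integral>\<^sup>+p. u (t, p) \<partial>\<mu> t)"])
        (auto simp: space_restrict_space)
    moreover have "(\<integral>\<^sup>+t\<in>I. (\<integral>\<^sup>+p. v (t, p) + u (t, p) \<partial>\<mu> t) \<partial>lborel)
        = (\<integral>\<^sup>+t\<in>I. (\<integral>\<^sup>+p. v (t, p) \<partial>\<mu> t) \<partial>lborel) + (\<integral>\<^sup>+t\<in>I. (\<integral>\<^sup>+p. u (t, p) \<partial>\<mu> t) \<partial>lborel)"
    proof -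
      have "(\<integral>\<^sup>+t\<in>I. (\<integral>\<^sup>+p. v (t, p) + u (t, p) \<partial>\<mu> t) \<partial>lborel)
        = (\<integral>\<^sup>+t. (\<integral>\<^sup>+p. v (t, p) \<partial>\<mu> t) * indicator I t + (\<integral>\<^sup>+p. u (t, p) \<partial>\<mu> t) * indicator I t \<partial>lborel)"
        by (intro nn_integral_cong) (auto simp: indicator_def inner)
      also have "\<dots> = (\<integral>\<^sup>+t\<in>I. (\<integral>\<^sup>+p. v (t, p) \<partial>\<mu> t) \<partial>lborel) + (\<integral>\<^sup>+t\<in>I. (\<integral>\<^sup>+p. u (t, p) \<partial>\<mu> t) \<partial>lborel)"
        by (intro nn_integral_add toI m)
      finally show ?thesis .
    qed
    moreover have "(\<integral>\<^sup>+z. v z + u z \<partial>spacetime I \<mu>) = (\<integral>\<^sup>+z. v z \<partial>spacetime I \<mu>) + (\<integral>\<^sup>+z. u z \<partial>spacetime I \<mu>)"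
      by (intro nn_integral_add st add)
    ultimately show ?case using add by simp
  next
    case (seq U)
    have mono: "incseq U" by (rule seq)
    have U_m: "U i \<in> borel_measurable borel" for i by (rule seq)
    define V where "V z = (SUP i. U i z)" for z
    have V: "(SUP i. U i) = V" by (auto simp: V_def fun_eq_iff image_image)
    have inner: "(\<integral>\<^sup>+p. V (t, p) \<partial>\<mu> t) = (SUP i. \<integral>\<^sup>+p. U i (t, p) \<partial>\<mu> t)" if "t \<in> I" for t
      unfolding V_def
      by (rule nn_integral_monotone_convergence_SUP)
        (use mono Pair[OF that U_m] in \<open>auto simp: incseq_def le_fun_def\<close>)
    have m: "(\<lambda>t. \<integral>\<^sup>+p. U i (t, p) \<partial>\<mu> t) \<in> borel_measurable ?M" for i using seq by blast
    have "(\<lambda>t. \<integral>\<^sup>+p. V (t, p) \<partial>\<mu> t) \<in> borel_measurable ?M"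
      using m inner
      by (subst measurable_cong[where g = "\<lambda>t. SUP i. (\<integral>\<^sup>+p. U i (t, p) \<partial>\<mu> t)"])
        (auto simp: space_restrict_space)
    moreover have "(\<integral>\<^sup>+t\<in>I. (\<integral>\<^sup>+p. V (t, p) \<partial>\<mu> t) \<partial>lborel)
        = (SUP i. \<integral>\<^sup>+t\<in>I. (\<integral>\<^sup>+p. U i (t, p) \<partial>\<mu> t) \<partial>lborel)"
    proof -
      have "(\<integral>\<^sup>+t\<in>I. (\<integral>\<^sup>+p. V (t, p) \<partial>\<mu> t) \<partial>lborel)
        = (\<integral>\<^sup>+t. (SUP i. (\<integral>\<^sup>+p. U i (t, p) \<partial>\<mu> t) * indicator I t) \<partial>lborel)"
      proof (intro nn_integral_cong)
        fix t
        show "(\<integral>\<^sup>+p. V (t, p) \<partial>\<mu> t) * indicator I t = (SUP i. (\<integral>\<^sup>+p. U i (t, p) \<partial>\<mu> t) * indicator I t)"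
          by (cases "t \<in> I") (simp_all add: inner)
      qed
      also have "\<dots> = (SUP i. \<integral>\<^sup>+t\<in>I. (\<integral>\<^sup>+p. U i (t, p) \<partial>\<mu> t) \<partial>lborel)"
      proof (rule nn_integral_monotone_convergence_SUP)
        show "incseq (\<lambda>i t. (\<integral>\<^sup>+p. U i (t, p) \<partial>\<mu> t) * indicator I t)"
          using mono by (auto simp: incseq_def le_fun_def intro!: mult_right_mono nn_integral_mono)
      qed (rule toI[OF m])
      finally show ?thesis .
    qed
    moreover have "(\<integral>\<^sup>+z. V z \<partial>spacetime I \<mu>) = (SUP i. \<integral>\<^sup>+z. U i z \<partial>spacetime I \<mu>)"
      unfolding V_def by (rule nn_integral_monotone_convergence_SUP[OF mono st[OF U_m]])
    ultimately show ?case unfolding V using seq by simp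
  qed
  then show "(\<lambda>t. \<integral>\<^sup>+p. f (t, p) \<partial>\<mu> t) \<in> borel_measurable ?M"
    "(\<integral>\<^sup>+z. f z \<partial>spacetime I \<mu>) = (\<integral>\<^sup>+t\<in>I. (\<integral>\<^sup>+p. f (t, p) \<partial>\<mu> t) \<partial>lborel)" by blast+
qed

lemma integral_spacetime_nonneg:
  fixes \<mu> :: "real \<Rightarrow> ('d::finite) torus measure" and f :: "real \<times> 'd torus \<Rightarrow> real"
  assumes \<mu>: "measure_curve {a<..<b} C \<mu>" and f: "f \<in> borel_measurable borel" "\<And>z. 0 \<le> f z" "\<And>z. f z \<le> B"
  shows "set_integrable lborel {a<..<b} (\<lambda>t. \<integral>p. f (t, p) \<partial>\<mu> t)"
    and "integrable (spacetime {a<..<b} \<mu>) f"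
    and "(\<integral>z. f z \<partial>spacetime {a<..<b} \<mu>) = (LBINT t:{a<..<b}. \<integral>p. f (t, p) \<partial>\<mu> t)"
proof -
  let ?I = "{a<..<b}"
  have I: "?I \<in> sets borel" by simp
  have B: "0 \<le> B" using f(2,3)[of undefined] by linarith
  have C: "0 \<le> C" if "t \<in> ?I" for t
    using \<mu> that measure_nonneg[of "\<mu> t" UNIV] unfolding measure_curve_def by (meson order_trans)
  have fe: "(\<lambda>z. ennreal (f z)) \<in> borel_measurable borel" using f(1) by simp
  note nn = nn_integral_spacetime[OF \<mu> I fe]
  have inner: "(\<integral>\<^sup>+p. ennreal (f (t, p)) \<partial>\<mu> t) = ennreal (\<integral>p. f (t, p) \<partial>\<mu> t)"
    and bound: "0 \<le> (\<integral>p. f (t, p) \<partial>\<mu> t)" "(\<integral>p. f (t, p) \<partial>\<mu> t) \<le> B * C" if t: "t \<in> ?I" for t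
  proof -
    interpret finite_measure "\<mu> t" using \<mu> t by (simp add: measure_curve_def)
    have sets: "sets (\<mu> t) = sets borel" and mass: "measure (\<mu> t) UNIV \<le> C" using \<mu> t by (simp_all add: measure_curve_def)
    have sp: "space (\<mu> t) = UNIV" using sets_eq_imp_space_eq[OF sets] by simp
    have "Pair t \<in> measurable borel (borel :: (real \<times> 'd torus) measure)"
      by (rule borel_measurable_continuous_onI) (intro continuous_intros)
    from measurable_compose[OF this f(1)] have m: "(\<lambda>p. f (t, p)) \<in> borel_measurable (\<mu> t)"
      unfolding measurable_cong_sets[OF sets refl] .
    have int: "integrable (\<mu> t) (\<lambda>p. f (t, p))"
      by (rule integrable_const_bound[of _ B]) (use f m in auto)
    show "(\<integral>\<^sup>+p. ennreal (f (t, p)) \<partial>\<mu> t) = ennreal (\<integral>p. f (t, p) \<partial>\<mu> t)"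
      by (rule nn_integral_eq_integral[OF int]) (use f in auto)
    show "0 \<le> (\<integral>p. f (t, p) \<partial>\<mu> t)" by (rule Bochner_Integration.integral_nonneg) (use f in auto)
    have "(\<integral>p. f (t, p) \<partial>\<mu> t) \<le> (\<integral>p. B \<partial>\<mu> t)"
      by (rule integral_mono[OF int]) (use f in auto)
    also have "\<dots> = B * measure (\<mu> t) UNIV" by (simp add: sp)
    also have "\<dots> \<le> B * C" using mass B by (rule mult_left_mono)
    finally show "(\<integral>p. f (t, p) \<partial>\<mu> t) \<le> B * C" .
  qed
  have meas: "(\<lambda>t. indicator ?I t *\<^sub>R (\<integral>p. f (t, p) \<partial>\<mu> t)) \<in> borel_measurable lborel"
  proof -
    have "(\<lambda>t. (\<integral>\<^sup>+p. ennreal (f (t, p)) \<partial>\<mu> t) * indicator ?I t) \<in> borel_measurable borel"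
      using nn(1) by (simp add: borel_measurable_restrict_space_iff_ennreal)
    then have "(\<lambda>t. enn2real ((\<integral>\<^sup>+p. ennreal (f (t, p)) \<partial>\<mu> t) * indicator ?I t)) \<in> borel_measurable borel"
      by simp
    also have "(\<lambda>t. enn2real ((\<integral>\<^sup>+p. ennreal (f (t, p)) \<partial>\<mu> t) * indicator ?I t))
        = (\<lambda>t. indicator ?I t *\<^sub>R (\<integral>p. f (t, p) \<partial>\<mu> t))"
      by (auto simp: fun_eq_iff indicator_def inner bound)
    finally show ?thesis by simp
  qed
  show int: "set_integrable lborel ?I (\<lambda>t. \<integral>p. f (t, p) \<partial>\<mu> t)"
    unfolding set_integrable_def
  proof (rule Bochner_Integration.integrable_bound[OF _ meas])
    show "integrable lborel (\<lambda>t. indicator ?I t * (B * C))"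
      using emeasure_bounded_finite[of ?I]
      by (intro integrable_mult_left integrable_real_indicator) auto
    show "AE t in lborel. norm (indicator ?I t *\<^sub>R (\<integral>p. f (t, p) \<partial>\<mu> t)) \<le> norm (indicator ?I t * (B * C))"
      using bound C B by (intro always_eventually allI) (auto simp: indicator_def)
  qed
  have "(\<integral>\<^sup>+z. ennreal (f z) \<partial>spacetime ?I \<mu>) = (\<integral>\<^sup>+t. ennreal (indicator ?I t *\<^sub>R (\<integral>p. f (t, p) \<partial>\<mu> t)) \<partial>lborel)"
    unfolding nn(2) by (intro nn_integral_cong) (auto simp: indicator_def inner)
  also have "\<dots> = ennreal (LBINT t:?I. \<integral>p. f (t, p) \<partial>\<mu> t)"
    unfolding set_lebesgue_integral_def
    by (rule nn_integral_eq_integral[OF int[unfolded set_integrable_def]])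
      (use bound in \<open>auto simp: indicator_def\<close>)
  finally have eq: "(\<integral>\<^sup>+z. ennreal (f z) \<partial>spacetime ?I \<mu>) = ennreal (LBINT t:?I. \<integral>p. f (t, p) \<partial>\<mu> t)" .
  have fst: "f \<in> borel_measurable (spacetime ?I \<mu>)"
    unfolding measurable_cong_sets[OF sets_spacetime(1)[OF I] refl] by (rule measurable_restrict_space1[OF f(1)])
  show fi: "integrable (spacetime ?I \<mu>) f"
    by (rule integrableI_nonneg[OF fst]) (use f eq in auto)
  have "ennreal (\<integral>z. f z \<partial>spacetime ?I \<mu>) = ennreal (LBINT t:?I. \<integral>p. f (t, p) \<partial>\<mu> t)"
    using nn_integral_eq_integral[OF fi] f(2) eq by simp
  then show "(\<integral>z. f z \<partial>spacetime ?I \<mu>) = (LBINT t:?I. \<integral>p. f (t, p) \<partial>\<mu> t)"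
  proof (subst (asm) ennreal_inj)
    show "0 \<le> (LBINT t:?I. \<integral>p. f (t, p) \<partial>\<mu> t)"
      unfolding set_lebesgue_integral_def
      by (rule Bochner_Integration.integral_nonneg) (use bound in \<open>auto simp: indicator_def\<close>)
  qed (auto intro: Bochner_Integration.integral_nonneg f)
qed

text \<open>Adding the constant \<open>B\<close> reduces the assertion to nonnegative functions.\<close>

lemma integral_spacetime:
  fixes \<mu> :: "real \<Rightarrow> ('d::finite) torus measure" and f :: "real \<times> 'd torus \<Rightarrow> real"
  assumes \<mu>: "measure_curve {a<..<b} C \<mu>" and f: "f \<in> borel_measurable borel" "\<And>z. \<bar>f z\<bar> \<le> B"
  shows "set_integrable lborel {a<..<b} (\<lambda>t. \<integral>p. f (t, p) \<partial>\<mu> t)"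
    and "(\<integral>z. f z \<partial>spacetime {a<..<b} \<mu>) = (LBINT t:{a<..<b}. \<integral>p. f (t, p) \<partial>\<mu> t)"
proof -
  let ?I = "{a<..<b}"
  define g where "g z = f z + B" for z
  have g: "g \<in> borel_measurable borel" "\<And>z. 0 \<le> g z" "\<And>z. g z \<le> 2 * B"
    using f(1) f(2) by (auto simp: g_def[abs_def] abs_le_iff) (smt (verit))+
  have B: "0 \<le> B" using f(2)[of undefined] by linarith
  have c: "(\<lambda>z. B) \<in> borel_measurable (borel :: (real \<times> 'd torus) measure)" "\<And>z. 0 \<le> B" "\<And>z. B \<le> B" using B by auto
  note G = integral_spacetime_nonneg[OF \<mu> g]
  note K = integral_spacetime_nonneg[where f = "\<lambda>_. B", OF \<mu> c]
  have inner: "(\<integral>p. f (t, p) \<partial>\<mu> t) = (\<integral>p. g (t, p) \<partial>\<mu> t) - (\<integral>p. B \<partial>\<mu> t)" if t: "t \<in> ?I" for t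
  proof -
    interpret finite_measure "\<mu> t" using \<mu> t by (simp add: measure_curve_def)
    have sets: "sets (\<mu> t) = sets borel" using \<mu> t by (simp_all add: measure_curve_def)
    have "Pair t \<in> measurable borel (borel :: (real \<times> 'd torus) measure)"
      by (rule borel_measurable_continuous_onI) (intro continuous_intros)
    from measurable_compose[OF this g(1)] have m: "(\<lambda>p. g (t, p)) \<in> borel_measurable (\<mu> t)"
      unfolding measurable_cong_sets[OF sets refl] .
    have "integrable (\<mu> t) (\<lambda>p. g (t, p))"
      by (rule integrable_const_bound[of _ "2 * B"]) (use g m in auto)
    then have "(\<integral>p. g (t, p) - B \<partial>\<mu> t) = (\<integral>p. g (t, p) \<partial>\<mu> t) - (\<integral>p. B \<partial>\<mu> t)"
      by (intro Bochner_Integration.integral_diff) auto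
    then show ?thesis by (simp add: g_def)
  qed
  have "set_integrable lborel ?I (\<lambda>t. (\<integral>p. g (t, p) \<partial>\<mu> t) - (\<integral>p. B \<partial>\<mu> t))"
    by (rule set_integral_diff(1)[OF G(1) K(1)])
  moreover have "set_integrable lborel ?I (\<lambda>t. (\<integral>p. g (t, p) \<partial>\<mu> t) - (\<integral>p. B \<partial>\<mu> t))
      = set_integrable lborel ?I (\<lambda>t. \<integral>p. f (t, p) \<partial>\<mu> t)"
    by (rule set_integrable_cong) (auto simp: inner)
  ultimately show "set_integrable lborel ?I (\<lambda>t. \<integral>p. f (t, p) \<partial>\<mu> t)" by simp
  have "(\<integral>z. f z \<partial>spacetime ?I \<mu>) = (\<integral>z. g z - B \<partial>spacetime ?I \<mu>)" by (simp add: g_def)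
  also have "\<dots> = (\<integral>z. g z \<partial>spacetime ?I \<mu>) - (\<integral>z. B \<partial>spacetime ?I \<mu>)"
    by (rule Bochner_Integration.integral_diff[OF G(2) K(2)])
  also have "\<dots> = (LBINT t:?I. (\<integral>p. g (t, p) \<partial>\<mu> t) - (\<integral>p. B \<partial>\<mu> t))"
    unfolding G(3) K(3) by (rule set_integral_diff(2)[OF G(1) K(1), symmetric])
  also have "\<dots> = (LBINT t:?I. \<integral>p. f (t, p) \<partial>\<mu> t)"
    by (rule set_lebesgue_integral_cong) (auto simp: inner)
  finally show "(\<integral>z. f z \<partial>spacetime ?I \<mu>) = (LBINT t:?I. \<integral>p. f (t, p) \<partial>\<mu> t)" .
qed

lemma spacetime_in_Mplus:
  fixes \<mu> :: "real \<Rightarrow> ('d::finite) torus measure"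
  assumes \<mu>: "measure_curve {a<..<b} C \<mu>"
  shows "spacetime {a<..<b} \<mu> \<in> Mplus ({a<..<b} \<times> UNIV)"
proof -
  have c: "(\<lambda>z. 1) \<in> borel_measurable (borel :: (real \<times> 'd torus) measure)" "\<And>z. 0 \<le> (1::real)" "\<And>z. 1 \<le> (1::real)" by auto
  have "integrable (spacetime {a<..<b} \<mu>) (\<lambda>z. 1 :: real)"
    by (rule integral_spacetime_nonneg(2)[where f = "\<lambda>_. 1", OF \<mu> c])
  then have "emeasure (spacetime {a<..<b} \<mu>) (space (spacetime {a<..<b} \<mu>)) < \<infinity>"
    by (simp add: integrable_iff_bounded)
  then have "finite_measure (spacetime {a<..<b} \<mu>)" by (intro finite_measureI) auto
  then show ?thesis by (simp add: Mplus_def sets_spacetime(1))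
qed

text \<open>The indicator of an open set is the pointwise limit of the continuous functions \<open>min 1 (n f)\<close>, where
  \<open>f\<close> is positive exactly on that set; open sets generate the Borel sets and are stable under intersection.\<close>

lemma measurable_curve_if_integrals_measurable:
  fixes \<mu> :: "real \<Rightarrow> ('d::finite) torus measure"
  assumes \<mu>: "\<And>t. t \<in> I \<Longrightarrow> sets (\<mu> t) = sets borel" "\<And>t. t \<in> I \<Longrightarrow> finite_measure (\<mu> t)"
    and int: "\<And>f :: 'd torus \<Rightarrow> real. continuous_on UNIV f \<Longrightarrow> (\<lambda>t. \<integral>p. f p \<partial>\<mu> t) \<in> borel_measurable (restrict_space borel I)"
    and A: "A \<in> sets borel"
  shows "(\<lambda>t. emeasure (\<mu> t) A) \<in> borel_measurable (restrict_space borel I)"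
proof -
  let ?M = "restrict_space borel I"
  have open_case: "(\<lambda>t. emeasure (\<mu> t) U) \<in> borel_measurable ?M" if "open U" for U
  proof -
    obtain f :: "'d torus \<Rightarrow> real" where f: "continuous_on UNIV f" "\<And>p. 0 \<le> f p" "\<And>p. f p \<le> 1" "U = {p. 0 < f p}"
      using torus_open_superlevel[OF \<open>open U\<close>] by blast
    define g where "g n p = min 1 (real n * f p)" for n p
    have g: "continuous_on UNIV (g n)" for n unfolding g_def by (intro continuous_intros f)
    have g01: "0 \<le> g n p" "g n p \<le> 1" for n p using f(2)[of p] by (auto simp: g_def)
    have lim: "(\<lambda>n. g n p) \<longlonglongrightarrow> indicator U p" for p
    proof (cases "p \<in> U")
      case True
      then have pos: "0 < f p" using f(4) by simp
      obtain N where N: "1 / f p \<le> real N" using real_arch_simple by blast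
      have "g n p = 1" if "N \<le> n" for n
      proof -
        have "1 \<le> real N * f p" using N pos by (simp add: field_simps)
        also have "\<dots> \<le> real n * f p" using that pos by (intro mult_right_mono) auto
        finally show ?thesis by (simp add: g_def)
      qed
      then show ?thesis using True by (auto intro!: tendsto_eventually eventually_sequentiallyI[of N])
    next
      case False
      then have "f p = 0" using f(2,4) by (auto simp: less_le)
      then show ?thesis using False by (simp add: g_def)
    qed
    have "measure (\<mu> t) U = lim (\<lambda>n. \<integral>p. g n p \<partial>\<mu> t)" if t: "t \<in> I" for t
    proof -
      interpret finite_measure "\<mu> t" by (rule \<mu>(2)[OF t])
      have U: "U \<in> sets (\<mu> t)" using \<open>open U\<close> \<mu>(1)[OF t] by simp
      have "(\<lambda>n. \<integral>p. g n p \<partial>\<mu> t) \<longlonglongrightarrow> (\<integral>p. indicator U p \<partial>\<mu> t)"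
      proof (rule integral_dominated_convergence[where w = "\<lambda>_. 1"])
        show "g n \<in> borel_measurable (\<mu> t)" for n
          unfolding measurable_cong_sets[OF \<mu>(1)[OF t] refl] by (rule borel_measurable_continuous_onI[OF g])
      qed (use U lim g01 in auto)
      also have "(\<integral>p. indicator U p \<partial>\<mu> t) = measure (\<mu> t) U" using U by simp
      finally show ?thesis by (rule limI[symmetric])
    qed
    moreover have "(\<lambda>t. lim (\<lambda>n. \<integral>p. g n p \<partial>\<mu> t)) \<in> borel_measurable ?M"
      by (rule borel_measurable_lim_metric) (rule int[OF g])
    ultimately have "(\<lambda>t. measure (\<mu> t) U) \<in> borel_measurable ?M"
      by (subst measurable_cong[where g = "\<lambda>t. lim (\<lambda>n. \<integral>p. g n p \<partial>\<mu> t)"]) (auto simp: space_restrict_space)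
    then have "(\<lambda>t. ennreal (measure (\<mu> t) U)) \<in> borel_measurable ?M" by simp
    then show ?thesis
      by (subst measurable_cong[where g = "\<lambda>t. ennreal (measure (\<mu> t) U)"])
        (auto simp: space_restrict_space finite_measure.emeasure_eq_measure[OF \<mu>(2)])
  qed
  have "Int_stable {U :: 'd torus set. open U}" by (auto intro: Int_stableI)
  moreover have "{U :: 'd torus set. open U} \<subseteq> Pow UNIV" by simp
  moreover have "A \<in> sigma_sets UNIV {U. open U}" using A by (simp add: borel_def)
  ultimately show ?thesis
  proof (induction rule: sigma_sets_induct_disjoint)
    case (basic U)
    then show ?case using open_case by simp
  next
    case (compl B)
    have B: "B \<in> sets borel" using compl(1) by (simp add: borel_def)
    have "emeasure (\<mu> t) (UNIV - B) = emeasure (\<mu> t) UNIV - emeasure (\<mu> t) B" if t: "t \<in> space ?M" for t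
    proof -
      have t: "t \<in> I" using t by (simp add: space_restrict_space)
      interpret finite_measure "\<mu> t" by (rule \<mu>(2)[OF t])
      have sp: "space (\<mu> t) = UNIV" using sets_eq_imp_space_eq[OF \<mu>(1)[OF t]] by simp
      show ?thesis using emeasure_compl[of B "\<mu> t"] B \<mu>(1)[OF t] sp by simp
    qed
    moreover have "(\<lambda>t. emeasure (\<mu> t) UNIV - emeasure (\<mu> t) B) \<in> borel_measurable ?M"
      by (intro borel_measurable_minus_ennreal compl open_case open_UNIV)
    ultimately show ?case by (subst measurable_cong) auto
  next
    case (union B)
    have B: "B i \<in> sets borel" for i using union(2) by (auto simp: borel_def)
    have "emeasure (\<mu> t) (\<Union>i. B i) = (\<Sum>i. emeasure (\<mu> t) (B i))" if t: "t \<in> space ?M" for t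
    proof -
      have t: "t \<in> I" using t by (simp add: space_restrict_space)
      show ?thesis using union(1) B \<mu>(1)[OF t] by (intro suminf_emeasure[symmetric]) auto
    qed
    moreover have "(\<lambda>t. \<Sum>i. emeasure (\<mu> t) (B i)) \<in> borel_measurable ?M"
      by (intro borel_measurable_suminf_order union(3))
    ultimately show ?case by (subst measurable_cong) auto
  qed auto
qed

section \<open>Functions of class \<open>C\<^sup>1\<close> on the torus\<close>

lemma C1_torus_has_derivative:
  assumes "f \<in> C1_torus"
  shows "((\<lambda>y. f (to_torus y)) has_derivative (\<lambda>v. grad f x \<bullet> v)) (at x)"
proof -
  have "(\<lambda>y. f (to_torus y)) differentiable (at x)" using assms by (simp add: C1_torus_def)
  then have D: "((\<lambda>y. f (to_torus y)) has_derivative frechet_derivative (\<lambda>y. f (to_torus y)) (at x)) (at x)"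
    by (simp only: frechet_derivative_works)
  interpret linear "frechet_derivative (\<lambda>y. f (to_torus y)) (at x)" by (rule has_derivative_linear[OF D])
  have "frechet_derivative (\<lambda>y. f (to_torus y)) (at x) v = grad f x \<bullet> v" for v
  proof -
    have "frechet_derivative (\<lambda>y. f (to_torus y)) (at x) v
        = frechet_derivative (\<lambda>y. f (to_torus y)) (at x) (\<Sum>i\<in>UNIV. v $ i *\<^sub>R axis i 1)"
      using basis_expansion[of v] by (simp add: scalar_mult_eq_scaleR)
    also have "\<dots> = (\<Sum>i\<in>UNIV. v $ i *\<^sub>R frechet_derivative (\<lambda>y. f (to_torus y)) (at x) (axis i 1))"
      by (simp add: sum scale)
    also have "\<dots> = grad f x \<bullet> v" by (simp add: grad_def inner_vec_def mult.commute)
    finally show ?thesis .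
  qed
  then have "frechet_derivative (\<lambda>y. f (to_torus y)) (at x) = (\<lambda>v. grad f x \<bullet> v)" by blast
  then show ?thesis using D by simp
qed

lemma grad_eqI:
  assumes "((\<lambda>y. f (to_torus y)) has_derivative (\<lambda>v. w \<bullet> v)) (at x)"
  shows "grad f x = w"
  unfolding grad_def frechet_derivative_at[OF assms, symmetric] by (simp add: inner_axis vec_eq_iff)

lemma C1_torus_continuous: "f \<in> C1_torus \<Longrightarrow> continuous_on UNIV f"
  unfolding continuous_on_torus_iff
  by (intro continuous_at_imp_continuous_on ballI has_derivative_continuous[OF C1_torus_has_derivative])

lemma grad_periodic:
  assumes f: "f \<in> C1_torus" and xy: "to_torus x = to_torus y"
  shows "grad f x = grad f y"
proof (rule grad_eqI)
  have eq: "f (to_torus (z + (y - x))) = f (to_torus z)" for z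
  proof -
    have "to_torus (z + (y - x)) = to_torus z"
      using xy[symmetric] by (simp add: to_torus_eq_iff)
    then show ?thesis by simp
  qed
  have "((\<lambda>z. z + (y - x)) has_derivative (\<lambda>v. v)) (at x)"
    by (auto intro!: derivative_eq_intros)
  moreover have "((\<lambda>z. f (to_torus z)) has_derivative (\<lambda>v. grad f y \<bullet> v)) (at (x + (y - x)))"
    using C1_torus_has_derivative[OF f, of y] by simp
  ultimately have "((\<lambda>z. f (to_torus (z + (y - x)))) has_derivative (\<lambda>v. grad f y \<bullet> v)) (at x)"
    using has_derivative_compose[of "\<lambda>z. z + (y - x)" "\<lambda>v. v" x UNIV "\<lambda>z. f (to_torus z)" "\<lambda>v. grad f y \<bullet> v"] by simp
  then show "((\<lambda>z. f (to_torus z)) has_derivative (\<lambda>v. grad f y \<bullet> v)) (at x)" by (simp only: eq)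
qed

text \<open>The suprema in the norm are suprema of bounded sets: the function and its gradient are continuous, and
  periodicity reduces both to a compact set.\<close>

lemma C1_norm_upper:
  assumes f: "f \<in> C1_torus"
  shows "\<bar>f p\<bar> \<le> C1_norm f" "norm (grad f x) \<le> C1_norm f"
proof -
  obtain B where B: "\<And>p. \<bar>f p\<bar> \<le> B"
    using bounded_continuous_torus[OF C1_torus_continuous[OF f]] by blast
  have "continuous_on UNIV (grad f)" using f by (simp add: C1_torus_def)
  then have "continuous_on (cbox 0 1) (grad f)" by (rule continuous_on_subset) simp
  then have "compact (grad f ` cbox 0 1)" by (rule compact_continuous_image) simp
  then have "bounded (grad f ` cbox 0 1)" by (rule compact_imp_bounded)
  then obtain G where G: "\<forall>y\<in>grad f ` cbox 0 1. norm y \<le> G" unfolding bounded_iff by blast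
  have G': "norm (grad f x) \<le> G" for x
  proof -
    have "frac_rep (to_torus x) \<in> cbox 0 1"
      by (auto simp: cbox_def Basis_vec_def inner_axis frac_rep_bounds less_imp_le)
    then have "norm (grad f (frac_rep (to_torus x))) \<le> G" using G by blast
    moreover have "grad f (frac_rep (to_torus x)) = grad f x" by (rule grad_periodic[OF f]) simp
    ultimately show ?thesis by simp
  qed
  have b1: "bdd_above (range (\<lambda>p. \<bar>f p\<bar>))" by (rule bdd_aboveI[of _ B]) (use B in auto)
  have b2: "bdd_above (range (\<lambda>x. norm (grad f x)))" by (rule bdd_aboveI[of _ G]) (use G' in auto)
  have "0 \<le> (SUP p. \<bar>f p\<bar>)" using cSUP_upper2[OF b1, of undefined 0] by auto
  moreover have "0 \<le> (SUP x. norm (grad f x))" using cSUP_upper2[OF b2, of undefined 0] by auto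
  moreover have "\<bar>f p\<bar> \<le> (SUP p. \<bar>f p\<bar>)" by (rule cSUP_upper[OF _ b1]) simp
  moreover have "norm (grad f x) \<le> (SUP x. norm (grad f x))" by (rule cSUP_upper[OF _ b2]) simp
  ultimately show "\<bar>f p\<bar> \<le> C1_norm f" "norm (grad f x) \<le> C1_norm f" unfolding C1_norm_def by linarith+
qed

lemma C1_torus_lipschitz:
  assumes f: "f \<in> C1_torus"
  shows "torus_lipschitz f (C1_norm f)"
  unfolding torus_lipschitz_def
proof (intro allI)
  fix x y
  have "norm (f (to_torus x) - f (to_torus y)) \<le> C1_norm f * norm (x - y)"
  proof (rule differentiable_bound[of UNIV "\<lambda>y. f (to_torus y)" "\<lambda>x v. grad f x \<bullet> v"])
    show "onorm (\<lambda>v. grad f x \<bullet> v) \<le> C1_norm f" for x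
    proof (rule onorm_le)
      fix v
      have "norm (grad f x \<bullet> v) \<le> norm (grad f x) * norm v" using Cauchy_Schwarz_ineq2 by simp
      also have "\<dots> \<le> C1_norm f * norm v" by (intro mult_right_mono C1_norm_upper f) auto
      finally show "norm (grad f x \<bullet> v) \<le> C1_norm f * norm v" .
    qed
  qed (auto intro: C1_torus_has_derivative[OF f])
  then show "\<bar>f (to_torus x) - f (to_torus y)\<bar> \<le> C1_norm f * norm (x - y)" by simp
qed

lemma C1_torus_lincomb:
  assumes f: "f \<in> C1_torus" and g: "g \<in> C1_torus"
  shows "(\<lambda>p. c * f p + d * g p) \<in> C1_torus"
proof -
  have D: "((\<lambda>y. c * f (to_torus y) + d * g (to_torus y)) has_derivative (\<lambda>v. (c *\<^sub>R grad f x + d *\<^sub>R grad g x) \<bullet> v)) (at x)" for x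
    by (auto intro!: derivative_eq_intros C1_torus_has_derivative[OF f] C1_torus_has_derivative[OF g]
        simp: inner_add_left)
  have "grad (\<lambda>p. c * f p + d * g p) = (\<lambda>x. c *\<^sub>R grad f x + d *\<^sub>R grad g x)"
    by (rule ext, rule grad_eqI, rule D)
  moreover have "continuous_on UNIV (\<lambda>x. c *\<^sub>R grad f x + d *\<^sub>R grad g x)"
    using f g by (intro continuous_intros) (auto simp: C1_torus_def)
  ultimately show ?thesis using D unfolding C1_torus_def differentiable_def by auto
qed

lemma C1_torus_diff: "f \<in> C1_torus \<Longrightarrow> g \<in> C1_torus \<Longrightarrow> (\<lambda>p. f p - g p) \<in> C1_torus"
  using C1_torus_lincomb[of f g 1 "-1"] by simp

text \<open>Of the convergence in the \<open>C\<^sup>1\<close> norm only the uniform control of the values matters below; in this form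
  it passes to cell averages.\<close>

lemma C1c_curve_dominated:
  assumes "C1c_curve I \<phi> \<psi>"
  shows "\<exists>g. (g \<longlongrightarrow> 0) (at t) \<and> (\<forall>s p. \<bar>(\<phi> s p - \<phi> t p) / (s - t) - \<psi> t p\<bar> \<le> g s)"
    and "\<exists>g. (g \<longlongrightarrow> 0) (at t) \<and> (\<forall>s p. \<bar>\<psi> s p - \<psi> t p\<bar> \<le> g s)"
proof -
  have C1: "\<phi> t \<in> C1_torus" "\<psi> t \<in> C1_torus" for t using assms by (auto simp: C1c_curve_def)
  show "\<exists>g. (g \<longlongrightarrow> 0) (at t) \<and> (\<forall>s p. \<bar>(\<phi> s p - \<phi> t p) / (s - t) - \<psi> t p\<bar> \<le> g s)"
  proof (intro exI conjI allI)
    show "((\<lambda>s. C1_norm (\<lambda>p. (\<phi> s p - \<phi> t p) / (s - t) - \<psi> t p)) \<longlongrightarrow> 0) (at t)"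
      using assms by (auto simp: C1c_curve_def)
    fix s p
    have "(\<lambda>p. 1 / (s - t) * (\<phi> s p - \<phi> t p) + (-1) * \<psi> t p) \<in> C1_torus"
      by (intro C1_torus_lincomb C1_torus_diff C1)
    also have "(\<lambda>p. 1 / (s - t) * (\<phi> s p - \<phi> t p) + (-1) * \<psi> t p) = (\<lambda>p. (\<phi> s p - \<phi> t p) / (s - t) - \<psi> t p)" by simp
    finally show "\<bar>(\<phi> s p - \<phi> t p) / (s - t) - \<psi> t p\<bar> \<le> C1_norm (\<lambda>p. (\<phi> s p - \<phi> t p) / (s - t) - \<psi> t p)"
      by (rule C1_norm_upper(1))
  qed
  show "\<exists>g. (g \<longlongrightarrow> 0) (at t) \<and> (\<forall>s p. \<bar>\<psi> s p - \<psi> t p\<bar> \<le> g s)"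
  proof (intro exI conjI allI)
    show "((\<lambda>s. C1_norm (\<lambda>p. \<psi> s p - \<psi> t p)) \<longlongrightarrow> 0) (at t)"
      using assms by (auto simp: C1c_curve_def)
    show "\<bar>\<psi> s p - \<psi> t p\<bar> \<le> C1_norm (\<lambda>p. \<psi> s p - \<psi> t p)" for s p
      by (intro C1_norm_upper(1)[of "\<lambda>p. \<psi> s p - \<psi> t p"] C1_torus_diff C1)
  qed
qed

lemma C1c_curve_jointly_continuous:
  fixes \<psi> :: "real \<Rightarrow> ('d::finite) torus \<Rightarrow> real"
  assumes "C1c_curve I \<phi> \<psi>"
  shows "continuous_on UNIV (\<lambda>z. \<psi> (fst z) (snd z))"
proof (rule continuous_at_imp_continuous_on, rule ballI)
  fix z :: "real \<times> 'd torus"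
  obtain t p where z: "z = (t, p)" by (cases z)
  have "\<psi> t \<in> C1_torus" using assms by (auto simp: C1c_curve_def)
  then have ct: "continuous_on UNIV (\<psi> t)" by (rule C1_torus_continuous)
  obtain g where g: "(g \<longlongrightarrow> 0) (at t)" "\<And>s p. \<bar>\<psi> s p - \<psi> t p\<bar> \<le> g s"
    using C1c_curve_dominated(2)[OF assms, of t] by blast
  define g0 where "g0 s = (if s = t then 0 else g s)" for s
  have g0: "\<bar>\<psi> s p - \<psi> t p\<bar> \<le> g0 s" for s p using g(2) by (auto simp: g0_def)
  have "(g0 \<longlongrightarrow> 0) (at t)"
    using g(1) by (rule Lim_transform_eventually) (auto simp: g0_def eventually_at_filter)
  then have "isCont g0 t" by (simp add: isCont_def g0_def)
  moreover have "(fst \<longlongrightarrow> t) (at z)" using tendsto_fst[OF tendsto_ident_at, of z UNIV] by (simp add: z)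
  ultimately have "((\<lambda>y. g0 (fst y)) \<longlongrightarrow> g0 t) (at z)" by (rule isCont_tendsto_compose)
  then have lim0: "((\<lambda>y. g0 (fst y)) \<longlongrightarrow> 0) (at z)" by (simp add: g0_def)
  have "((\<lambda>y. \<psi> (fst y) (snd y) - \<psi> t (snd y)) \<longlongrightarrow> 0) (at z)"
    by (rule Lim_null_comparison[OF always_eventually lim0]) (use g0 in simp)
  moreover have "((\<lambda>y. \<psi> t (snd y)) \<longlongrightarrow> \<psi> t p) (at z)"
  proof (rule isCont_tendsto_compose[where g = "\<psi> t" and f = snd])
    show "isCont (\<psi> t) p" using ct by (simp add: continuous_on_eq_continuous_at)
    show "(snd \<longlongrightarrow> p) (at z)" using tendsto_snd[OF tendsto_ident_at, of z UNIV] by (simp add: z)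
  qed
  ultimately have "((\<lambda>y. (\<psi> (fst y) (snd y) - \<psi> t (snd y)) + \<psi> t (snd y)) \<longlongrightarrow> 0 + \<psi> t p) (at z)"
    by (rule tendsto_add)
  then show "isCont (\<lambda>z. \<psi> (fst z) (snd z)) z" by (simp add: isCont_def z)
qed

lemma C1c_curve_bounded:
  fixes \<psi> :: "real \<Rightarrow> ('d::finite) torus \<Rightarrow> real"
  assumes "C1c_curve {a<..<b} \<phi> \<psi>"
  obtains B where "\<And>t p. t \<in> {a<..<b} \<Longrightarrow> \<bar>\<psi> t p\<bar> \<le> B"
proof -
  have "compact ({a..b} \<times> (UNIV :: 'd torus set))" by (intro compact_Times compact_torus) auto
  then have "compact ((\<lambda>z. \<psi> (fst z) (snd z)) ` ({a..b} \<times> UNIV))"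
    by (intro compact_continuous_image continuous_on_subset[OF C1c_curve_jointly_continuous[OF assms]]) auto
  then have "bounded ((\<lambda>z. \<psi> (fst z) (snd z)) ` ({a..b} \<times> UNIV))" by (rule compact_imp_bounded)
  then obtain B where B: "\<forall>y\<in>(\<lambda>z. \<psi> (fst z) (snd z)) ` ({a..b} \<times> UNIV). norm y \<le> B"
    unfolding bounded_iff by blast
  have "\<bar>\<psi> t p\<bar> \<le> B" if "t \<in> {a<..<b}" for t p
  proof -
    have "\<psi> t p \<in> (\<lambda>z. \<psi> (fst z) (snd z)) ` ({a..b} \<times> UNIV)"
      using that by (intro image_eqI[of _ _ "(t, p)"]) auto
    then have "norm (\<psi> t p) \<le> B" using B by blast
    then show ?thesis by simp
  qed
  then show thesis using that by blast
qed

section \<open>Curves of finite action at a fixed scale\<close>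

text \<open>The speed, at time \<open>t\<close>, at which integrals of Lipschitz functions against the embedded measure can
  change.\<close>

definition flux_intensity ::
  "(('d::finite, 'v) site \<times> ('d, 'v) site) set \<Rightarrow> real \<Rightarrow>
   (real \<Rightarrow> ('d torus \<times> 'v) \<times> ('d torus \<times> 'v) \<Rightarrow> real) \<Rightarrow> real \<Rightarrow> real" where
  "flux_intensity E \<epsilon> J t = \<epsilon> * (\<Sum>e\<in>E_eps E \<epsilon>. \<bar>J t e\<bar>)"

text \<open>A flux whose action is close to the infimum is chosen, and the lower bound of the energy is integrated
  in time.\<close>

lemma flux_intensity_bound:
  fixes E :: "(('d::finite, 'v::finite) site \<times> ('d, 'v) site) set" and F :: "('d, 'v) cost"
  assumes E: "periodic_graph E" and F: "admissible_cost E F" and "a < b"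
    and A: "0 \<le> A" and M: "0 \<le> M"
  obtains K where "0 \<le> K" "\<And>\<epsilon> m. \<epsilon> \<in> scales E \<Longrightarrow> action E F \<epsilon> {a<..<b} m < ereal A \<Longrightarrow>
    total_mass \<epsilon> {a<..<b} m \<le> ennreal M \<Longrightarrow>
    \<exists>J. CE E \<epsilon> {a<..<b} m J \<and> set_integrable lborel {a<..<b} (flux_intensity E \<epsilon> J) \<and>
      (LBINT t:{a<..<b}. flux_intensity E \<epsilon> J t) \<le> K"
proof -
  let ?I = "{a<..<b}"
  obtain c C where c: "0 < c" and C: "0 \<le> C" and low: "\<And>\<epsilon> m J. \<epsilon> \<in> scales E \<Longrightarrow> \<forall>x\<in>X_eps \<epsilon>. 0 \<le> m x \<Longrightarrow>
    J \<in> antisym_fluxes (E_eps E \<epsilon>) \<Longrightarrow>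
    ereal (c * (\<epsilon> * (\<Sum>e\<in>E_eps E \<epsilon>. \<bar>J e\<bar>)) - C * (1 + (\<Sum>x\<in>X_eps \<epsilon>. m x))) \<le> energy E F \<epsilon> m J"
    using energy_lower_bound[OF E F] by blast
  define W where "W = C * (b - a) + C * M"
  have W: "0 \<le> W" using C M \<open>a < b\<close> by (simp add: W_def)
  define K where "K = (A + 2 * W) / c"
  show thesis
  proof (rule that[of K])
    show "0 \<le> K" using A W c by (simp add: K_def)
    fix \<epsilon> :: real and m :: "real \<Rightarrow> 'd torus \<times> 'v \<Rightarrow> real"
    assume \<epsilon>: "\<epsilon> \<in> scales E" and act: "action E F \<epsilon> ?I m < ereal A" and mass: "total_mass \<epsilon> ?I m \<le> ennreal M"
    have pos: "0 < \<epsilon>" using \<epsilon> by (simp add: scales_def)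
    obtain J where J: "CE E \<epsilon> ?I m J" and en: "ereal_integral ?I (\<lambda>t. energy E F \<epsilon> (m t) (J t)) < ereal A"
      using act unfolding action_def INF_less_iff by blast
    have dens: "density_curve \<epsilon> ?I m" using J by (simp add: CE_def)
    have m0: "0 \<le> m t x" if "t \<in> ?I" "x \<in> X_eps \<epsilon>" for t x using dens that by (simp add: density_curve_def)
    have Ja: "J t \<in> antisym_fluxes (E_eps E \<epsilon>)" if "t \<in> ?I" for t using J that by (simp add: CE_def)
    let ?h = "flux_intensity E \<epsilon> J"
    define w where "w t = C * (1 + (\<Sum>x\<in>X_eps \<epsilon>. m t x))" for t
    have h0: "0 \<le> ?h t" for t using pos by (simp add: flux_intensity_def sum_nonneg)
    have hm: "(\<lambda>t. indicator ?I t * ?h t) \<in> borel_measurable lborel"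
    proof -
      have "?h \<in> borel_measurable (restrict_space borel ?I)"
        unfolding flux_intensity_def[abs_def] using J
        by (intro borel_measurable_times borel_measurable_const borel_measurable_sum borel_measurable_abs)
          (auto simp: CE_def)
      then show ?thesis by (simp add: borel_measurable_restrict_space_iff)
    qed
    have mass_m: "(\<lambda>t. indicator ?I t * (\<Sum>x\<in>X_eps \<epsilon>. m t x)) \<in> borel_measurable borel"
    proof -
      have "continuous_on ?I (\<lambda>t. \<Sum>x\<in>X_eps \<epsilon>. m t x)"
        using dens by (intro continuous_on_sum) (auto simp: density_curve_def)
      from borel_measurable_continuous_on_indicator[OF _ this] show ?thesis by simp
    qed
    have mass0: "0 \<le> (\<Sum>x\<in>X_eps \<epsilon>. m t x)" if "t \<in> ?I" for t by (intro sum_nonneg m0 that)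
    have "(\<integral>\<^sup>+t\<in>?I. ennreal (c * ?h t) \<partial>lborel) \<le> ennreal (A + 2 * W)"
    proof (rule nn_integral_le_ereal_integral[where w = w])
      show "ereal (c * ?h t - w t) \<le> energy E F \<epsilon> (m t) (J t)" if "t \<in> ?I" for t
        unfolding w_def flux_intensity_def using low[OF \<epsilon> _ Ja[OF that]] m0[OF that] by blast
      show "0 \<le> c * ?h t" for t using c h0 by simp
      have "(\<lambda>t. c * (indicator ?I t * ?h t)) \<in> borel_measurable lborel"
        by (intro borel_measurable_times borel_measurable_const hm)
      then show "(\<lambda>t. indicator ?I t * (c * ?h t)) \<in> borel_measurable lborel" by (simp add: mult.left_commute)
      show "0 \<le> w t" if "t \<in> ?I" for t using C mass0[OF that] by (simp add: w_def)
      have "(\<lambda>t. C * (indicator ?I t + indicator ?I t * (\<Sum>x\<in>X_eps \<epsilon>. m t x))) \<in> borel_measurable borel"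
        by (intro borel_measurable_times borel_measurable_const borel_measurable_add mass_m borel_measurable_indicator) simp
      then show "(\<lambda>t. indicator ?I t * w t) \<in> borel_measurable lborel" by (simp add: w_def algebra_simps)
      show "(\<integral>\<^sup>+t\<in>?I. ennreal (w t) \<partial>lborel) \<le> ennreal W"
      proof -
        have "(\<integral>\<^sup>+t\<in>?I. ennreal (w t) \<partial>lborel)
          = (\<integral>\<^sup>+t. ennreal C * indicator ?I t + ennreal C * ennreal (indicator ?I t * (\<Sum>x\<in>X_eps \<epsilon>. m t x)) \<partial>lborel)"
        proof (rule nn_integral_cong)
          fix t
          show "ennreal (w t) * indicator ?I t
            = ennreal C * indicator ?I t + ennreal C * ennreal (indicator ?I t * (\<Sum>x\<in>X_eps \<epsilon>. m t x))"
          proof (cases "t \<in> ?I")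
            case True
            have "ennreal (w t) = ennreal C * (1 + ennreal (\<Sum>x\<in>X_eps \<epsilon>. m t x))"
              unfolding w_def using C mass0[OF True] by (subst ennreal_mult) (simp_all add: ennreal_plus)
            then show ?thesis using True by (simp add: distrib_left)
          qed simp
        qed
        also have "\<dots> = (\<integral>\<^sup>+t. ennreal C * indicator ?I t \<partial>lborel)
            + (\<integral>\<^sup>+t. ennreal C * ennreal (indicator ?I t * (\<Sum>x\<in>X_eps \<epsilon>. m t x)) \<partial>lborel)"
          by (rule nn_integral_add) (use mass_m in measurable)
        also have "(\<integral>\<^sup>+t. ennreal C * indicator ?I t \<partial>lborel) = ennreal C * ennreal (b - a)"
          using \<open>a < b\<close> by (simp add: nn_integral_cmult_indicator)
        also have "(\<integral>\<^sup>+t. ennreal C * ennreal (indicator ?I t * (\<Sum>x\<in>X_eps \<epsilon>. m t x)) \<partial>lborel)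
            = ennreal C * (\<integral>\<^sup>+t. ennreal (indicator ?I t * (\<Sum>x\<in>X_eps \<epsilon>. m t x)) \<partial>lborel)"
          by (rule nn_integral_cmult) (use mass_m in measurable)
        also have "(\<integral>\<^sup>+t. ennreal (indicator ?I t * (\<Sum>x\<in>X_eps \<epsilon>. m t x)) \<partial>lborel) = total_mass \<epsilon> ?I m"
          unfolding total_mass_def by (intro nn_integral_cong) (auto simp: indicator_def)
        also have "ennreal C * ennreal (b - a) + ennreal C * total_mass \<epsilon> ?I m
            \<le> ennreal C * ennreal (b - a) + ennreal C * ennreal M"
          by (intro add_left_mono mult_left_mono mass) simp
        also have "\<dots> = ennreal W"
          using C M \<open>a < b\<close> by (simp add: W_def ennreal_mult[symmetric] ennreal_plus[symmetric] del: ennreal_plus)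
        finally show ?thesis .
      qed
      show "ereal_integral ?I (\<lambda>t. energy E F \<epsilon> (m t) (J t)) \<le> ereal A" using en by simp
    qed (use W A in auto)
    moreover have "(\<integral>\<^sup>+t\<in>?I. ennreal (c * ?h t) \<partial>lborel) = (\<integral>\<^sup>+t. ennreal (c * (indicator ?I t * ?h t)) \<partial>lborel)"
      by (intro nn_integral_cong) (auto simp: indicator_def)
    ultimately have le: "(\<integral>\<^sup>+t. ennreal (c * (indicator ?I t * ?h t)) \<partial>lborel) \<le> ennreal (A + 2 * W)" by simp
    have "integrable lborel (\<lambda>t. c * (indicator ?I t * ?h t))"
    proof (rule integrableI_nonneg)
      show "(\<lambda>t. c * (indicator ?I t * ?h t)) \<in> borel_measurable lborel"
        by (intro borel_measurable_times borel_measurable_const hm)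
      show "AE t in lborel. 0 \<le> c * (indicator ?I t * ?h t)" using c h0 by simp
      show "(\<integral>\<^sup>+t. ennreal (c * (indicator ?I t * ?h t)) \<partial>lborel) < \<infinity>"
        using le by (rule le_less_trans) simp
    qed
    then have int_c: "integrable lborel (\<lambda>t. c * (indicator ?I t * ?h t))" .
    then have int: "integrable lborel (\<lambda>t. indicator ?I t * ?h t)" using c by simp
    have "ennreal (\<integral>t. c * (indicator ?I t * ?h t) \<partial>lborel) \<le> ennreal (A + 2 * W)"
      using le nn_integral_eq_integral[OF int_c] c h0 by simp
    then have "(\<integral>t. c * (indicator ?I t * ?h t) \<partial>lborel) \<le> A + 2 * W"
      using A W by (subst (asm) ennreal_le_iff) auto
    then have "c * (\<integral>t. indicator ?I t * ?h t \<partial>lborel) \<le> A + 2 * W" by simp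
    then have "(\<integral>t. indicator ?I t * ?h t \<partial>lborel) \<le> K" using c by (simp add: K_def field_simps)
    then show "\<exists>J. CE E \<epsilon> ?I m J \<and> set_integrable lborel ?I (flux_intensity E \<epsilon> J) \<and>
      (LBINT t:?I. flux_intensity E \<epsilon> J t) \<le> K"
      using J int by (intro exI[of _ J]) (simp add: set_integrable_def set_lebesgue_integral_def)
  qed
qed

context
  fixes E :: "(('d::finite, 'v::finite) site \<times> ('d, 'v) site) set"
    and \<epsilon> a b :: real and m J
  assumes E: "periodic_graph E" and \<epsilon>: "\<epsilon> \<in> scales E" and ab: "a < b"
    and CE: "CE E \<epsilon> {a<..<b} m J"
    and int_h: "set_integrable lborel {a<..<b} (flux_intensity E \<epsilon> J)"
begin

lemma CE_nonneg: "t \<in> {a<..<b} \<Longrightarrow> x \<in> X_eps \<epsilon> \<Longrightarrow> 0 \<le> m t x"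
  using CE by (simp add: CE_def density_curve_def)

lemma CE_continuous: "x \<in> X_eps \<epsilon> \<Longrightarrow> continuous_on {a<..<b} (\<lambda>t. m t x)"
  using CE by (simp add: CE_def density_curve_def)

lemma CE_antisym: "t \<in> {a<..<b} \<Longrightarrow> J t \<in> antisym_fluxes (E_eps E \<epsilon>)"
  using CE by (simp add: CE_def)

lemma CE_divergence_integrable:
  "x \<in> X_eps \<epsilon> \<Longrightarrow> compact K \<Longrightarrow> K \<subseteq> {a<..<b} \<Longrightarrow>
    set_integrable lborel K (\<lambda>t. divergence (E_eps E \<epsilon>) (J t) x)"
  using CE by (simp add: CE_def)

lemma CE_increment:
  assumes x: "x \<in> X_eps \<epsilon>" and st: "a < s" "s < t" "t < b"
  shows "m t x - m s x = - (LBINT r:{s<..t}. divergence (E_eps E \<epsilon>) (J r) x)"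
proof (rule weak_derivative_imp_increment[OF CE_continuous[OF x] CE_divergence_integrable[OF x] _ st])
  fix \<phi> assume "test_function {a<..<b} \<phi>"
  then show "- (LBINT t:{a<..<b}. deriv \<phi> t * m t x) + (LBINT t:{a<..<b}. \<phi> t * divergence (E_eps E \<epsilon>) (J t) x) = 0"
    using CE x unfolding CE_def by blast
qed

text \<open>The continuity equation at the single sites, summed with weights.\<close>

lemma weighted_mass_increment:
  assumes st: "a < s" "s < t" "t < b"
  shows "(\<Sum>x\<in>X_eps \<epsilon>. m t x * \<phi> x) - (\<Sum>x\<in>X_eps \<epsilon>. m s x * \<phi> x)
    = - (LBINT r:{s<..t}. \<Sum>x\<in>X_eps \<epsilon>. \<phi> x * divergence (E_eps E \<epsilon>) (J r) x)"
proof -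
  have int: "set_integrable lborel {s<..t} (\<lambda>r. divergence (E_eps E \<epsilon>) (J r) x)" if "x \<in> X_eps \<epsilon>" for x
  proof (rule set_integrable_subset)
    show "set_integrable lborel {s..t} (\<lambda>r. divergence (E_eps E \<epsilon>) (J r) x)"
      by (rule CE_divergence_integrable[OF that]) (use st in auto)
  qed auto
  have "(\<Sum>x\<in>X_eps \<epsilon>. m t x * \<phi> x) - (\<Sum>x\<in>X_eps \<epsilon>. m s x * \<phi> x) = (\<Sum>x\<in>X_eps \<epsilon>. \<phi> x * (m t x - m s x))"
    by (simp add: sum_subtractf algebra_simps)
  also have "\<dots> = (\<Sum>x\<in>X_eps \<epsilon>. \<phi> x * - (LBINT r:{s<..t}. divergence (E_eps E \<epsilon>) (J r) x))"
    by (intro sum.cong refl) (simp only: CE_increment[OF _ st])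
  also have "\<dots> = - (\<Sum>x\<in>X_eps \<epsilon>. LBINT r:{s<..t}. \<phi> x * divergence (E_eps E \<epsilon>) (J r) x)"
    by (simp add: sum_negf)
  also have "(\<Sum>x\<in>X_eps \<epsilon>. LBINT r:{s<..t}. \<phi> x * divergence (E_eps E \<epsilon>) (J r) x)
      = (LBINT r:{s<..t}. \<Sum>x\<in>X_eps \<epsilon>. \<phi> x * divergence (E_eps E \<epsilon>) (J r) x)"
    unfolding set_lebesgue_integral_def scaleR_sum_right
    by (rule Bochner_Integration.integral_sum[symmetric])
      (use int in \<open>auto simp: set_integrable_def mult.left_commute\<close>)
  finally show ?thesis .
qed

text \<open>With constant weights the summation by parts leaves nothing.\<close>

lemma mass_conserved:
  assumes "s \<in> {a<..<b}" "t \<in> {a<..<b}"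
  shows "(\<Sum>x\<in>X_eps \<epsilon>. m s x) = (\<Sum>x\<in>X_eps \<epsilon>. m t x)"
proof -
  have *: "(\<Sum>x\<in>X_eps \<epsilon>. m t x) = (\<Sum>x\<in>X_eps \<epsilon>. m s x)" if st: "a < s" "s < t" "t < b" for s t
  proof -
    have "(\<Sum>x\<in>X_eps \<epsilon>. 1 * divergence (E_eps E \<epsilon>) (J r) x) = 0" if "r \<in> {s<..t}" for r
      using sum_divergence_gradient[OF E \<epsilon> CE_antisym, of r "\<lambda>_. 1"] that st by simp
    then have "(LBINT r:{s<..t}. \<Sum>x\<in>X_eps \<epsilon>. 1 * divergence (E_eps E \<epsilon>) (J r) x) = (LBINT r:{s<..t}. 0)"
      by (intro set_lebesgue_integral_cong) auto
    then show ?thesis using weighted_mass_increment[OF st, of "\<lambda>_. 1"] by simp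
  qed
  consider "s < t" | "s = t" | "t < s" by linarith
  then show ?thesis by cases (use *[of s t] *[of t s] assms in auto)
qed

text \<open>The mass is constant, so it is its own average over the time interval.\<close>

lemma mass_bound:
  assumes "total_mass \<epsilon> {a<..<b} m \<le> ennreal M" "0 \<le> M" "t \<in> {a<..<b}"
  shows "(\<Sum>x\<in>X_eps \<epsilon>. m t x) \<le> M / (b - a)"
proof -
  let ?c = "\<Sum>x\<in>X_eps \<epsilon>. m t x"
  have c: "0 \<le> ?c" by (intro sum_nonneg CE_nonneg assms)
  have "total_mass \<epsilon> {a<..<b} m = (\<integral>\<^sup>+r. ennreal ?c * indicator {a<..<b} r \<partial>lborel)"
    unfolding total_mass_def using mass_conserved[OF assms(3)]
    by (intro nn_integral_cong) (auto simp: indicator_def)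
  also have "\<dots> = ennreal ?c * ennreal (b - a)" using ab by (simp add: nn_integral_cmult_indicator)
  also have "\<dots> = ennreal (?c * (b - a))" using c ab by (simp add: ennreal_mult)
  finally have "ennreal (?c * (b - a)) \<le> ennreal M" using assms(1) by simp
  then have "?c * (b - a) \<le> M" using assms(2) by (simp add: ennreal_le_iff)
  then show ?thesis using ab by (simp add: field_simps)
qed

lemma integral_embed_CE:
  fixes f :: "'d torus \<Rightarrow> real"
  assumes "t \<in> {a<..<b}" "f \<in> borel_measurable borel" "\<And>p. \<bar>f p\<bar> \<le> B"
  shows "(\<integral>p. f p \<partial>embed \<epsilon> (m t)) = (\<Sum>x\<in>X_eps \<epsilon>. m t x * cell_average \<epsilon> f x)"
  by (rule integral_embed[OF \<epsilon> CE_nonneg[OF assms(1)] assms(2,3)])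

lemma continuous_integral_embed:
  fixes f :: "'d torus \<Rightarrow> real"
  assumes "f \<in> borel_measurable borel" "\<And>p. \<bar>f p\<bar> \<le> B"
  shows "continuous_on {a<..<b} (\<lambda>t. \<integral>p. f p \<partial>embed \<epsilon> (m t))"
proof -
  have "continuous_on {a<..<b} (\<lambda>t. \<Sum>x\<in>X_eps \<epsilon>. m t x * cell_average \<epsilon> f x)"
    by (intro continuous_on_sum continuous_on_mult CE_continuous continuous_on_const)
  then show ?thesis
    by (rule continuous_on_eq) (simp add: integral_embed_CE[OF _ assms])
qed

lemma integral_embed_1_conserved:
  assumes "s \<in> {a<..<b}" "t \<in> {a<..<b}"
  shows "(\<integral>p. 1 \<partial>embed \<epsilon> (m s)) = (\<integral>p. (1::real) \<partial>embed \<epsilon> (m t))"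
proof (cases "X_eps \<epsilon> = ({} :: ('d torus \<times> 'v) set)")
  case True
  then show ?thesis using integral_embed_CE[of _ "\<lambda>_. 1" 1] assms by simp
next
  case False
  then obtain x0 :: "'d torus \<times> 'v" where x0: "x0 \<in> X_eps \<epsilon>" by blast
  have "(\<integral>p. 1 \<partial>embed \<epsilon> (m t)) = (\<Sum>x\<in>X_eps \<epsilon>. m t x) * cell_average \<epsilon> (\<lambda>_. 1) x0" if "t \<in> {a<..<b}" for t
  proof -
    have "(\<integral>p. 1 \<partial>embed \<epsilon> (m t)) = (\<Sum>x\<in>X_eps \<epsilon>. m t x * cell_average \<epsilon> (\<lambda>_. 1) x)"
      by (rule integral_embed_CE[OF that]) auto
    also have "\<dots> = (\<Sum>x\<in>X_eps \<epsilon>. m t x * cell_average \<epsilon> (\<lambda>_. 1) x0)"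
      by (intro sum.cong refl arg_cong2[where f = "(*)"] cell_average_const[OF \<epsilon> _ x0])
    finally show ?thesis by (simp add: sum_distrib_right)
  qed
  then show ?thesis using assms mass_conserved[OF assms] by simp
qed

lemma abs_integral_embed_le:
  fixes f :: "'d torus \<Rightarrow> real"
  assumes "t \<in> {a<..<b}" "f \<in> borel_measurable borel" "\<And>p. \<bar>f p\<bar> \<le> B"
  shows "\<bar>\<integral>p. f p \<partial>embed \<epsilon> (m t)\<bar> \<le> (\<Sum>x\<in>X_eps \<epsilon>. m t x) * B"
proof -
  have "\<bar>\<integral>p. f p \<partial>embed \<epsilon> (m t)\<bar> \<le> (\<Sum>x\<in>X_eps \<epsilon>. \<bar>m t x * cell_average \<epsilon> f x\<bar>)"
    unfolding integral_embed_CE[OF assms] by (rule sum_abs)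
  also have "\<dots> \<le> (\<Sum>x\<in>X_eps \<epsilon>. m t x * B)"
    using CE_nonneg[OF assms(1)] abs_cell_average_le[OF \<epsilon> _ assms(2,3)]
    by (intro sum_mono) (auto simp: abs_mult intro!: mult_left_mono)
  finally show ?thesis by (simp add: sum_distrib_right)
qed

text \<open>Cell averages at the two ends of an edge differ by at most \<open>L\<close> times the length of the edge. This length
  is at most \<open>\<epsilon> D\<close>, and the factor \<open>\<epsilon>\<close> is the one in the flux intensity.\<close>

lemma abs_sum_average_divergence_le:
  fixes f :: "'d torus \<Rightarrow> real"
  assumes D: "\<And>\<epsilon> x y. \<epsilon> \<in> scales E \<Longrightarrow> (x, y) \<in> E_eps E \<epsilon> \<Longrightarrow>
    \<exists>w w'. fst x = to_torus w \<and> fst y = to_torus w' \<and> norm (w - w') \<le> \<epsilon> * D"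
    and f: "f \<in> borel_measurable borel" "\<And>p. \<bar>f p\<bar> \<le> B" "torus_lipschitz f L" "0 \<le> L"
    and t: "t \<in> {a<..<b}"
  shows "\<bar>\<Sum>x\<in>X_eps \<epsilon>. cell_average \<epsilon> f x * divergence (E_eps E \<epsilon>) (J t) x\<bar> \<le> L * D * flux_intensity E \<epsilon> J t"
proof -
  have "\<bar>\<Sum>x\<in>X_eps \<epsilon>. cell_average \<epsilon> f x * divergence (E_eps E \<epsilon>) (J t) x\<bar> \<le> (L * (\<epsilon> * D)) * (\<Sum>e\<in>E_eps E \<epsilon>. \<bar>J t e\<bar>)"
  proof (rule abs_sum_divergence_le[OF E \<epsilon> CE_antisym[OF t]])
    fix x y assume xy: "(x, y) \<in> E_eps E \<epsilon>"
    then have X: "x \<in> X_eps \<epsilon>" "y \<in> X_eps \<epsilon>" using E_eps_subset by blast+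
    obtain w w' where w: "fst x = to_torus w" "fst y = to_torus w'" "norm (w - w') \<le> \<epsilon> * D" using D[OF \<epsilon> xy] by blast
    have "\<bar>cell_average \<epsilon> f x - cell_average \<epsilon> f y\<bar> \<le> L * norm (w - w')"
      by (rule cell_average_lipschitz[OF \<epsilon> X f(1,2,3) w(1,2)])
    also have "\<dots> \<le> L * (\<epsilon> * D)" using w(3) f(4) by (rule mult_left_mono)
    finally show "\<bar>cell_average \<epsilon> f x - cell_average \<epsilon> f y\<bar> \<le> L * (\<epsilon> * D)" .
  qed
  then show ?thesis by (simp add: flux_intensity_def mult_ac)
qed

lemma integral_embed_increment_le:
  fixes f :: "'d torus \<Rightarrow> real"
  assumes D: "\<And>\<epsilon> x y. \<epsilon> \<in> scales E \<Longrightarrow> (x, y) \<in> E_eps E \<epsilon> \<Longrightarrow>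
    \<exists>w w'. fst x = to_torus w \<and> fst y = to_torus w' \<and> norm (w - w') \<le> \<epsilon> * D"
    and f: "f \<in> borel_measurable borel" "\<And>p. \<bar>f p\<bar> \<le> B" "torus_lipschitz f L" "0 \<le> L"
    and st: "a < s" "s < t" "t < b"
  shows "\<bar>(\<integral>p. f p \<partial>embed \<epsilon> (m t)) - (\<integral>p. f p \<partial>embed \<epsilon> (m s))\<bar> \<le> (LBINT r:{s<..t}. L * D * flux_intensity E \<epsilon> J r)"
proof -
  let ?g = "\<lambda>r. \<Sum>x\<in>X_eps \<epsilon>. cell_average \<epsilon> f x * divergence (E_eps E \<epsilon>) (J r) x"
  have sub: "{s<..t} \<subseteq> {a<..<b}" using st by auto
  have int: "integrable lborel (\<lambda>r. indicator {s<..t} r *\<^sub>R (L * D * flux_intensity E \<epsilon> J r))"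
    using set_integrable_mult_right[OF set_integrable_subset[OF int_h _ sub], of "L * D"] by (simp add: set_integrable_def)
  have "(\<integral>p. f p \<partial>embed \<epsilon> (m t)) - (\<integral>p. f p \<partial>embed \<epsilon> (m s)) = - (LBINT r:{s<..t}. ?g r)"
    using weighted_mass_increment[OF st, of "cell_average \<epsilon> f"] st
    by (simp add: integral_embed_CE[OF _ f(1,2)])
  then have "\<bar>(\<integral>p. f p \<partial>embed \<epsilon> (m t)) - (\<integral>p. f p \<partial>embed \<epsilon> (m s))\<bar> = \<bar>LBINT r:{s<..t}. ?g r\<bar>" by simp
  also have "\<dots> \<le> (\<integral>r. indicator {s<..t} r *\<^sub>R (L * D * flux_intensity E \<epsilon> J r) \<partial>lborel)"
    unfolding set_lebesgue_integral_def real_norm_def[symmetric]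
  proof (rule Bochner_Integration.integral_norm_bound_integral)
    show "integrable lborel (\<lambda>r. indicator {s<..t} r *\<^sub>R ?g r)"
    proof -
      have "set_integrable lborel {s<..t} (\<lambda>r. divergence (E_eps E \<epsilon>) (J r) x)" if "x \<in> X_eps \<epsilon>" for x
      proof (rule set_integrable_subset)
        show "set_integrable lborel {s..t} (\<lambda>r. divergence (E_eps E \<epsilon>) (J r) x)"
          by (rule CE_divergence_integrable[OF that]) (use st in auto)
      qed auto
      then show ?thesis unfolding scaleR_sum_right
        by (intro Bochner_Integration.integrable_sum) (auto simp: set_integrable_def mult.left_commute)
    qed
    show "norm (indicator {s<..t} r *\<^sub>R ?g r) \<le> indicator {s<..t} r *\<^sub>R (L * D * flux_intensity E \<epsilon> J r)" for r
      using abs_sum_average_divergence_le[OF D f, of r] sub by (auto simp: indicator_def)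
  qed (rule int)
  finally show ?thesis by (simp only: set_lebesgue_integral_def)
qed

text \<open>For fixed \<open>x\<close> the cell average of \<open>\<phi>\<^sub>t\<close> at \<open>x\<close> is a \<open>C\<^sup>1\<close> function of time with derivative the cell average
  of \<open>\<psi>\<^sub>t\<close>. Integration by parts in time at every site replaces \<open>\<psi>\<^sub>t\<close> and the density by \<open>\<phi>\<^sub>t\<close> and the
  divergence, to which the previous estimate applies because \<open>\<phi>\<^sub>t\<close> is 1-Lipschitz.\<close>

lemma integral_embed_test_curve_le:
  assumes D: "\<And>\<epsilon> x y. \<epsilon> \<in> scales E \<Longrightarrow> (x, y) \<in> E_eps E \<epsilon> \<Longrightarrow>
    \<exists>w w'. fst x = to_torus w \<and> fst y = to_torus w' \<and> norm (w - w') \<le> \<epsilon> * D" "0 \<le> D"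
    and \<phi>: "C1c_curve {a<..<b} \<phi> \<psi>" "\<And>t. t \<in> {a<..<b} \<Longrightarrow> C1_norm (\<phi> t) \<le> 1"
  shows "\<bar>LBINT t:{a<..<b}. \<integral>p. \<psi> t p \<partial>embed \<epsilon> (m t)\<bar> \<le> D * (LBINT t:{a<..<b}. flux_intensity E \<epsilon> J t)"
proof -
  let ?I = "{a<..<b}"
  let ?X = "X_eps \<epsilon> :: ('d torus \<times> 'v) set"
  let ?div = "\<lambda>t x. divergence (E_eps E \<epsilon>) (J t) x"
  have C1: "\<phi> t \<in> C1_torus" "\<psi> t \<in> C1_torus" for t using \<phi>(1) by (auto simp: C1c_curve_def)
  have meas: "f \<in> borel_measurable borel" if "f \<in> C1_torus" for f :: "'d torus \<Rightarrow> real"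
    by (rule borel_measurable_continuous_onI[OF C1_torus_continuous[OF that]])
  have avg_diff: "cell_average \<epsilon> (\<lambda>p. c * f p + d * g p) x = c * cell_average \<epsilon> f x + d * cell_average \<epsilon> g x"
    if x: "x \<in> ?X" and fg: "f \<in> C1_torus" "g \<in> C1_torus" for f g c d x
  proof -
    note int = integrable_unit_cube[OF measurable_to_torus_affine[OF meas[OF fg(1)]] C1_norm_upper(1)[OF fg(1)]]
      integrable_unit_cube[OF measurable_to_torus_affine[OF meas[OF fg(2)]] C1_norm_upper(1)[OF fg(2)]]
    let ?w = "scaled_site \<epsilon> (z_of \<epsilon> x)"
    have w: "fst x = to_torus ?w" by (rule z_of_X_eps(2)[OF \<epsilon> x])
    have m3: "(\<lambda>p. c * f p + d * g p) \<in> borel_measurable borel"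
      by (intro borel_measurable_add borel_measurable_times borel_measurable_const meas fg)
    show ?thesis
      unfolding cell_average_eq[OF \<epsilon> x meas[OF fg(1)] w] cell_average_eq[OF \<epsilon> x meas[OF fg(2)] w] cell_average_eq[OF \<epsilon> x m3 w]
      using int[of ?w \<epsilon>] by (simp add: distrib_left mult.left_commute)
  qed
  have avg_le: "\<bar>cell_average \<epsilon> f x\<bar> \<le> B"
    if "x \<in> ?X" "f \<in> borel_measurable borel" "\<And>p. \<bar>f p\<bar> \<le> B" for f x B
    by (rule abs_cell_average_le[OF \<epsilon> that])
  obtain K where K: "compact K" "K \<subseteq> ?I" "\<And>t. t \<notin> K \<Longrightarrow> \<phi> t = (\<lambda>p. 0)" using \<phi>(1) by (auto simp: C1c_curve_def)
  define u where "u x t = cell_average \<epsilon> (\<phi> t) x" for x :: "'d torus \<times> 'v" and t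
  define u' where "u' x t = cell_average \<epsilon> (\<psi> t) x" for x :: "'d torus \<times> 'v" and t
  have du: "(u x has_real_derivative u' x t) (at t)" if x: "x \<in> ?X" for x t
  proof -
    obtain g where g: "(g \<longlongrightarrow> 0) (at t)" "\<And>s p. \<bar>(\<phi> s p - \<phi> t p) / (s - t) - \<psi> t p\<bar> \<le> g s"
      using C1c_curve_dominated(1)[OF \<phi>(1), of t] by blast
    have "\<bar>(u x s - u x t) / (s - t) - u' x t\<bar> \<le> g s" for s
    proof -
      have d1: "(\<lambda>p. (1 / (s - t)) * \<phi> s p + (- 1 / (s - t)) * \<phi> t p) \<in> C1_torus" by (rule C1_torus_lincomb[OF C1(1) C1(1)])
      have "(u x s - u x t) / (s - t) - u' x t
          = cell_average \<epsilon> (\<lambda>p. 1 * ((1 / (s - t)) * \<phi> s p + (- 1 / (s - t)) * \<phi> t p) + (-1) * \<psi> t p) x"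
        unfolding avg_diff[OF x d1 C1(2)] avg_diff[OF x C1(1) C1(1)] u_def u'_def
        by (simp add: diff_divide_distrib)
      also have "\<bar>\<dots>\<bar> \<le> g s"
      proof (rule avg_le[OF x])
        show "(\<lambda>p. 1 * ((1 / (s - t)) * \<phi> s p + (- 1 / (s - t)) * \<phi> t p) + (-1) * \<psi> t p) \<in> borel_measurable borel"
          by (rule meas, rule C1_torus_lincomb[OF d1 C1(2)])
        show "\<bar>1 * ((1 / (s - t)) * \<phi> s p + (- 1 / (s - t)) * \<phi> t p) + (-1) * \<psi> t p\<bar> \<le> g s" for p
          using g(2)[of s p] by (simp add: diff_divide_distrib)
      qed
      finally show ?thesis .
    qed
    then have "((\<lambda>s. (u x s - u x t) / (s - t) - u' x t) \<longlongrightarrow> 0) (at t)"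
      by (intro Lim_null_comparison[OF always_eventually g(1)]) simp
    then have "((\<lambda>s. (u x s - u x t) / (s - t)) \<longlongrightarrow> u' x t) (at t)" by (simp add: LIM_zero_iff)
    then show ?thesis by (simp add: has_field_derivative_iff)
  qed
  have cu': "isCont (u' x) t" if x: "x \<in> ?X" for x t
  proof -
    obtain g where g: "(g \<longlongrightarrow> 0) (at t)" "\<And>s p. \<bar>\<psi> s p - \<psi> t p\<bar> \<le> g s"
      using C1c_curve_dominated(2)[OF \<phi>(1), of t] by blast
    have "\<bar>u' x s - u' x t\<bar> \<le> g s" for s
    proof -
      have "u' x s - u' x t = cell_average \<epsilon> (\<lambda>p. 1 * \<psi> s p + (-1) * \<psi> t p) x"
        unfolding avg_diff[OF x C1(2) C1(2)] u'_def by simp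
      also have "\<bar>\<dots>\<bar> \<le> g s"
        by (rule avg_le[OF x meas[OF C1_torus_lincomb[OF C1(2) C1(2)]]]) (use g(2) in simp)
      finally show ?thesis .
    qed
    then have "((\<lambda>s. u' x s - u' x t) \<longlongrightarrow> 0) (at t)"
      by (intro Lim_null_comparison[OF always_eventually g(1)]) simp
    then show ?thesis by (simp add: isCont_def LIM_zero_iff)
  qed
  have u0: "u x t = 0" if "t \<notin> K" for x t
    using K(3)[OF that] by (simp add: u_def cell_average_def)
  have u'0: "u' x t = 0" if x: "x \<in> ?X" and t: "t \<notin> K" for x t
  proof -
    have "open (- K)" using K(1) by (simp add: compact_imp_closed open_Compl)
    then have "\<forall>\<^sub>F s in nhds t. 0 = u x s"
      unfolding eventually_nhds using u0 t by (intro exI[of _ "- K"]) auto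
    then have "(u x has_real_derivative 0) (at t)"
      by (rule DERIV_cong_ev[THEN iffD1, OF refl _ refl]) simp
    then show ?thesis using du[OF x] DERIV_unique by blast
  qed
  have parts: "(LBINT t:?I. u' x t * m t x) = (LBINT t:?I. u x t * ?div t x)" if x: "x \<in> ?X" for x
    by (rule integral_by_parts_increment[OF CE_increment[OF x] CE_divergence_integrable[OF x] du[OF x] cu'[OF x] K(1,2) u0 ab])
  have cont_u: "continuous_on UNIV (u x)" "continuous_on UNIV (u' x)" if "x \<in> ?X" for x
    using DERIV_isCont[OF du[OF that]] cu'[OF that] by (auto intro!: continuous_at_imp_continuous_on)
  have int1: "integrable lborel (\<lambda>t. indicator ?I t *\<^sub>R (u' x t * m t x))" if x: "x \<in> ?X" for x
  proof -
    have iK: "integrable lborel (\<lambda>t. indicator K t *\<^sub>R (u' x t * m t x))"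
      by (rule borel_integrable_compact[OF K(1)])
        (intro continuous_on_mult continuous_on_subset[OF cont_u(2)[OF x] subset_UNIV] continuous_on_subset[OF CE_continuous[OF x] K(2)])
    have eq: "indicator K t *\<^sub>R (u' x t * m t x) = indicator ?I t *\<^sub>R (u' x t * m t x)" for t
      using u'0[OF x] K(2) by (cases "t \<in> K") auto
    show ?thesis using iK unfolding eq .
  qed
  have int2: "integrable lborel (\<lambda>t. indicator ?I t *\<^sub>R (u x t * ?div t x))" if x: "x \<in> ?X" for x
  proof -
    have "bounded (u x ` K)"
      by (intro compact_imp_bounded compact_continuous_image K continuous_on_subset[OF cont_u(1)[OF x] subset_UNIV])
    then obtain B where B: "\<forall>y\<in>u x ` K. norm y \<le> B" unfolding bounded_iff by blast
    have int_div: "integrable lborel (\<lambda>t. indicator K t *\<^sub>R ?div t x)"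
      using CE_divergence_integrable[OF x K(1,2)] by (simp add: set_integrable_def)
    have iK: "integrable lborel (\<lambda>t. u x t * (indicator K t *\<^sub>R ?div t x))"
    proof (rule Bochner_Integration.integrable_bound[OF integrable_mult_right[OF int_div, of B]])
      show "(\<lambda>t. u x t * (indicator K t *\<^sub>R ?div t x)) \<in> borel_measurable lborel"
        using borel_measurable_continuous_onI[OF cont_u(1)[OF x]] borel_measurable_integrable[OF int_div]
        by (intro borel_measurable_times) auto
      show "AE t in lborel. norm (u x t * (indicator K t *\<^sub>R ?div t x)) \<le> norm (B * (indicator K t *\<^sub>R ?div t x))"
      proof (intro always_eventually allI)
        fix t
        have "\<bar>u x t\<bar> \<le> \<bar>B\<bar>" if "t \<in> K" using B that by fastforce
        then show "norm (u x t * (indicator K t *\<^sub>R ?div t x)) \<le> norm (B * (indicator K t *\<^sub>R ?div t x))"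
          by (cases "t \<in> K") (auto simp: abs_mult mult_right_mono)
      qed
    qed
    have eq: "u x t * (indicator K t *\<^sub>R ?div t x) = indicator ?I t *\<^sub>R (u x t * ?div t x)" for t
      using u0 K(2) by (cases "t \<in> K") auto
    show ?thesis using iK unfolding eq .
  qed
  have "(LBINT t:?I. \<integral>p. \<psi> t p \<partial>embed \<epsilon> (m t)) = (LBINT t:?I. \<Sum>x\<in>?X. u' x t * m t x)"
  proof (rule set_lebesgue_integral_cong)
    show "\<forall>t. t \<in> ?I \<longrightarrow> (\<integral>p. \<psi> t p \<partial>embed \<epsilon> (m t)) = (\<Sum>x\<in>?X. u' x t * m t x)"
      using integral_embed_CE[OF _ meas[OF C1(2)] C1_norm_upper(1)[OF C1(2)]] by (simp add: u'_def mult.commute)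
  qed simp
  also have "\<dots> = (\<Sum>x\<in>?X. LBINT t:?I. u' x t * m t x)"
    unfolding set_lebesgue_integral_def scaleR_sum_right by (rule Bochner_Integration.integral_sum) (rule int1)
  also have "\<dots> = (\<Sum>x\<in>?X. LBINT t:?I. u x t * ?div t x)" by (intro sum.cong refl parts)
  also have "\<dots> = (LBINT t:?I. \<Sum>x\<in>?X. u x t * ?div t x)"
    unfolding set_lebesgue_integral_def scaleR_sum_right by (rule Bochner_Integration.integral_sum[symmetric]) (rule int2)
  finally have eq: "(LBINT t:?I. \<integral>p. \<psi> t p \<partial>embed \<epsilon> (m t)) = (LBINT t:?I. \<Sum>x\<in>?X. u x t * ?div t x)" .
  have "\<bar>LBINT t:?I. \<Sum>x\<in>?X. u x t * ?div t x\<bar> \<le> (\<integral>t. indicator ?I t *\<^sub>R (D * flux_intensity E \<epsilon> J t) \<partial>lborel)"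
    unfolding set_lebesgue_integral_def real_norm_def[symmetric]
  proof (rule Bochner_Integration.integral_norm_bound_integral)
    show "integrable lborel (\<lambda>t. indicator ?I t *\<^sub>R (\<Sum>x\<in>?X. u x t * ?div t x))"
      unfolding scaleR_sum_right by (rule Bochner_Integration.integrable_sum) (rule int2)
    show "integrable lborel (\<lambda>t. indicator ?I t *\<^sub>R (D * flux_intensity E \<epsilon> J t))"
      using set_integrable_mult_right[OF int_h, of D] by (simp add: set_integrable_def)
    fix t
    show "norm (indicator ?I t *\<^sub>R (\<Sum>x\<in>?X. u x t * ?div t x)) \<le> indicator ?I t *\<^sub>R (D * flux_intensity E \<epsilon> J t)"
    proof (cases "t \<in> ?I")
      case True
      have lip: "torus_lipschitz (\<phi> t) 1"
        unfolding torus_lipschitz_def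
      proof (intro allI)
        fix x y
        have "\<bar>\<phi> t (to_torus x) - \<phi> t (to_torus y)\<bar> \<le> C1_norm (\<phi> t) * norm (x - y)"
          using C1_torus_lipschitz[OF C1(1)] unfolding torus_lipschitz_def by blast
        also have "\<dots> \<le> 1 * norm (x - y)" by (intro mult_right_mono \<phi>(2)[OF True]) simp
        finally show "\<bar>\<phi> t (to_torus x) - \<phi> t (to_torus y)\<bar> \<le> 1 * norm (x - y)" .
      qed
      have "\<bar>\<Sum>x\<in>?X. u x t * ?div t x\<bar> \<le> 1 * D * flux_intensity E \<epsilon> J t"
        unfolding u_def
        by (rule abs_sum_average_divergence_le[OF D(1) meas[OF C1(1)] C1_norm_upper(1)[OF C1(1)] lip _ True]) simp_all
      then show ?thesis using True by simp
    qed simp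
  qed
  also have "\<dots> = D * (LBINT t:?I. flux_intensity E \<epsilon> J t)"
    by (simp add: set_lebesgue_integral_def mult.left_commute)
  finally show ?thesis by (simp add: eq)
qed

end

section \<open>Compactness\<close>

text \<open>Uniform approximation by trigonometric polynomials changes the integrals by at most the error times
  the common bound of the masses, so the integrals of \<open>f\<close> form a Cauchy sequence.\<close>

lemma trig_monomials_determine_convergence:
  fixes \<nu> :: "nat \<Rightarrow> ('d::finite) torus measure" and f :: "'d torus \<Rightarrow> real"
  assumes \<nu>: "\<And>n. sets (\<nu> n) = sets borel" "\<And>n. finite_measure (\<nu> n)" "\<And>n. measure (\<nu> n) UNIV \<le> C"
    and conv: "\<And>\<alpha> \<beta>. convergent (\<lambda>n. \<integral>p. trig_monomial \<alpha> \<beta> p \<partial>\<nu> n)"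
    and f: "continuous_on UNIV f"
  shows "convergent (\<lambda>n. \<integral>p. f p \<partial>\<nu> n)"
proof -
  have int: "integrable (\<nu> n) g" if g: "continuous_on UNIV g" for n and g :: "'d torus \<Rightarrow> real"
  proof -
    interpret finite_measure "\<nu> n" by (rule \<nu>(2))
    obtain B where B: "\<And>p. \<bar>g p\<bar> \<le> B" using bounded_continuous_torus[OF g] by blast
    have "g \<in> borel_measurable (\<nu> n)"
      unfolding measurable_cong_sets[OF \<nu>(1) refl] by (rule borel_measurable_continuous_onI[OF g])
    then show ?thesis by (intro integrable_const_bound[of _ B]) (use B in auto)
  qed
  have poly: "convergent (\<lambda>n. \<integral>p. g p \<partial>\<nu> n)" if "trig_polynomial g" for g
    using that
  proof induction
    case (monomial \<alpha> \<beta>)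
    show ?case by (rule conv)
  next
    case (scale g c)
    then show ?case by (auto intro: convergent_mult convergent_const)
  next
    case (add g h)
    have "(\<integral>p. g p + h p \<partial>\<nu> n) = (\<integral>p. g p \<partial>\<nu> n) + (\<integral>p. h p \<partial>\<nu> n)" for n
      by (intro Bochner_Integration.integral_add int continuous_trig_polynomial add)
    then show ?case using convergent_add[OF add.IH] by simp
  qed
  have C: "0 \<le> C" using \<nu>(3) measure_nonneg order_trans by blast
  have "Cauchy (\<lambda>n. \<integral>p. f p \<partial>\<nu> n)"
  proof (rule CauchyI)
    fix e :: real assume "0 < e"
    \<comment> \<open>\<open>C + 1\<close> instead of \<open>C\<close>, which may be zero.\<close>
    define \<delta> where "\<delta> = e / (3 * (C + 1))"
    have \<delta>: "0 < \<delta>" "\<delta> * C \<le> e / 3"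
      using \<open>0 < e\<close> C by (auto simp: \<delta>_def field_simps)
    obtain g where g: "trig_polynomial g" "\<And>p. \<bar>f p - g p\<bar> < \<delta>"
      using trig_polynomial_dense[OF f \<delta>(1)] by blast
    have close: "\<bar>(\<integral>p. f p \<partial>\<nu> n) - (\<integral>p. g p \<partial>\<nu> n)\<bar> \<le> e / 3" for n
    proof -
      interpret finite_measure "\<nu> n" by (rule \<nu>(2))
      have sp: "space (\<nu> n) = UNIV" using sets_eq_imp_space_eq[OF \<nu>(1)] by simp
      note cg = continuous_trig_polynomial[OF g(1)]
      have "(\<integral>p. f p \<partial>\<nu> n) - (\<integral>p. g p \<partial>\<nu> n) = (\<integral>p. f p - g p \<partial>\<nu> n)"
        by (rule Bochner_Integration.integral_diff[OF int[OF f] int[OF cg], symmetric])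
      also have "\<bar>\<dots>\<bar> \<le> (\<integral>p. \<bar>f p - g p\<bar> \<partial>\<nu> n)" by (rule integral_abs_bound)
      also have "\<dots> \<le> (\<integral>p. \<delta> \<partial>\<nu> n)"
        by (intro integral_mono integrable_abs int continuous_on_diff f cg) (use g(2) in \<open>auto intro: less_imp_le\<close>)
      also have "\<dots> = \<delta> * measure (\<nu> n) UNIV" by (simp add: sp)
      also have "\<dots> \<le> \<delta> * C" using \<nu>(3) \<delta>(1) by (intro mult_left_mono) auto
      finally show ?thesis using \<delta>(2) by simp
    qed
    have "Cauchy (\<lambda>n. \<integral>p. g p \<partial>\<nu> n)" using poly[OF g(1)] by (simp add: Cauchy_convergent_iff)
    from CauchyD[OF this, of "e / 3"] \<open>0 < e\<close> obtain N where
      N: "\<And>m n. N \<le> m \<Longrightarrow> N \<le> n \<Longrightarrow> norm ((\<integral>p. g p \<partial>\<nu> m) - (\<integral>p. g p \<partial>\<nu> n)) < e / 3" by auto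
    show "\<exists>M. \<forall>m\<ge>M. \<forall>n\<ge>M. norm ((\<integral>p. f p \<partial>\<nu> m) - (\<integral>p. f p \<partial>\<nu> n)) < e"
    proof (intro exI[of _ N] allI impI)
      fix m n assume "N \<le> m" "N \<le> n"
      from N[OF this] close[of m] close[of n]
      show "norm ((\<integral>p. f p \<partial>\<nu> m) - (\<integral>p. f p \<partial>\<nu> n)) < e" unfolding real_norm_def by linarith
    qed
  qed
  then show ?thesis by (simp add: Cauchy_convergent_iff)
qed

text \<open>Weak compactness provides a limit along some subsequence; since the integrals of every continuous
  function converge along the whole sequence, so do the measures.\<close>

lemma torus_measures_converge:
  fixes \<nu> :: "nat \<Rightarrow> ('d::finite) torus measure"
  assumes \<nu>: "\<And>n. sets (\<nu> n) = sets borel" "\<And>n. finite_measure (\<nu> n)" "\<And>n. measure (\<nu> n) UNIV \<le> C"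
    and conv: "\<And>\<alpha> \<beta>. convergent (\<lambda>n. \<integral>p. trig_monomial \<alpha> \<beta> p \<partial>\<nu> n)"
  shows "\<exists>\<mu>. sets \<mu> = sets borel \<and> finite_measure \<mu> \<and>
    (\<forall>f :: 'd torus \<Rightarrow> real. continuous_on UNIV f \<longrightarrow> (\<lambda>n. \<integral>p. f p \<partial>\<nu> n) \<longlonglongrightarrow> (\<integral>p. f p \<partial>\<mu>))"
proof -
  obtain r \<mu> where r: "strict_mono (r :: nat \<Rightarrow> nat)" and \<mu>: "sets \<mu> = sets borel" "finite_measure \<mu>"
    and lim: "\<forall>f :: 'd torus \<Rightarrow> real. continuous_on UNIV f \<longrightarrow> (\<lambda>n. \<integral>p. f p \<partial>\<nu> (r n)) \<longlonglongrightarrow> (\<integral>p. f p \<partial>\<mu>)"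
    using torus_finite_measures_weakly_compact[of \<nu> C, OF \<nu>] by (elim exE conjE) (rule that)
  have "(\<lambda>n. \<integral>p. f p \<partial>\<nu> n) \<longlonglongrightarrow> (\<integral>p. f p \<partial>\<mu>)" if f: "continuous_on UNIV f" for f :: "'d torus \<Rightarrow> real"
  proof -
    obtain l where l: "(\<lambda>n. \<integral>p. f p \<partial>\<nu> n) \<longlonglongrightarrow> l"
      using trig_monomials_determine_convergence[of \<nu> C f, OF \<nu> conv f] unfolding convergent_def by (elim exE) (rule that)
    have "(\<lambda>n. \<integral>p. f p \<partial>\<nu> (r n)) \<longlonglongrightarrow> l"
      using LIMSEQ_subseq_LIMSEQ[OF l r] by (simp add: comp_def)
    from LIMSEQ_unique[OF this lim[rule_format, OF f]] show ?thesis using l by simp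
  qed
  then show ?thesis using \<mu> by blast
qed

text \<open>A diagonal sequence: each \<open>v j\<close> contributes a countable exceptional set, and so does their union.\<close>

lemma common_subsequence_off_countable:
  fixes v :: "nat \<Rightarrow> nat \<Rightarrow> real \<Rightarrow> real"
  assumes "\<And>j s. strict_mono (s :: nat \<Rightarrow> nat) \<Longrightarrow>
    \<exists>r N. strict_mono (r :: nat \<Rightarrow> nat) \<and> countable N \<and> (\<forall>t\<in>I - N. convergent (\<lambda>n. v j (s (r n)) t))"
  shows "\<exists>r N. strict_mono (r :: nat \<Rightarrow> nat) \<and> countable N \<and> (\<forall>j. \<forall>t\<in>I - N. convergent (\<lambda>n. v j (r n) t))"
proof -
  define P where "P j s \<longleftrightarrow> (\<exists>N. countable N \<and> (\<forall>t\<in>I - N. convergent (\<lambda>n. v j (s n) t)))"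
    for j and s :: "nat \<Rightarrow> nat"
  interpret subseqs P
  proof
    fix j :: nat and s :: "nat \<Rightarrow> nat" assume "strict_mono s"
    from assms[OF this, of j] show "\<exists>r'. strict_mono r' \<and> P j (s \<circ> r')"
      unfolding P_def by (simp add: comp_def)
  qed
  have stable: "P j (s \<circ> r)" if r: "strict_mono r" and Ps: "P j s" for r s j
  proof -
    obtain N where "countable N" "\<forall>t\<in>I - N. convergent (\<lambda>n. v j (s n) t)" using Ps unfolding P_def by blast
    then show ?thesis unfolding P_def using convergent_subseq_convergent[OF _ r]
      by (intro exI[of _ N]) (auto simp: comp_def)
  qed
  have "P j diagseq" for j
  proof -
    obtain N where N: "countable N" "\<forall>t\<in>I - N. convergent (\<lambda>n. v j ((diagseq \<circ> (+) (Suc j)) n) t)"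
      using diagseq_holds[OF stable, of j] unfolding P_def by blast
    have "convergent (\<lambda>n. v j (diagseq n) t)" if "t \<in> I - N" for t
      using N(2) that convergent_ignore_initial_segment[of "\<lambda>n. v j (diagseq n) t" "Suc j"]
      by (simp add: comp_def add.commute)
    then show ?thesis unfolding P_def using N(1) by blast
  qed
  then have "\<forall>j. \<exists>N. countable N \<and> (\<forall>t\<in>I - N. convergent (\<lambda>n. v j (diagseq n) t))"
    by (simp add: P_def)
  from choice[OF this] obtain N where
    N: "\<forall>j. countable (N j) \<and> (\<forall>t\<in>I - N j. convergent (\<lambda>n. v j (diagseq n) t))" ..
  show ?thesis
  proof (intro exI conjI)
    show "strict_mono diagseq" by (rule subseq_diagseq)
    show "countable (\<Union>j. N j)" using N by simp
    show "\<forall>j. \<forall>t\<in>I - (\<Union>j. N j). convergent (\<lambda>n. v j (diagseq n) t)" using N by blast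
  qed
qed

theorem theorem5p4:
  fixes E :: "(('d::finite, 'v::finite) site \<times> ('d, 'v) site) set"
    and F :: "('d, 'v) cost"
    and a b :: real
    and m :: "real \<Rightarrow> real \<Rightarrow> 'd torus \<times> 'v \<Rightarrow> real"
    and eps :: "nat \<Rightarrow> real"
  assumes "periodic_graph E"
    and "admissible_cost E F"
    and "a < b"
    and "\<And>\<epsilon>. \<epsilon> \<in> scales E \<Longrightarrow> density_curve \<epsilon> {a<..<b} (m \<epsilon>)"
    and "(SUP \<epsilon>\<in>scales E. action E F \<epsilon> {a<..<b} (m \<epsilon>)) < \<infinity>"
    and "(SUP \<epsilon>\<in>scales E. total_mass \<epsilon> {a<..<b} (m \<epsilon>)) < \<infinity>"
    and "\<And>k. eps k \<in> scales E" and "eps \<longlonglongrightarrow> 0"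
  shows "\<exists>\<mu>\<in>BV_KR {a<..<b}. \<exists>r :: nat \<Rightarrow> nat. strict_mono r \<and>
    weakly_converges ({a<..<b} \<times> UNIV)
      (\<lambda>k. spacetime {a<..<b} (\<lambda>t. embed (eps (r k)) (m (eps (r k)) t)))
      (spacetime {a<..<b} \<mu>) \<and>
    (AE t\<in>{a<..<b} in lborel.
      weakly_converges UNIV (\<lambda>k. embed (eps (r k)) (m (eps (r k)) t)) (\<mu> t)) \<and>
    (\<exists>c. \<forall>t\<in>{a<..<b}. emeasure (\<mu> t) UNIV = c)"
proof -
  let ?I = "{a<..<b}"
  note E = assms(1) and F = assms(2) and ab = assms(3) and eps = assms(7)
  \<comment> \<open>The bounds are real numbers above the suprema; strictness for the action provides a flux with
    energy below \<open>A\<close>.\<close>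
  obtain A where A: "0 \<le> A" "\<And>\<epsilon>. \<epsilon> \<in> scales E \<Longrightarrow> action E F \<epsilon> ?I (m \<epsilon>) < ereal A"
  proof -
    define S where "S = (SUP \<epsilon>\<in>scales E. action E F \<epsilon> ?I (m \<epsilon>))"
    obtain A where A: "S < ereal A" "0 < A"
    proof (cases S)
      case (real x)
      then show thesis using that[of "\<bar>x\<bar> + 1"] by simp
    next
      case PInf
      then show thesis using assms(5) by (simp add: S_def)
    next
      case MInf
      then show thesis using that[of 1] by simp
    qed
    have "action E F \<epsilon> ?I (m \<epsilon>) < ereal A" if "\<epsilon> \<in> scales E" for \<epsilon>
      using SUP_upper[OF that, of "\<lambda>\<epsilon>. action E F \<epsilon> ?I (m \<epsilon>)"] A(1) unfolding S_def by (rule le_less_trans)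
    then show thesis using that A(2) by (meson less_imp_le)
  qed
  obtain M where M: "0 \<le> M" "\<And>\<epsilon>. \<epsilon> \<in> scales E \<Longrightarrow> total_mass \<epsilon> ?I (m \<epsilon>) \<le> ennreal M"
  proof -
    define S where "S = (SUP \<epsilon>\<in>scales E. total_mass \<epsilon> ?I (m \<epsilon>))"
    have "S < top" using assms(6) by (simp add: S_def)
    then have S: "S = ennreal (enn2real S)" by simp
    have "total_mass \<epsilon> ?I (m \<epsilon>) \<le> ennreal (enn2real S)" if "\<epsilon> \<in> scales E" for \<epsilon>
      using SUP_upper[OF that, of "\<lambda>\<epsilon>. total_mass \<epsilon> ?I (m \<epsilon>)"] S unfolding S_def by simp
    then show thesis using that[of "enn2real S"] by simp
  qed
  obtain K where K: "0 \<le> K" "\<And>\<epsilon> m. \<epsilon> \<in> scales E \<Longrightarrow> action E F \<epsilon> ?I m < ereal A \<Longrightarrow>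
    total_mass \<epsilon> ?I m \<le> ennreal M \<Longrightarrow>
    \<exists>J. CE E \<epsilon> ?I m J \<and> set_integrable lborel ?I (flux_intensity E \<epsilon> J) \<and>
      (LBINT t:?I. flux_intensity E \<epsilon> J t) \<le> K"
    using flux_intensity_bound[OF E F ab A(1) M(1)] by blast
  have "\<forall>k. \<exists>J. CE E (eps k) ?I (m (eps k)) J \<and> set_integrable lborel ?I (flux_intensity E (eps k) J) \<and>
      (LBINT t:?I. flux_intensity E (eps k) J t) \<le> K"
    using K(2)[OF eps A(2)[OF eps] M(2)[OF eps]] by blast
  then obtain J where J: "\<And>k. CE E (eps k) ?I (m (eps k)) (J k)"
    "\<And>k. set_integrable lborel ?I (flux_intensity E (eps k) (J k))"
    "\<And>k. (LBINT t:?I. flux_intensity E (eps k) (J k) t) \<le> K" by metis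
  obtain D where D: "0 \<le> D" "\<And>\<epsilon> x y. \<epsilon> \<in> scales E \<Longrightarrow> (x, y) \<in> E_eps E \<epsilon> \<Longrightarrow>
    \<exists>w w'. fst x = to_torus w \<and> fst y = to_torus w' \<and> norm (w - w') \<le> \<epsilon> * D"
    using edge_displacement[OF E] by blast
  define \<nu> where "\<nu> k t = embed (eps k) (m (eps k) t)" for k t
  define C where "C = M / (b - a)"
  have mass: "(\<Sum>x\<in>X_eps (eps k). m (eps k) t x) \<le> C" if "t \<in> ?I" for k t
    unfolding C_def by (rule mass_bound[OF E eps ab J(1) J(2) M(2)[OF eps] M(1) that])
  have sets\<nu>: "sets (\<nu> k t) = sets borel" for k t by (simp add: \<nu>_def)
  have fin\<nu>: "finite_measure (\<nu> k t)" if "t \<in> ?I" for k t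
    unfolding \<nu>_def by (rule finite_measure_embed[OF eps CE_nonneg[OF E eps ab J(1) J(2) that]])
  have int\<nu>_le: "\<bar>\<integral>p. f p \<partial>\<nu> k t\<bar> \<le> C * B"
    if t: "t \<in> ?I" and f: "f \<in> borel_measurable borel" "\<And>p. \<bar>f p\<bar> \<le> B" for k t B and f :: "'d torus \<Rightarrow> real"
  proof -
    have "\<bar>\<integral>p. f p \<partial>\<nu> k t\<bar> \<le> (\<Sum>x\<in>X_eps (eps k). m (eps k) t x) * B"
      unfolding \<nu>_def by (rule abs_integral_embed_le[OF E eps ab J(1) J(2) t f])
    also have "\<dots> \<le> C * B" using mass[OF t] order_trans[OF abs_ge_zero f(2)] by (rule mult_right_mono)
    finally show ?thesis .
  qed
  have mass\<nu>: "measure (\<nu> k t) UNIV \<le> C" if t: "t \<in> ?I" for k t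
  proof -
    have "space (\<nu> k t) = UNIV" using sets_eq_imp_space_eq[OF sets\<nu>] by simp
    then show ?thesis using int\<nu>_le[OF t, of "\<lambda>_. 1" 1 k] by simp
  qed
  have cont\<nu>: "continuous_on ?I (\<lambda>t. \<integral>p. f p \<partial>\<nu> k t)" if f: "continuous_on UNIV f" for k and f :: "'d torus \<Rightarrow> real"
  proof -
    obtain B where B: "\<And>p. \<bar>f p\<bar> \<le> B" using bounded_continuous_torus[OF f] by blast
    show ?thesis unfolding \<nu>_def
      by (rule continuous_integral_embed[OF E eps ab J(1) J(2) borel_measurable_continuous_onI[OF f] B])
  qed
  have \<nu>_curve: "measure_curve ?I C (\<nu> k)" for k
    unfolding measure_curve_def
  proof (intro conjI ballI)
    fix A :: "'d torus set" assume "A \<in> sets borel"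
    then show "(\<lambda>t. emeasure (\<nu> k t) A) \<in> borel_measurable (restrict_space borel ?I)"
      by (intro measurable_curve_if_integrals_measurable sets\<nu> fin\<nu> borel_measurable_continuous_on_restrict cont\<nu>)
  qed (use sets\<nu> fin\<nu> mass\<nu> in auto)

  \<comment> \<open>An enumeration of all trigonometric monomials.\<close>
  define \<tau> :: "nat \<Rightarrow> 'd torus \<Rightarrow> real"
    where "\<tau> j = trig_monomial (fst (from_nat j :: ('d \<Rightarrow> nat) \<times> ('d \<Rightarrow> nat))) (snd (from_nat j :: ('d \<Rightarrow> nat) \<times> ('d \<Rightarrow> nat)))" for j
  have \<tau>: "\<exists>\<alpha> \<beta>. \<tau> j = trig_monomial \<alpha> \<beta>" for j
    unfolding \<tau>_def by blast
  have \<tau>_surj: "trig_monomial \<alpha> \<beta> = \<tau> (to_nat (\<alpha>, \<beta>))" for \<alpha> \<beta> :: "'d \<Rightarrow> nat" by (simp add: \<tau>_def)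
  have "\<exists>r N. strict_mono (r :: nat \<Rightarrow> nat) \<and> countable N \<and>
    (\<forall>j. \<forall>t\<in>?I - N. convergent (\<lambda>n. \<integral>p. \<tau> j p \<partial>\<nu> (r n) t))"
  proof (rule common_subsequence_off_countable)
    fix j and s :: "nat \<Rightarrow> nat" assume "strict_mono s"
    have c: "continuous_on UNIV (\<tau> j)" using \<tau>[of j] continuous_trig_monomial by metis
    have bm: "\<tau> j \<in> borel_measurable borel" by (rule borel_measurable_continuous_onI[OF c])
    obtain B where B: "\<And>p. \<bar>\<tau> j p\<bar> \<le> B" using bounded_continuous_torus[OF c] by blast
    obtain L0 where L0: "torus_lipschitz (\<tau> j) L0" using \<tau>[of j] torus_lipschitz_trig_monomial by metis
    have L: "torus_lipschitz (\<tau> j) \<bar>L0\<bar>"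
      using L0 unfolding torus_lipschitz_def by (meson abs_ge_self mult_right_mono norm_ge_zero order_trans)
    let ?h = "\<lambda>k t. \<bar>L0\<bar> * D * flux_intensity E (eps k) (J k) t"
    show "\<exists>r N. strict_mono (r :: nat \<Rightarrow> nat) \<and> countable N \<and> (\<forall>t\<in>?I - N. convergent (\<lambda>n. \<integral>p. \<tau> j p \<partial>\<nu> (s (r n)) t))"
    proof (rule Helly_bounded_variation[where u = "\<lambda>n t. \<integral>p. \<tau> j p \<partial>\<nu> (s n) t" and h = "\<lambda>n. ?h (s n)"
          and B = "C * B" and C = "\<bar>L0\<bar> * D * K", OF ab])
      show "continuous_on ?I (\<lambda>t. \<integral>p. \<tau> j p \<partial>\<nu> (s n) t)" for n by (rule cont\<nu>[OF c])
      show "\<bar>\<integral>p. \<tau> j p \<partial>\<nu> (s n) t\<bar> \<le> C * B" if "t \<in> ?I" for n t by (rule int\<nu>_le[OF that bm B])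
      show "set_integrable lborel ?I (?h (s n))" for n by (rule set_integrable_mult_right) (rule J(2))
      show "0 \<le> ?h (s n) t" for n t
        using D(1) eps[of "s n"] by (simp add: flux_intensity_def sum_nonneg scales_def)
      show "(LBINT t:?I. ?h (s n) t) \<le> \<bar>L0\<bar> * D * K" for n
        using J(3)[of "s n"] D(1) by (simp add: mult_left_mono)
      show "\<bar>(\<integral>p. \<tau> j p \<partial>\<nu> (s n) t) - (\<integral>p. \<tau> j p \<partial>\<nu> (s n) t')\<bar> \<le> (LBINT r:{t'<..t}. ?h (s n) r)"
        if "a < t'" "t' < t" "t < b" for n t t'
        unfolding \<nu>_def
        by (rule integral_embed_increment_le[OF E eps ab J(1) J(2) D(2) bm B L _ that]) simp_all
    qed
  qed
  then obtain r N where r: "strict_mono (r :: nat \<Rightarrow> nat)" and N: "countable N"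
    and convN: "\<And>j t. t \<in> ?I - N \<Longrightarrow> convergent (\<lambda>n. \<integral>p. \<tau> j p \<partial>\<nu> (r n) t)" by blast
  have "\<forall>t\<in>?I - N. \<exists>\<mu>. sets \<mu> = sets borel \<and> finite_measure \<mu> \<and>
    (\<forall>f :: 'd torus \<Rightarrow> real. continuous_on UNIV f \<longrightarrow> (\<lambda>n. \<integral>p. f p \<partial>\<nu> (r n) t) \<longlonglongrightarrow> (\<integral>p. f p \<partial>\<mu>))"
  proof
    fix t assume t: "t \<in> ?I - N"
    show "\<exists>\<mu>. sets \<mu> = sets borel \<and> finite_measure \<mu> \<and>
      (\<forall>f :: 'd torus \<Rightarrow> real. continuous_on UNIV f \<longrightarrow> (\<lambda>n. \<integral>p. f p \<partial>\<nu> (r n) t) \<longlonglongrightarrow> (\<integral>p. f p \<partial>\<mu>))"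
    proof (rule torus_measures_converge[OF sets\<nu>])
      show "finite_measure (\<nu> (r n) t)" "measure (\<nu> (r n) t) UNIV \<le> C" for n using fin\<nu> mass\<nu> t by auto
      show "convergent (\<lambda>n. \<integral>p. trig_monomial \<alpha> \<beta> p \<partial>\<nu> (r n) t)" for \<alpha> \<beta>
        unfolding \<tau>_surj by (rule convN[OF t])
    qed
  qed
  from bchoice[OF this] obtain \<mu>0 where \<mu>0': "\<forall>t\<in>?I - N. sets (\<mu>0 t) = sets borel \<and> finite_measure (\<mu>0 t) \<and>
    (\<forall>f :: 'd torus \<Rightarrow> real. continuous_on UNIV f \<longrightarrow> (\<lambda>n. \<integral>p. f p \<partial>\<nu> (r n) t) \<longlonglongrightarrow> (\<integral>p. f p \<partial>\<mu>0 t))" ..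
  have \<mu>0: "sets (\<mu>0 t) = sets borel" "finite_measure (\<mu>0 t)"
    "continuous_on UNIV f \<Longrightarrow> (\<lambda>n. \<integral>p. f p \<partial>\<nu> (r n) t) \<longlonglongrightarrow> (\<integral>p. f p \<partial>\<mu>0 t)"
    if "t \<in> ?I - N" for t and f :: "'d torus \<Rightarrow> real"
    using \<mu>0' that by blast+
  have "?I - N \<noteq> {}"
  proof
    assume "?I - N = {}"
    then have "?I \<subseteq> N" by blast
    then have "countable ?I" using N by (rule countable_subset)
    then show False using uncountable_open_interval[of a b] ab by simp
  qed
  then obtain t0 where t0: "t0 \<in> ?I - N" by blast
  \<comment> \<open>At exceptional times any measure of the right mass will do; a single one keeps the curve measurable.\<close>
  define \<mu> where "\<mu> t = \<mu>0 (if t \<in> ?I - N then t else t0)" for t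
  have sets\<mu>: "sets (\<mu> t) = sets borel" and fin\<mu>: "finite_measure (\<mu> t)" for t
    unfolding \<mu>_def using \<mu>0(1,2)[of t] \<mu>0(1,2)[OF t0] by simp_all
  have lim: "(\<lambda>n. \<integral>p. f p \<partial>\<nu> (r n) t) \<longlonglongrightarrow> (\<integral>p. f p \<partial>\<mu> t)"
    if "t \<in> ?I - N" "continuous_on UNIV f" for t and f :: "'d torus \<Rightarrow> real"
    using \<mu>0(3)[OF that] that(1) by (simp add: \<mu>_def)
  have mass0: "measure (\<mu>0 t) UNIV = measure (\<mu>0 t0) UNIV" if t: "t \<in> ?I - N" for t
  proof -
    have sp: "space (\<mu>0 t) = UNIV" "space (\<mu>0 t0) = UNIV"
      using sets_eq_imp_space_eq[OF \<mu>0(1)[OF t]] sets_eq_imp_space_eq[OF \<mu>0(1)[OF t0]] by simp_all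
    have "(\<lambda>n. \<integral>p. 1 \<partial>\<nu> (r n) t) \<longlonglongrightarrow> (\<integral>p. (1::real) \<partial>\<mu>0 t)" by (rule \<mu>0(3)[OF t]) simp
    moreover have "(\<lambda>n. \<integral>p. 1 \<partial>\<nu> (r n) t0) \<longlonglongrightarrow> (\<integral>p. (1::real) \<partial>\<mu>0 t0)" by (rule \<mu>0(3)[OF t0]) simp
    moreover have "(\<integral>p. 1 \<partial>\<nu> (r n) t) = (\<integral>p. (1::real) \<partial>\<nu> (r n) t0)" for n
      unfolding \<nu>_def by (rule integral_embed_1_conserved[OF E eps ab J(1) J(2)]) (use t t0 in auto)
    ultimately have "(\<integral>p. (1::real) \<partial>\<mu>0 t) = (\<integral>p. (1::real) \<partial>\<mu>0 t0)" using LIMSEQ_unique by simp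
    then show ?thesis by (simp add: sp)
  qed
  have mass\<mu>: "measure (\<mu> t) UNIV = measure (\<mu>0 t0) UNIV" for t
    unfolding \<mu>_def by (cases "t \<in> ?I - N") (simp_all only: if_True if_False mass0)
  have mass\<mu>_le: "measure (\<mu> t) UNIV \<le> C" for t
  proof -
    have sp: "space (\<mu>0 t0) = UNIV" "space (\<nu> n t0) = UNIV" for n
      using sets_eq_imp_space_eq[OF \<mu>0(1)[OF t0]] sets_eq_imp_space_eq[OF sets\<nu>] by simp_all
    have "(\<lambda>n. \<integral>p. 1 \<partial>\<nu> (r n) t0) \<longlonglongrightarrow> (\<integral>p. (1::real) \<partial>\<mu>0 t0)" by (rule \<mu>0(3)[OF t0]) simp
    moreover have "(\<integral>p. (1::real) \<partial>\<nu> (r n) t0) \<le> C" for n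
    proof -
      have "t0 \<in> ?I" using t0 by blast
      from mass\<nu>[OF this, of "r n"] show ?thesis by (simp add: sp)
    qed
    ultimately have "(\<integral>p. (1::real) \<partial>\<mu>0 t0) \<le> C"
      by (intro LIMSEQ_le_const2) blast+
    then show ?thesis by (simp add: mass\<mu> sp)
  qed
  have Nb: "N \<in> sets borel" using N by (intro sets.countable[of N borel]) auto
  have \<mu>_curve: "measure_curve ?I C \<mu>"
    unfolding measure_curve_def
  proof (intro conjI ballI)
    fix A :: "'d torus set" assume A: "A \<in> sets borel"
    show "(\<lambda>t. emeasure (\<mu> t) A) \<in> borel_measurable (restrict_space borel ?I)"
    proof (rule measurable_curve_if_integrals_measurable[OF sets\<mu> fin\<mu> _ A])
      fix f :: "'d torus \<Rightarrow> real" assume f: "continuous_on UNIV f"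
      define V where "V n t = (if t \<in> N then \<integral>p. f p \<partial>\<mu>0 t0 else \<integral>p. f p \<partial>\<nu> (r n) t)" for n t
      have "V n \<in> borel_measurable (restrict_space borel ?I)" for n
        unfolding V_def[abs_def]
      proof (rule measurable_If)
        show "{t \<in> space (restrict_space borel ?I). t \<in> N} \<in> sets (restrict_space borel ?I)"
          using Nb by (auto simp: sets_restrict_space_iff space_restrict_space)
      qed (auto intro: borel_measurable_continuous_on_restrict cont\<nu>[OF f])
      moreover have "(\<lambda>n. V n t) \<longlonglongrightarrow> (\<integral>p. f p \<partial>\<mu> t)" if "t \<in> space (restrict_space borel ?I)" for t
      proof (cases "t \<in> N")
        case True
        then show ?thesis by (simp add: V_def \<mu>_def)
      next
        case False
        then show ?thesis using lim[of t f] that f by (simp add: V_def space_restrict_space)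
      qed
      ultimately show "(\<lambda>t. \<integral>p. f p \<partial>\<mu> t) \<in> borel_measurable (restrict_space borel ?I)"
        by (rule borel_measurable_LIMSEQ_metric)
    qed
  qed (use sets\<mu> fin\<mu> mass\<mu>_le in auto)

  have IU: "(?I \<times> UNIV :: (real \<times> 'd torus) set) \<in> sets borel"
    unfolding borel_prod[symmetric] by simp
  have st_eq: "(\<integral>z. f z \<partial>spacetime ?I \<kappa>) = (LBINT t:?I. \<integral>p. f (t, p) \<partial>\<kappa> t)"
    and st_int: "set_integrable lborel ?I (\<lambda>t. \<integral>p. f (t, p) \<partial>\<kappa> t)"
    if f: "continuous_on (?I \<times> UNIV) f" "\<And>z. z \<in> ?I \<times> UNIV \<Longrightarrow> \<bar>f z\<bar> \<le> B" and \<kappa>: "measure_curve ?I C \<kappa>"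
    for f :: "real \<times> 'd torus \<Rightarrow> real" and B \<kappa>
  proof -
    define g where "g z = indicator (?I \<times> UNIV) z *\<^sub>R f z" for z
    have gm: "g \<in> borel_measurable borel"
      unfolding g_def[abs_def] by (rule borel_measurable_continuous_on_indicator[OF IU f(1)])
    have gB: "\<bar>g z\<bar> \<le> \<bar>B\<bar>" for z using f(2)[of z] by (auto simp: g_def indicator_def)
    have gf: "g (t, p) = f (t, p)" if "t \<in> ?I" for t p using that by (simp add: g_def)
    note G = integral_spacetime[OF \<kappa> gm gB]
    have "(\<integral>z. f z \<partial>spacetime ?I \<kappa>) = (\<integral>z. g z \<partial>spacetime ?I \<kappa>)"
      by (rule Bochner_Integration.integral_cong) (auto simp: sets_spacetime(2) g_def)
    also have "\<dots> = (LBINT t:?I. \<integral>p. f (t, p) \<partial>\<kappa> t)"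
      unfolding G(2) by (rule set_lebesgue_integral_cong) (auto simp: gf)
    finally show "(\<integral>z. f z \<partial>spacetime ?I \<kappa>) = (LBINT t:?I. \<integral>p. f (t, p) \<partial>\<kappa> t)" .
    have "set_integrable lborel ?I (\<lambda>t. \<integral>p. g (t, p) \<partial>\<kappa> t) = set_integrable lborel ?I (\<lambda>t. \<integral>p. f (t, p) \<partial>\<kappa> t)"
      by (rule set_integrable_cong) (auto simp: gf)
    then show "set_integrable lborel ?I (\<lambda>t. \<integral>p. f (t, p) \<partial>\<kappa> t)" using G(1) by simp
  qed
  have AE_N: "AE t in lborel. t \<notin> N"
    using N by (intro AE_not_in countable_imp_null_set_lborel)
  have st_lim: "(\<lambda>n. LBINT t:?I. \<integral>p. f (t, p) \<partial>\<nu> (r n) t) \<longlonglongrightarrow> (LBINT t:?I. \<integral>p. f (t, p) \<partial>\<mu> t)"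
    if f: "continuous_on (?I \<times> UNIV) f" "\<And>z. z \<in> ?I \<times> UNIV \<Longrightarrow> \<bar>f z\<bar> \<le> B"
    for f :: "real \<times> 'd torus \<Rightarrow> real" and B
    unfolding set_lebesgue_integral_def
  proof (rule integral_dominated_convergence[where w = "\<lambda>t. indicator ?I t * (C * B)"])
    have slice: "continuous_on UNIV (\<lambda>p. f (t, p))" if "t \<in> ?I" for t
      by (rule continuous_on_compose2[OF f(1)]) (use that in \<open>auto intro!: continuous_intros\<close>)
    show "(\<lambda>t. indicator ?I t *\<^sub>R (\<integral>p. f (t, p) \<partial>\<mu> t)) \<in> borel_measurable lborel"
      using st_int[OF f \<mu>_curve] by (auto simp: set_integrable_def)
    show "(\<lambda>t. indicator ?I t *\<^sub>R (\<integral>p. f (t, p) \<partial>\<nu> (r n) t)) \<in> borel_measurable lborel" for n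
      using st_int[OF f \<nu>_curve] by (auto simp: set_integrable_def)
    show "integrable lborel (\<lambda>t. indicator ?I t * (C * B))"
      using emeasure_bounded_finite[of ?I] by (intro integrable_mult_left integrable_real_indicator) auto
    show "AE t in lborel. (\<lambda>n. indicator ?I t *\<^sub>R (\<integral>p. f (t, p) \<partial>\<nu> (r n) t)) \<longlonglongrightarrow> indicator ?I t *\<^sub>R (\<integral>p. f (t, p) \<partial>\<mu> t)"
      using AE_N
    proof eventually_elim
      case (elim t)
      show ?case
      proof (cases "t \<in> ?I")
        case True
        then show ?thesis using lim[OF _ slice, of t] elim by simp
      qed simp
    qed
    show "AE t in lborel. norm (indicator ?I t *\<^sub>R (\<integral>p. f (t, p) \<partial>\<nu> (r n) t)) \<le> indicator ?I t * (C * B)" for n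
    proof (intro always_eventually allI)
      fix t
      show "norm (indicator ?I t *\<^sub>R (\<integral>p. f (t, p) \<partial>\<nu> (r n) t)) \<le> indicator ?I t * (C * B)"
      proof (cases "t \<in> ?I")
        case True
        have "\<bar>\<integral>p. f (t, p) \<partial>\<nu> (r n) t\<bar> \<le> C * B"
          by (rule int\<nu>_le[OF True borel_measurable_continuous_onI[OF slice[OF True]]]) (use f(2) True in auto)
        then show ?thesis using True by simp
      qed simp
    qed
  qed

  have "weakly_converges (?I \<times> UNIV) (\<lambda>k. spacetime ?I (\<nu> (r k))) (spacetime ?I \<mu>)"
    unfolding weakly_converges_def
  proof (intro conjI allI impI spacetime_in_Mplus[OF \<nu>_curve] spacetime_in_Mplus[OF \<mu>_curve])
    fix f :: "real \<times> 'd torus \<Rightarrow> real"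
    assume f: "continuous_on (?I \<times> UNIV) f" "bounded (f ` (?I \<times> UNIV))"
    obtain B where B: "\<forall>y\<in>f ` (?I \<times> UNIV). norm y \<le> B" using f(2) unfolding bounded_iff by blast
    have fB: "\<bar>f z\<bar> \<le> B" if "z \<in> ?I \<times> UNIV" for z using B that by (metis imageI real_norm_def)
    show "(\<lambda>n. \<integral>z. f z \<partial>spacetime ?I (\<nu> (r n))) \<longlonglongrightarrow> (\<integral>z. f z \<partial>spacetime ?I \<mu>)"
    proof -
      have "(\<integral>z. f z \<partial>spacetime ?I (\<nu> k)) = (LBINT t:?I. \<integral>p. f (t, p) \<partial>\<nu> k t)" for k
        by (rule st_eq[OF f(1) fB \<nu>_curve])
      moreover have "(\<integral>z. f z \<partial>spacetime ?I \<mu>) = (LBINT t:?I. \<integral>p. f (t, p) \<partial>\<mu> t)"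
        by (rule st_eq[OF f(1) fB \<mu>_curve])
      moreover have "(\<lambda>n. LBINT t:?I. \<integral>p. f (t, p) \<partial>\<nu> (r n) t) \<longlonglongrightarrow> (LBINT t:?I. \<integral>p. f (t, p) \<partial>\<mu> t)"
        by (rule st_lim[OF f(1) fB])
      ultimately show ?thesis by (simp only:)
    qed
  qed
  moreover have "AE t\<in>?I in lborel. weakly_converges UNIV (\<lambda>k. \<nu> (r k) t) (\<mu> t)"
    using AE_N
  proof eventually_elim
    case (elim t)
    show ?case
    proof
      assume t: "t \<in> ?I"
      show "weakly_converges UNIV (\<lambda>k. \<nu> (r k) t) (\<mu> t)"
        unfolding weakly_converges_def Mplus_def
        using sets\<nu> sets\<mu> fin\<nu>[OF t] fin\<mu> lim[of t] t elim by simp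
    qed
  qed
  moreover have "\<forall>t\<in>?I. emeasure (\<mu> t) UNIV = ennreal (measure (\<mu>0 t0) UNIV)"
    using finite_measure.emeasure_eq_measure[OF fin\<mu>] mass\<mu> by simp
  moreover have "\<mu> \<in> BV_KR ?I"
    unfolding BV_KR_def mem_Collect_eq
  proof (intro conjI ballI allI impI)
    show "\<mu> t \<in> Mplus UNIV" for t using sets\<mu> fin\<mu> by (simp add: Mplus_def)
    show "(\<lambda>t. emeasure (\<mu> t) A) \<in> borel_measurable (restrict_space borel ?I)" if "A \<in> sets borel" for A
      using \<mu>_curve that by (simp add: measure_curve_def)
    have \<psi>: "continuous_on (?I \<times> UNIV) (\<lambda>z. \<psi> (fst z) (snd z))"
      "\<exists>B. \<forall>z. z \<in> ?I \<times> UNIV \<longrightarrow> \<bar>\<psi> (fst z) (snd z)\<bar> \<le> B"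
      if c: "C1c_curve ?I \<phi> \<psi>" for \<phi> \<psi> :: "real \<Rightarrow> 'd torus \<Rightarrow> real"
    proof -
      show "continuous_on (?I \<times> UNIV) (\<lambda>z. \<psi> (fst z) (snd z))"
        by (rule continuous_on_subset[OF C1c_curve_jointly_continuous[OF c]]) simp
      obtain B where "\<And>t p. t \<in> ?I \<Longrightarrow> \<bar>\<psi> t p\<bar> \<le> B" using C1c_curve_bounded[OF c] by blast
      then show "\<exists>B. \<forall>z. z \<in> ?I \<times> UNIV \<longrightarrow> \<bar>\<psi> (fst z) (snd z)\<bar> \<le> B" by auto
    qed
    show "set_integrable lborel ?I (\<lambda>t. \<integral>p. \<psi> t p \<partial>\<mu> t)" if c: "C1c_curve ?I \<phi> \<psi>" for \<phi> \<psi>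
    proof -
      obtain B where "\<And>z. z \<in> ?I \<times> UNIV \<Longrightarrow> \<bar>\<psi> (fst z) (snd z)\<bar> \<le> B" using \<psi>(2)[OF c] by blast
      from st_int[OF \<psi>(1)[OF c] this \<mu>_curve] show ?thesis by simp
    qed
    show "bdd_above {LBINT t:?I. (\<integral>p. \<psi> t p \<partial>\<mu> t) | \<phi> \<psi>. C1c_curve ?I \<phi> \<psi> \<and> (\<forall>t\<in>?I. C1_norm (\<phi> t) \<le> 1)}"
    proof (rule bdd_aboveI[of _ "D * K"])
      fix x assume "x \<in> {LBINT t:?I. (\<integral>p. \<psi> t p \<partial>\<mu> t) | \<phi> \<psi>. C1c_curve ?I \<phi> \<psi> \<and> (\<forall>t\<in>?I. C1_norm (\<phi> t) \<le> 1)}"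
      then obtain \<phi> \<psi> where x: "x = (LBINT t:?I. (\<integral>p. \<psi> t p \<partial>\<mu> t))" and c: "C1c_curve ?I \<phi> \<psi>"
        and \<phi>: "\<And>t. t \<in> ?I \<Longrightarrow> C1_norm (\<phi> t) \<le> 1" by blast
      obtain B where "\<And>z. z \<in> ?I \<times> UNIV \<Longrightarrow> \<bar>\<psi> (fst z) (snd z)\<bar> \<le> B" using \<psi>(2)[OF c] by blast
      from st_lim[OF \<psi>(1)[OF c] this]
      have "(\<lambda>n. LBINT t:?I. \<integral>p. \<psi> t p \<partial>\<nu> (r n) t) \<longlonglongrightarrow> x" by (simp add: x)
      moreover have "(LBINT t:?I. \<integral>p. \<psi> t p \<partial>\<nu> (r n) t) \<le> D * K" for n
      proof -
        have "\<bar>LBINT t:?I. \<integral>p. \<psi> t p \<partial>\<nu> (r n) t\<bar> \<le> D * (LBINT t:?I. flux_intensity E (eps (r n)) (J (r n)) t)"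
          unfolding \<nu>_def by (rule integral_embed_test_curve_le[OF E eps ab J(1) J(2) D(2) D(1) c \<phi>])
        also have "\<dots> \<le> D * K" by (rule mult_left_mono[OF J(3) D(1)])
        finally show ?thesis by linarith
      qed
      ultimately show "x \<le> D * K" by (intro LIMSEQ_le_const2[of _ x]) auto
    qed
  qed
  ultimately show ?thesis
    using r unfolding \<nu>_def by blast
qed

end
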